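(* Let $t>0$, $\alpha>0$, $m\in\{0,1\}$, $n\ge1$ an integer, $v_0=\frac n2$, $v_1=n+1$, and suppose $v_m>\frac\alpha2-1$. Then, given $N(t)=n$, the random process $X_m(G_\alpha(t))$ has the conditional distribution $$P\left\{X_m(G_\alpha(t))\in dx\,|\,N(t)=n\right\}=\frac{dx}{\Gamma\left(\frac{\alpha+1}{2}\right)B\left(\frac\alpha2,v_m-\frac\alpha2+1\right)}\int_0^1w^{\frac\alpha2-1}(1-w)^{v_m-\frac\alpha2}\,\frac{t}{\sqrt{\pi w}\,c}\left(\frac{t|x|}{2c\sqrt{w}}\right)^{\frac\alpha2}K_{-\frac\alpha2}\left(\frac{t|x|}{c\sqrt{w}}\right)dw .$$
   Context: Fix $c>0$, $\lambda>0$. For $m\in\{0,1\}$ let $X_m(s)=c\sum_{j=1}^{N(s)+1}(s_j-s_{j-1})\cos\theta_j$, where $N$ is a homogeneous Poisson process of rate $\lambda$ with event times $s_1<s_2<\cdots$, $s_0=0$, $s_{N(s)+1}=s$, and the $\theta_j$ are i.i.d. (independent of $N$) with density $\frac{\Gamma(m+1)}{\sqrt\pi\,\Gamma(m+\frac12)}\sin^{2m}\theta$ on $(0,\pi)$. For $n\ge1$ let $p_n^m(x,s)$ be the density of $X_m(s)$ given $N(s)=n$; explicitly $p_n^m(x,s)=\frac{\Gamma(v_m)\Gamma(v_m+1)}{2\pi\Gamma(2v_m)}\left(\frac{2}{cs}\right)^{2v_m}(c^2s^2-x^2)^{v_m-\frac12}$ for $|x|<cs$ and $0$ otherwise. $G_\alpha(t)$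 is a positive random variable, independent of $X_m$ and $N$, with Gamma density $g_\alpha(s,t)=\frac{t^\alpha}{\Gamma(\alpha)}s^{\alpha-1}e^{-ts}$, $s>0$. For an independent positive random time $T$, the conditional law $P\{X_m(T)\in dx\,|\,N(t)=n\}$ means the law of $X_m$ at time $T$ when the number of Poisson events up to that time is fixed to be $n$, i.e. $dx\int_0^\infty p_n^m(x,s)\,P\{T\in ds\}$. $B(a,b)=\Gamma(a)\Gamma(b)/\Gamma(a+b)$ is the Beta function, and $K_\mu(x)=\frac12\left(\frac x2\right)^\mu\int_0^\infty e^{-z-\frac{x^2}{4z}}z^{-\mu-1}dz$ ($x>0$) is the modified Bessel function of the second kind. Equalities of laws are equalities of Lebesgue densities (a.e. $x\in\mathbb{R}$). *)

theory Defs
  imports "HOL-Probability.Probability"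
begin

(* S j is the time of the j-th event for j >= 1, with S 0 = 0. *)
definition event_count :: "(nat \<Rightarrow> 'a \<Rightarrow> real) \<Rightarrow> real \<Rightarrow> 'a \<Rightarrow> nat" where
  "event_count S s \<omega> = card {j. 1 \<le> j \<and> S j \<omega> \<le> s}"

(* The convention s_{N(s)+1} = s closes the last, incomplete displacement at the current time. *)
definition random_motion ::
    "real \<Rightarrow> (nat \<Rightarrow> 'a \<Rightarrow> real) \<Rightarrow> (nat \<Rightarrow> 'a \<Rightarrow> real) \<Rightarrow> real \<Rightarrow> 'a \<Rightarrow> real" where
  "random_motion c S \<theta> s \<omega> =
     (let k = event_count S s \<omega>
      in c * (\<Sum>j = 1..k + 1.
           ((if j = k + 1 then s else S j \<omega>) - S (j - 1) \<omega>) * cos (\<theta> j \<omega>)))"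

definition angle_density :: "nat \<Rightarrow> real \<Rightarrow> real" where
  "angle_density m x =
     (if 0 < x \<and> x < pi
      then Gamma (real m + 1) / (sqrt pi * Gamma (real m + 1 / 2)) * sin x ^ (2 * m) else 0)"

definition gamma_density :: "real \<Rightarrow> real \<Rightarrow> real \<Rightarrow> real" where
  "gamma_density \<alpha> t s =
     (if 0 < s then t powr \<alpha> / Gamma \<alpha> * s powr (\<alpha> - 1) * exp (- t * s) else 0)"

(* The homogeneous Poisson process of rate l is given by its event times, whose successive gaps
   are i.i.d. exponential.  Mutual independence of all gaps (Inl) and all angles (Inr) says at
   once that the gaps are independent, the angles are independent, and that the angles are
   independent of the Poisson process.  The strict ordering S 1 < S 2 < ... holds almost surely. *)
definition poisson_motion ::
    "'a measure \<Rightarrow> real \<Rightarrow> nat \<Rightarrow> (nat \<Rightarrow> 'a \<Rightarrow> real) \<Rightarrow> (nat \<Rightarrow> 'a \<Rightarrow> real) \<Rightarrow> bool" where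
  "poisson_motion M l m S \<theta> \<longleftrightarrow>
     (\<forall>\<omega>\<in>space M. S 0 \<omega> = 0) \<and>
     (\<forall>j\<ge>1. distributed M lborel (\<lambda>\<omega>. S j \<omega> - S (j - 1) \<omega>) (exponential_density l)) \<and>
     (\<forall>j\<ge>1. distributed M lborel (\<theta> j) (angle_density m)) \<and>
     prob_space.indep_vars M (\<lambda>_. borel)
       (case_sum (\<lambda>j \<omega>. S j \<omega> - S (j - 1) \<omega>) \<theta>) ({1..} <+> {1..})"

(* The law of X at the random time T when the number of events up to that time is fixed to be n:
   the mixture, over the law of T, of the conditional laws of X s given N s = n.
   This is not the conditional law of X at time T given N T = n, which would reweight T. *)
definition fixed_count_law ::
    "'a measure \<Rightarrow> (real \<Rightarrow> 'a \<Rightarrow> real) \<Rightarrow> (real \<Rightarrow> 'a \<Rightarrow> nat) \<Rightarrow> nat \<Rightarrow> ('a \<Rightarrow> real) \<Rightarrow> real measure"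
  where
  "fixed_count_law M X N n T =
     distr M borel T \<bind>
       (\<lambda>s. distr (uniform_measure M {\<omega> \<in> space M. N s \<omega> = n}) borel (X s))"

definition bessel_K :: "real \<Rightarrow> real \<Rightarrow> real" where
  "bessel_K \<mu> x =
     1 / 2 * (x / 2) powr \<mu> *
       (LINT z:{0<..}|lborel. exp (- z - x\<^sup>2 / (4 * z)) * z powr (- \<mu> - 1))"

end

(* Given N(s) = n, the gaps between turns are uniform on a simplex, so X(s) is an affine image of a
   uniform convex combination of i.i.d. variables (1 - cos theta) / 2 in [0, 1].  If F is the
   generating function of the moments of one of these, then the k-th moment of the combination of
   n + 1 of them is n! k! / (n + k)! times the k-th coefficient of F^(n+1).  For m = 0 we have
   F = (1 - z)^(-1/2), and for m = 1 we have F(z) = C(z/4)^2 with C the Catalan generating function;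
   in both cases these are the moments of the Beta(v + 1/2, v + 1/2) law, and moments determine a
   law on [0, 1].

   The Gamma mixture of the resulting densities is brought to the Bessel form by writing exp (-s)
   as a mixture of the Gaussian kernels exp (-s^2 / (4 r)) and applying Kummer's transformation
   U(a, b, z) = z^(1 - b) U(a - b + 1, 2 - b, z) to the inner integral. *)
theory Submission
  imports Defs
begin

section \<open>Integral transformations\<close>

text \<open>The moment recursion and the final mixture are computed with
  \<open>ennreal\<close>-valued integrals, so orders of integration are exchanged without
  integrability proofs. The target formula, however, contains Bochner integrals (over w, and in
  \<open>bessel_K\<close>), whose value would be a meaningless 0 without integrability; finiteness
  is proved for these. Passing from cos theta to (1 - cos theta) / 2 serves the same end: moments of
  nonnegative variables fit into \<open>ennreal\<close>. The simplex law of the gaps is never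
  formed. The weighted sum grows by one step at a time, and the powers of the gap lengths are
  integrated by Beta integrals; their factorials cancel the binomial coefficients of the expanded
  power. This is why the ordinary generating function of the moments appears. The exponential
  factors multiply to exp (- l s) whatever the gaps are, which is the uniformity in analytic form.
  Kummer's transformation is used with a = v + 1/2 and c = v + 1 - \<alpha>/2; positivity of the
  latter is the hypothesis on v. The variable of the transformed integral becomes w, and the
  variance parameter r of the Gaussian mixture becomes z in the integral for K.\<close>

text \<open>Substitution for absolutely integrable functions is an equivalence: one side has the
  value \<open>b\<close> iff the other has. So a finite value on either side transfers, and in the
  only case left both sides are infinite.\<close>

lemma nn_integral_change_of_variables:
  fixes f g g' :: "real \<Rightarrow> real"
  assumes [measurable]: "S \<in> sets borel" "T \<in> sets borel"
    and [measurable]: "f \<in> borel_measurable borel" "g \<in> borel_measurable borel" "g' \<in> borel_measurable borel"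
    and deriv: "\<And>x. x \<in> S \<Longrightarrow> (g has_field_derivative g' x) (at x within S)"
    and bij: "bij_betw g S T"
    and nonneg: "\<And>y. y \<in> T \<Longrightarrow> 0 \<le> f y"
  shows "(\<integral>\<^sup>+y\<in>T. ennreal (f y) \<partial>lborel) = (\<integral>\<^sup>+x\<in>S. ennreal (\<bar>g' x\<bar> * f (g x)) \<partial>lborel)"
proof -
  have inj: "inj_on g S" and T: "g ` S = T" using bij by (auto simp: bij_betw_def)
  have nonneg': "0 \<le> \<bar>g' x\<bar> * f (g x)" if "x \<in> S" for x using nonneg T that by auto
  have hi: "(h has_integral r) U"
    if "set_borel_measurable borel U h" "\<And>x. x \<in> U \<Longrightarrow> 0 \<le> h x" "(\<integral>\<^sup>+x\<in>U. ennreal (h x) \<partial>lborel) = ennreal r" "0 \<le> r"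
    for h :: "real \<Rightarrow> real" and U r
  proof -
    have "(\<integral>\<^sup>+x. ennreal (indicator U x * h x) \<partial>lborel) = (\<integral>\<^sup>+x\<in>U. ennreal (h x) \<partial>lborel)"
      by (intro nn_integral_cong) (auto simp: indicator_def)
    then have "((\<lambda>x. indicator U x * h x) has_integral r) UNIV"
      using that by (intro nn_integral_has_integral) (auto simp: set_borel_measurable_def indicator_def)
    moreover have "(\<lambda>x. indicator U x * h x) = (\<lambda>x. if x \<in> U then h x else 0)"
      by (auto simp: indicator_def)
    ultimately show ?thesis
      by (simp add: has_integral_restrict_UNIV)
  qed
  have iff: "((\<lambda>x. \<bar>g' x\<bar> * f (g x)) has_integral b) S \<longleftrightarrow> (f has_integral b) T" for b
  proof -
    have "(\<lambda>x. \<bar>g' x\<bar> * f (g x)) absolutely_integrable_on S \<and>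
           integral S (\<lambda>x. \<bar>g' x\<bar> * f (g x)) = b
       \<longleftrightarrow> f absolutely_integrable_on (g ` S) \<and> integral (g ` S) f = b"
      by (rule has_absolute_integral_change_of_variables_1'[OF _ deriv inj]) auto
    then show ?thesis
      using nonneg nonneg' by (simp add: T absolutely_integrable_on_iff_nonneg has_integral_iff)
  qed
  have meas: "set_borel_measurable borel S (\<lambda>x. \<bar>g' x\<bar> * f (g x))" "set_borel_measurable borel T f"
    by (auto simp: set_borel_measurable_def)
  show ?thesis
  proof (cases "(\<integral>\<^sup>+y\<in>T. ennreal (f y) \<partial>lborel)" rule: ennreal_cases)
    case (real r)
    then have "(f has_integral r) T" by (intro hi meas nonneg) auto
    then have "((\<lambda>x. \<bar>g' x\<bar> * f (g x)) has_integral r) S" by (simp add: iff)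
    from nn_integral_has_integral_lebesgue'[OF nonneg' this] show ?thesis by (simp add: real)
  next
    case top
    note t = this
    show ?thesis
    proof (cases "(\<integral>\<^sup>+x\<in>S. ennreal (\<bar>g' x\<bar> * f (g x)) \<partial>lborel)" rule: ennreal_cases)
      case (real r)
      then have "((\<lambda>x. \<bar>g' x\<bar> * f (g x)) has_integral r) S" by (intro hi meas nonneg') auto
      then have "(f has_integral r) T" by (simp add: iff)
      from nn_integral_has_integral_lebesgue'[OF nonneg this] show ?thesis by (simp add: real)
    qed (use t in simp)
  qed
qed

section \<open>Gaussian, Gamma and Kummer integrals\<close>

lemma nn_integral_gaussian: "(\<integral>\<^sup>+x. ennreal (exp (- x\<^sup>2)) \<partial>lborel) = ennreal (sqrt pi)"
proof -
  have "has_bochner_integral lborel (\<lambda>x::real. exp (- x\<^sup>2) * x ^ (2 * 0)) (2 * (sqrt pi / 2 * (fact (2*0) / (2 ^ (2 * 0) * fact 0))))"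
    using has_bochner_integral_even_function[OF gaussian_moment_even_pos[of 0]] by simp
  then have h: "has_bochner_integral lborel (\<lambda>x::real. exp (- x\<^sup>2)) (sqrt pi)" by simp
  show ?thesis using h by (simp add: has_bochner_integral_iff nn_integral_eq_integral)
qed

lemma nn_integral_gamma_kernel:
  fixes a b :: real
  assumes "0 < a" "0 < b"
  shows "(\<integral>\<^sup>+x\<in>{0<..}. ennreal (x powr (a - 1) * exp (- (b * x))) \<partial>lborel) = ennreal (Gamma a * b powr (- a))"
proof -
  have "ennreal (Gamma a) = (\<integral>\<^sup>+ t. ennreal (indicator {0..} t * t powr (a - 1) / exp t) \<partial>lborel)"
    using assms by (simp add: Gamma_conv_nn_integral_real)
  also have "\<dots> = ennreal \<bar>b\<bar> * (\<integral>\<^sup>+ t. ennreal (indicator {0..} (0 + b * t) * (0 + b * t) powr (a - 1) / exp (0 + b * t)) \<partial>lborel)"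
    using assms by (intro nn_integral_real_affine) auto
  also have "(\<integral>\<^sup>+ t. ennreal (indicator {0..} (0 + b * t) * (0 + b * t) powr (a - 1) / exp (0 + b * t)) \<partial>lborel)
     = (\<integral>\<^sup>+ t. ennreal (b powr (a - 1)) * (ennreal (t powr (a - 1) * exp (- (b * t))) * indicator {0<..} t) \<partial>lborel)"
    using AE_lborel_singleton[of "0::real"]
    by (intro nn_integral_cong_AE, eventually_elim)
      (use assms in \<open>auto simp: indicator_def ennreal_mult[symmetric] powr_mult exp_minus field_simps zero_le_mult_iff\<close>)
  also have "\<dots> = ennreal (b powr (a - 1)) * (\<integral>\<^sup>+x\<in>{0<..}. ennreal (x powr (a - 1) * exp (- (b * x))) \<partial>lborel)"
    by (rule nn_integral_cmult) auto
  finally have "ennreal (b powr (- a)) * ennreal (Gamma a) = ennreal (b powr (- a)) * (ennreal \<bar>b\<bar> *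
     (ennreal (b powr (a - 1)) * (\<integral>\<^sup>+x\<in>{0<..}. ennreal (x powr (a - 1) * exp (- (b * x))) \<partial>lborel)))" by simp
  also have "\<dots> = ennreal (b powr (- a) * b * b powr (a - 1)) * (\<integral>\<^sup>+x\<in>{0<..}. ennreal (x powr (a - 1) * exp (- (b * x))) \<partial>lborel)"
    using assms by (simp add: ennreal_mult mult.assoc)
  also have "b powr (- a) * b * b powr (a - 1) = 1"
    using assms by (simp add: powr_diff powr_minus field_simps)
  finally show ?thesis using assms by (simp add: ennreal_mult'[symmetric] Gamma_real_nonneg mult.commute)
qed

text \<open>The substitution \<open>u = sqrt r - s / (2 sqrt r)\<close> turns the Gaussian integral into the sum of two integrals,
  which the inversion \<open>r = s\<^sup>2 / (4 q)\<close> shows to be equal.\<close>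

lemma nn_integral_subordination:
  fixes s :: real
  assumes "0 < s"
  shows "(\<integral>\<^sup>+r\<in>{0<..}. ennreal (r powr (- 1 / 2) * exp (- r - s\<^sup>2 / (4 * r))) \<partial>lborel) = ennreal (sqrt pi * exp (- s))"
proof -
  let ?E = "\<lambda>r. exp (- r - s\<^sup>2 / (4 * r))"
  let ?g = "\<lambda>r. sqrt r - s / (2 * sqrt r)"
  let ?g' = "\<lambda>r. 1 / (2 * sqrt r) + s / (4 * r * sqrt r)"
  have bij: "bij_betw ?g {0<..} UNIV"
    unfolding bij_betw_def
  proof
    have "strict_mono_on {0<..} ?g"
    proof (rule strict_mono_onI)
      fix a b :: real assume "a \<in> {0<..}" "a < b"
      then have "sqrt a < sqrt b" "s / (2 * sqrt b) < s / (2 * sqrt a)" 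
        using assms by (auto intro!: divide_strict_left_mono)
      then show "?g a < ?g b" by linarith
    qed
    then show "inj_on ?g {0<..}" by (rule strict_mono_on_imp_inj_on)
    have "\<exists>r>0. u = ?g r" for u
    proof -
      \<comment> \<open>The positive root of 2 p^2 - 2 u p - s = 0, which is the equation
        \<open>u = ?g r\<close> for p = sqrt r.\<close>
      define p where "p = (u + sqrt (u\<^sup>2 + 2 * s)) / 2"
      have "\<bar>u\<bar> < sqrt (u\<^sup>2 + 2 * s)" using assms by (intro real_less_rsqrt) auto
      then have p: "0 < p" by (simp add: p_def abs_less_iff)
      have "2 * p - u = sqrt (u\<^sup>2 + 2 * s)" unfolding p_def by argo
      then have "(2 * p - u)\<^sup>2 = u\<^sup>2 + 2 * s" using assms by simp
      then have "p * p - u * p = s / 2" by (simp add: power2_eq_square algebra_simps)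
      then have "u = p - s / (2 * p)" using p by (simp add: field_simps)
      then show ?thesis using p by (intro exI[of _ "p\<^sup>2"]) auto
    qed
    then show "range_eq": "?g ` {0<..} = UNIV" by auto
  qed
  have sq: "r powr (-1/2) = 1 / sqrt r" if "0 < r" for r :: real
    using that by (simp add: powr_minus powr_half_sqrt[symmetric] field_simps)
  have "ennreal (sqrt pi) = (\<integral>\<^sup>+x\<in>UNIV. ennreal (exp (- x\<^sup>2)) \<partial>lborel)"
    by (simp add: nn_integral_gaussian)
  also have "\<dots> = (\<integral>\<^sup>+r\<in>{0<..}. ennreal (\<bar>?g' r\<bar> * exp (- (?g r)\<^sup>2)) \<partial>lborel)"
    using bij
  proof (intro nn_integral_change_of_variables)
    show "(?g has_real_derivative ?g' r) (at r within {0<..})" if "r \<in> {0<..}" for r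
      using that by (auto intro!: derivative_eq_intros simp: field_simps)
  qed auto
  \<comment> \<open>The cross term in the square of \<open>?g r\<close> is the constant - s, which
    leaves the factor \<open>exp s\<close>; the two summands of \<open>?g'\<close> give the two
    integrals.\<close>
  also have "\<dots> = (\<integral>\<^sup>+r. ennreal (exp s) * (ennreal (1 / 2 * (r powr (- 1 / 2) * ?E r)) * indicator {0<..} r +
      ennreal (s / (4 * r * sqrt r) * ?E r) * indicator {0<..} r) \<partial>lborel)"
  proof (intro nn_integral_cong)
    fix r :: real
    have "ennreal (\<bar>?g' r\<bar> * exp (- (?g r)\<^sup>2)) = ennreal (exp s) * (ennreal (1 / 2 * (r powr (- 1 / 2) * ?E r)) + ennreal (s / (4 * r * sqrt r) * ?E r))"
      if "0 < r"
    proof -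
      have "(?g r)\<^sup>2 = r - s + s\<^sup>2 / (4 * r)" using that by (simp add: power2_diff power_divide power_mult_distrib)
      then have "exp (- (?g r)\<^sup>2) = exp s * ?E r" by (simp add: exp_add[symmetric])
      moreover have "\<bar>?g' r\<bar> = ?g' r" using that assms by (intro abs_of_nonneg) auto
      ultimately have "\<bar>?g' r\<bar> * exp (- (?g r)\<^sup>2) = exp s * (1 / 2 * (r powr (- 1 / 2) * ?E r) + s / (4 * r * sqrt r) * ?E r)"
        using that by (simp only: sq) (simp add: algebra_simps)
      then show ?thesis using that assms by (simp add: ennreal_mult[symmetric] ennreal_plus[symmetric] del: ennreal_plus)
    qed
    then show "ennreal (\<bar>?g' r\<bar> * exp (- (?g r)\<^sup>2)) * indicator {0<..} r = ennreal (exp s) * (ennreal (1 / 2 * (r powr (- 1 / 2) * ?E r)) * indicator {0<..} r +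
      ennreal (s / (4 * r * sqrt r) * ?E r) * indicator {0<..} r)" by (auto simp: indicator_def)
  qed
  also have "\<dots> = ennreal (exp s) * ((\<integral>\<^sup>+r\<in>{0<..}. ennreal (1 / 2 * (r powr (- 1 / 2) * ?E r)) \<partial>lborel)
     + (\<integral>\<^sup>+r\<in>{0<..}. ennreal (s / (4 * r * sqrt r) * ?E r) \<partial>lborel))"
    by (simp add: nn_integral_cmult nn_integral_add)
  also have "(\<integral>\<^sup>+r\<in>{0<..}. ennreal (s / (4 * r * sqrt r) * ?E r) \<partial>lborel)
      = (\<integral>\<^sup>+q\<in>{0<..}. ennreal (\<bar>- (s\<^sup>2 / (4 * q\<^sup>2))\<bar> * (s / (4 * (s\<^sup>2 / (4 * q)) * sqrt (s\<^sup>2 / (4 * q))) * ?E (s\<^sup>2 / (4 * q)))) \<partial>lborel)"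
  proof (intro nn_integral_change_of_variables)
    show "((\<lambda>q. s\<^sup>2 / (4 * q)) has_real_derivative - (s\<^sup>2 / (4 * q\<^sup>2))) (at q within {0<..})" if "q \<in> {0<..}" for q
      using that by (auto intro!: derivative_eq_intros simp: field_simps power2_eq_square)
    show "bij_betw (\<lambda>q. s\<^sup>2 / (4 * q)) {0<..} {0<..}"
      by (rule bij_betwI[where g="\<lambda>q. s\<^sup>2 / (4 * q)"]) (use assms in auto)
  qed (use assms in auto)
  also have "\<dots> = (\<integral>\<^sup>+r\<in>{0<..}. ennreal (1 / 2 * (r powr (- 1 / 2) * ?E r)) \<partial>lborel)"
  proof (intro nn_integral_cong)
    fix q :: real
    have eq: "\<bar>- (s\<^sup>2 / (4 * q\<^sup>2))\<bar> * (s / (4 * (s\<^sup>2 / (4 * q)) * sqrt (s\<^sup>2 / (4 * q))) * ?E (s\<^sup>2 / (4 * q))) =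
        1 / 2 * (q powr (- 1 / 2) * ?E q)" if "0 < q"
    proof -
      have "?E (s\<^sup>2 / (4 * q)) = ?E q" using assms that by (simp add: algebra_simps)
      moreover have "sqrt (s\<^sup>2 / (4 * q)) = s / (2 * sqrt q)"
        using assms that by (simp add: real_sqrt_divide real_sqrt_mult)
      moreover have "q = sqrt q * sqrt q" using that by simp
      ultimately show ?thesis
        using that assms by (simp only: sq) (simp add: field_simps power2_eq_square)
    qed
    show "ennreal (\<bar>- (s\<^sup>2 / (4 * q\<^sup>2))\<bar> * (s / (4 * (s\<^sup>2 / (4 * q)) * sqrt (s\<^sup>2 / (4 * q))) * ?E (s\<^sup>2 / (4 * q)))) * indicator {0<..} q
      = ennreal (1 / 2 * (q powr (- 1 / 2) * ?E q)) * indicator {0<..} q"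
    proof (cases "0 < q")
      case True
      show ?thesis by (simp only: eq[OF True])
    qed simp
  qed
  also have "(\<integral>\<^sup>+r\<in>{0<..}. ennreal (1 / 2 * (r powr (- 1 / 2) * ?E r)) \<partial>lborel) + (\<integral>\<^sup>+r\<in>{0<..}. ennreal (1 / 2 * (r powr (- 1 / 2) * ?E r)) \<partial>lborel)
     = (\<integral>\<^sup>+r\<in>{0<..}. ennreal (r powr (- 1 / 2) * ?E r) \<partial>lborel)"
  proof (subst nn_integral_add[symmetric])
    show "(\<integral>\<^sup>+ x. ennreal (1 / 2 * (x powr (- 1 / 2) * ?E x)) * indicator {0<..} x + ennreal (1 / 2 * (x powr (- 1 / 2) * ?E x)) * indicator {0<..} x \<partial>lborel) =
      (\<integral>\<^sup>+r\<in>{0<..}. ennreal (r powr (- 1 / 2) * ?E r) \<partial>lborel)"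
      by (intro nn_integral_cong) (auto simp: indicator_def ennreal_plus[symmetric] simp del: ennreal_plus)
  qed auto
  finally have "ennreal (exp (- s)) * ennreal (sqrt pi) = ennreal (exp (- s)) * (ennreal (exp s) *
     (\<integral>\<^sup>+r\<in>{0<..}. ennreal (r powr (- 1 / 2) * ?E r) \<partial>lborel))" by simp
  also have "\<dots> = ennreal (exp (- s) * exp s) * (\<integral>\<^sup>+r\<in>{0<..}. ennreal (r powr (- 1 / 2) * ?E r) \<partial>lborel)"
    by (simp add: ennreal_mult mult.assoc)
  finally show ?thesis by (simp add: ennreal_mult[symmetric] exp_minus mult.commute)
qed

text \<open>Up to Gamma factors the two integrals are \<open>U(a, a - c + 1, b)\<close> and \<open>U(c, c - a + 1, b)\<close>; both arise by
  integrating \<open>x ^ (a - 1) u ^ (c - 1) exp (- (b x + u + x u))\<close> in either order.\<close>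

lemma nn_integral_kummer:
  fixes a b c :: real
  assumes "0 < a" "0 < b" "0 < c"
  shows "ennreal (Gamma c) * (\<integral>\<^sup>+x\<in>{0<..}. ennreal (x powr (a - 1) * (1 + x) powr (- c) * exp (- (b * x))) \<partial>lborel) =
    ennreal (Gamma a * b powr (c - a)) *
      (\<integral>\<^sup>+x\<in>{0<..}. ennreal (x powr (c - 1) * (1 + x) powr (- a) * exp (- (b * x))) \<partial>lborel)"
proof -
  let ?f = "\<lambda>x u::real. ennreal (x powr (a - 1) * exp (- (b * x)) * (u powr (c - 1) * exp (- ((1 + x) * u)))) * indicator {0<..} u * indicator {0<..} x"
  have "ennreal (Gamma c) * (\<integral>\<^sup>+x\<in>{0<..}. ennreal (x powr (a - 1) * (1 + x) powr (- c) * exp (- (b * x))) \<partial>lborel)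
    = (\<integral>\<^sup>+x. ennreal (Gamma c) * (ennreal (x powr (a - 1) * (1 + x) powr (- c) * exp (- (b * x))) * indicator {0<..} x) \<partial>lborel)"
    by (intro nn_integral_cmult[symmetric]) auto
  also have "\<dots> = (\<integral>\<^sup>+x. \<integral>\<^sup>+u. ?f x u \<partial>lborel \<partial>lborel)"
  proof (intro nn_integral_cong)
    fix x :: real
    show "ennreal (Gamma c) * (ennreal (x powr (a - 1) * (1 + x) powr (- c) * exp (- (b * x))) * indicator {0<..} x) = (\<integral>\<^sup>+u. ?f x u \<partial>lborel)"
    proof (cases "0 < x")
      case True
      have "(\<integral>\<^sup>+u. ?f x u \<partial>lborel) = (\<integral>\<^sup>+u. ennreal (x powr (a - 1) * exp (- (b * x))) * (ennreal (u powr (c - 1) * exp (- ((1 + x) * u))) * indicator {0<..} u) \<partial>lborel)"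
        using True by (intro nn_integral_cong) (simp add: ennreal_mult mult.assoc)
      also have "\<dots> = ennreal (x powr (a - 1) * exp (- (b * x))) * ennreal (Gamma c * (1 + x) powr (- c))"
        using True assms nn_integral_gamma_kernel[of c "1 + x"] by (subst nn_integral_cmult) auto
      finally show ?thesis
        using True assms by (simp add: ennreal_mult[symmetric] Gamma_real_nonneg mult_ac)
    qed simp
  qed
  also have "\<dots> = (\<integral>\<^sup>+u. \<integral>\<^sup>+x. ?f x u \<partial>lborel \<partial>lborel)"
    by (rule lborel_pair.Fubini') measurable
  also have "\<dots> = (\<integral>\<^sup>+u. ennreal (Gamma a) * (ennreal (u powr (c - 1) * (b + u) powr (- a) * exp (- u)) * indicator {0<..} u) \<partial>lborel)"
  proof (intro nn_integral_cong)
    fix u :: real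
    show "(\<integral>\<^sup>+x. ?f x u \<partial>lborel) = ennreal (Gamma a) * (ennreal (u powr (c - 1) * (b + u) powr (- a) * exp (- u)) * indicator {0<..} u)"
    proof (cases "0 < u")
      case True
      have "(\<integral>\<^sup>+x. ?f x u \<partial>lborel) = (\<integral>\<^sup>+x. ennreal (u powr (c - 1) * exp (- u)) * (ennreal (x powr (a - 1) * exp (- ((b + u) * x))) * indicator {0<..} x) \<partial>lborel)"
        using True by (intro nn_integral_cong)
          (simp add: ennreal_mult[symmetric] mult.assoc[symmetric], simp add: algebra_simps exp_add exp_minus exp_diff field_simps)
      also have "\<dots> = ennreal (u powr (c - 1) * exp (- u)) * ennreal (Gamma a * (b + u) powr (- a))"
        using True assms nn_integral_gamma_kernel[of a "b + u"] by (subst nn_integral_cmult) auto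
      finally show ?thesis
        using True assms by (simp add: ennreal_mult[symmetric] Gamma_real_nonneg mult_ac)
    qed simp
  qed
  also have "\<dots> = ennreal (Gamma a) * (\<integral>\<^sup>+u\<in>{0<..}. ennreal (u powr (c - 1) * (b + u) powr (- a) * exp (- u)) \<partial>lborel)"
    by (intro nn_integral_cmult) auto
  also have "(\<integral>\<^sup>+u\<in>{0<..}. ennreal (u powr (c - 1) * (b + u) powr (- a) * exp (- u)) \<partial>lborel)
    = ennreal \<bar>b\<bar> * (\<integral>\<^sup>+x. ennreal ((0 + b * x) powr (c - 1) * (b + (0 + b * x)) powr (- a) * exp (- (0 + b * x))) * indicator {0<..} (0 + b * x) \<partial>lborel)"
    using assms by (intro nn_integral_real_affine) auto
  also have "(\<integral>\<^sup>+x. ennreal ((0 + b * x) powr (c - 1) * (b + (0 + b * x)) powr (- a) * exp (- (0 + b * x))) * indicator {0<..} (0 + b * x) \<partial>lborel)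
    = (\<integral>\<^sup>+x. ennreal (b powr (c - 1 - a)) * (ennreal (x powr (c - 1) * (1 + x) powr (- a) * exp (- (b * x))) * indicator {0<..} x) \<partial>lborel)"
  proof (intro nn_integral_cong)
    fix x :: real
    have "(b * x) powr (c - 1) * (b + b * x) powr (- a) = b powr (c - 1 - a) * (x powr (c - 1) * (1 + x) powr (- a))" if "0 < x"
    proof -
      have "(b + b * x) powr (- a) = b powr (- a) * (1 + x) powr (- a)"
        using that assms powr_mult[of b "1 + x" "- a"] by (simp add: algebra_simps)
      moreover have "b powr (c - 1 - a) = b powr (c - 1) * b powr (- a)"
        by (simp add: powr_add[symmetric])
      ultimately show ?thesis using that assms by (simp add: powr_mult)
    qed
    then show "ennreal ((0 + b * x) powr (c - 1) * (b + (0 + b * x)) powr (- a) * exp (- (0 + b * x))) * indicator {0<..} (0 + b * x)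
       = ennreal (b powr (c - 1 - a)) * (ennreal (x powr (c - 1) * (1 + x) powr (- a) * exp (- (b * x))) * indicator {0<..} x)"
      using assms by (auto simp: indicator_def ennreal_mult[symmetric] zero_less_mult_iff)
  qed
  also have "\<dots> = ennreal (b powr (c - 1 - a)) * (\<integral>\<^sup>+x\<in>{0<..}. ennreal (x powr (c - 1) * (1 + x) powr (- a) * exp (- (b * x))) \<partial>lborel)"
    by (intro nn_integral_cmult) auto
  also have "ennreal (Gamma a) * (ennreal \<bar>b\<bar> * (ennreal (b powr (c - 1 - a)) * (\<integral>\<^sup>+x\<in>{0<..}. ennreal (x powr (c - 1) * (1 + x) powr (- a) * exp (- (b * x))) \<partial>lborel)))
    = ennreal (Gamma a * (b * b powr (c - 1 - a))) * (\<integral>\<^sup>+x\<in>{0<..}. ennreal (x powr (c - 1) * (1 + x) powr (- a) * exp (- (b * x))) \<partial>lborel)"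
    using assms by (simp add: ennreal_mult Gamma_real_nonneg mult.assoc)
  also have "b * b powr (c - 1 - a) = b powr (c - a)"
    using assms by (simp add: powr_diff)
  finally show ?thesis .
qed

section \<open>From the Gamma mixture to the Bessel mixture\<close>

text \<open>Replacing x by \<open>y * sqrt (1 + x)\<close> makes the Gaussian exponent linear and
  turns 1 - y^2 / x^2 into \<open>x / (1 + x)\<close>. The result is the left integral of
  \<open>nn_integral_kummer\<close> with parameters \<open>v + 1 / 2\<close>, y^2 / (4 r) and
  \<open>v + 1 - a / 2\<close>.\<close>

lemma nn_integral_sqrt_substitution:
  fixes y r v a :: real
  assumes "0 < y" "0 < r"
  shows "(\<integral>\<^sup>+x\<in>{y<..}. ennreal (x powr (a - 2) * (1 - y\<^sup>2 / x\<^sup>2) powr (v - 1 / 2) * exp (- (x\<^sup>2 / (4 * r)))) \<partial>lborel) =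
    ennreal (1 / 2 * y powr (a - 1) * exp (- (y\<^sup>2 / (4 * r)))) *
     (\<integral>\<^sup>+x\<in>{0<..}. ennreal (x powr ((v + 1 / 2) - 1) * (1 + x) powr (- (v + 1 - a / 2)) * exp (- (y\<^sup>2 / (4 * r) * x))) \<partial>lborel)"
proof -
  let ?f = "\<lambda>x. x powr (a - 2) * (1 - y\<^sup>2 / x\<^sup>2) powr (v - 1 / 2) * exp (- (x\<^sup>2 / (4 * r)))"
  have "(\<integral>\<^sup>+x\<in>{y<..}. ennreal (?f x) \<partial>lborel) = (\<integral>\<^sup>+x\<in>{0<..}. ennreal (\<bar>y / (2 * sqrt (1 + x))\<bar> * ?f (y * sqrt (1 + x))) \<partial>lborel)"
  proof (intro nn_integral_change_of_variables)
    show "((\<lambda>x. y * sqrt (1 + x)) has_real_derivative y / (2 * sqrt (1 + x))) (at x within {0<..})" if "x \<in> {0<..}" for x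
      using that by (auto intro!: derivative_eq_intros simp: field_simps)
    show "bij_betw (\<lambda>x. y * sqrt (1 + x)) {0<..} {y<..}"
    proof (rule bij_betwI[where g="\<lambda>x. (x / y)\<^sup>2 - 1"])
      show "(\<lambda>x. (x / y)\<^sup>2 - 1) \<in> {y<..} \<rightarrow> {0<..}"
        using assms by (auto simp: power_divide power_strict_mono)
    qed (use assms in \<open>auto simp: power_divide power_mult_distrib real_sqrt_divide\<close>)
  qed (use assms in auto)
  also have "\<dots> = (\<integral>\<^sup>+x. ennreal (1 / 2 * y powr (a - 1) * exp (- (y\<^sup>2 / (4 * r)))) *
     (ennreal (x powr ((v + 1 / 2) - 1) * (1 + x) powr (- (v + 1 - a / 2)) * exp (- (y\<^sup>2 / (4 * r) * x))) * indicator {0<..} x) \<partial>lborel)"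
  proof (intro nn_integral_cong)
    fix x :: real
    have eq: "\<bar>y / (2 * sqrt (1 + x))\<bar> * ?f (y * sqrt (1 + x)) = 1 / 2 * y powr (a - 1) * exp (- (y\<^sup>2 / (4 * r))) *
     (x powr ((v + 1 / 2) - 1) * (1 + x) powr (- (v + 1 - a / 2)) * exp (- (y\<^sup>2 / (4 * r) * x)))" if "0 < x"
    proof -
      have 1: "sqrt (1 + x) = (1 + x) powr (1 / 2)" using that by (simp add: powr_half_sqrt)
      have 2: "(1 - y\<^sup>2 / (y * sqrt (1 + x))\<^sup>2) = x / (1 + x)"
      proof -
        have "y\<^sup>2 / (y * sqrt (1 + x))\<^sup>2 = 1 / (1 + x)" using that assms by (simp add: power_mult_distrib)
        then show ?thesis using that by (simp add: field_simps)
      qed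
      have 3: "exp (- ((y * sqrt (1 + x))\<^sup>2 / (4 * r))) = exp (- (y\<^sup>2 / (4 * r))) * exp (- (y\<^sup>2 / (4 * r) * x))"
        using that assms by (simp add: power_mult_distrib exp_add[symmetric] add_divide_distrib algebra_simps)
      have 4: "(y * sqrt (1 + x)) powr (a - 2) = y powr (a - 1) / y * (1 + x) powr (a / 2 - 1)"
      proof -
        have "y powr (a - 2) = y powr (a - 1) / y" using powr_diff[of y "a - 1" 1] assms by simp
        then show ?thesis using that assms unfolding 1 by (simp add: powr_mult powr_powr diff_divide_distrib)
      qed
      have 5: "(x / (1 + x)) powr (v - 1 / 2) = x powr (v - 1 / 2) * (1 + x) powr (1 / 2 - v)"
        using that powr_minus_divide[of "1 + x" "v - 1 / 2"] by (simp add: powr_divide)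
      have 6: "(1 + x) powr (- (v + 1 - a / 2)) = (1 + x) powr (- (1/2)) * (1 + x) powr (a / 2 - 1) * (1 + x) powr (1 / 2 - v)"
        by (simp add: powr_add[symmetric] algebra_simps)
      have 7: "\<bar>y / (2 * sqrt (1 + x))\<bar> = y / 2 * (1 + x) powr (- (1 / 2))"
        using that assms unfolding 1 by (simp add: powr_minus field_simps)
      show ?thesis unfolding 2 3 4 5 6 7 using assms by simp
    qed
    show "ennreal (\<bar>y / (2 * sqrt (1 + x))\<bar> * ?f (y * sqrt (1 + x))) * indicator {0<..} x =
       ennreal (1 / 2 * y powr (a - 1) * exp (- (y\<^sup>2 / (4 * r)))) *
     (ennreal (x powr ((v + 1 / 2) - 1) * (1 + x) powr (- (v + 1 - a / 2)) * exp (- (y\<^sup>2 / (4 * r) * x))) * indicator {0<..} x)"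
    proof (cases "0 < x")
      case True
      show ?thesis unfolding eq[OF True] by (subst ennreal_mult) (auto simp: mult.assoc)
    qed simp
  qed
  also have "\<dots> = ennreal (1 / 2 * y powr (a - 1) * exp (- (y\<^sup>2 / (4 * r)))) *
     (\<integral>\<^sup>+x\<in>{0<..}. ennreal (x powr ((v + 1 / 2) - 1) * (1 + x) powr (- (v + 1 - a / 2)) * exp (- (y\<^sup>2 / (4 * r) * x))) \<partial>lborel)"
    by (intro nn_integral_cmult) auto
  finally show ?thesis .
qed

text \<open>With w = 1 / (1 + x) one has b / w = b + b x, so \<open>exp (- b)\<close> splits off and
  the right integral of \<open>nn_integral_kummer\<close> remains, for the same parameters as in the
  preceding substitution. Read backwards, this is how the mixing variable w arises.\<close>

lemma nn_integral_inverse_substitution: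
  fixes b v a :: real
  shows "(\<integral>\<^sup>+w\<in>{0<..<1}. ennreal (w powr (a / 2 - 3 / 2) * (1 - w) powr (v - a / 2) * exp (- (b / w))) \<partial>lborel) =
    ennreal (exp (- b)) * (\<integral>\<^sup>+x\<in>{0<..}. ennreal (x powr ((v + 1 - a / 2) - 1) * (1 + x) powr (- (v + 1 / 2)) * exp (- (b * x))) \<partial>lborel)"
proof -
  let ?f = "\<lambda>w. w powr (a / 2 - 3 / 2) * (1 - w) powr (v - a / 2) * exp (- (b / w))"
  have "(\<integral>\<^sup>+w\<in>{0<..<1}. ennreal (?f w) \<partial>lborel) = (\<integral>\<^sup>+x\<in>{0<..}. ennreal (\<bar>- (1 / (1 + x)\<^sup>2)\<bar> * ?f (1 / (1 + x))) \<partial>lborel)"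
  proof (intro nn_integral_change_of_variables)
    show "((\<lambda>x. 1 / (1 + x)) has_real_derivative - (1 / (1 + x)\<^sup>2)) (at x within {0<..})" if "x \<in> {0<..}" for x
      using that by (auto intro!: derivative_eq_intros simp: field_simps power2_eq_square)
    show "bij_betw (\<lambda>x::real. 1 / (1 + x)) {0<..} {0<..<1}"
      by (rule bij_betwI[where g="\<lambda>w. 1 / w - 1"]) (auto simp: field_simps)
  qed auto
  also have "\<dots> = (\<integral>\<^sup>+x. ennreal (exp (- b)) *
     (ennreal (x powr ((v + 1 - a / 2) - 1) * (1 + x) powr (- (v + 1 / 2)) * exp (- (b * x))) * indicator {0<..} x) \<partial>lborel)"
  proof (intro nn_integral_cong)
    fix x :: real
    have eq: "\<bar>- (1 / (1 + x)\<^sup>2)\<bar> * ?f (1 / (1 + x)) = exp (- b) *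
     (x powr ((v + 1 - a / 2) - 1) * (1 + x) powr (- (v + 1 / 2)) * exp (- (b * x)))" if "0 < x"
    proof -
      have 1: "1 - 1 / (1 + x) = x / (1 + x)" using that by (simp add: field_simps)
      have 2: "\<bar>- (1 / (1 + x)\<^sup>2)\<bar> = (1 + x) powr (- 2)" using that by (simp add: powr_minus field_simps)
      have 3: "(1 / (1 + x)) powr (a / 2 - 3 / 2) = (1 + x) powr (3 / 2 - a / 2)"
        using that powr_minus_divide[of "1 + x" "a / 2 - 3 / 2"] by (simp add: powr_divide)
      have 4: "(x / (1 + x)) powr (v - a / 2) = x powr (v - a / 2) * (1 + x) powr (a / 2 - v)"
        using that powr_minus_divide[of "1 + x" "v - a / 2"] by (simp add: powr_divide)
      have 5: "exp (- (b / (1 / (1 + x)))) = exp (- b) * exp (- (b * x))"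
        by (simp add: exp_add[symmetric] algebra_simps)
      have 6: "(1 + x) powr (- (v + 1 / 2)) = (1 + x) powr (- 2) * (1 + x) powr (3 / 2 - a / 2) * (1 + x) powr (a / 2 - v)"
        by (simp add: powr_add[symmetric] algebra_simps)
      show ?thesis unfolding 1 2 3 4 5 6 by simp
    qed
    show "ennreal (\<bar>- (1 / (1 + x)\<^sup>2)\<bar> * ?f (1 / (1 + x))) * indicator {0<..} x = ennreal (exp (- b)) *
     (ennreal (x powr ((v + 1 - a / 2) - 1) * (1 + x) powr (- (v + 1 / 2)) * exp (- (b * x))) * indicator {0<..} x)"
    proof (cases "0 < x")
      case True
      show ?thesis unfolding eq[OF True] by (subst ennreal_mult) (auto simp: mult.assoc)
    qed simp
  qed
  also have "\<dots> = ennreal (exp (- b)) * (\<integral>\<^sup>+x\<in>{0<..}. ennreal (x powr ((v + 1 - a / 2) - 1) * (1 + x) powr (- (v + 1 / 2)) * exp (- (b * x))) \<partial>lborel)"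
    by (intro nn_integral_cmult) auto
  finally show ?thesis .
qed

text \<open>The outer variable z is the parameter of the Gaussian mixture representing
  \<open>exp (- x)\<close>. For fixed z the inner integral passes through the square root
  substitution, Kummer's transformation and the inverse substitution. The bound on \<open>v\<close>
  makes \<open>v + 1 - a / 2\<close>, the second Kummer parameter, positive.\<close>

lemma nn_integral_bessel_mixture:
  fixes y v a :: real
  assumes "0 < y" "0 < v" "a / 2 - 1 < v"
  shows "ennreal (sqrt pi * Gamma (v + 1 - a / 2)) *
     (\<integral>\<^sup>+x\<in>{y<..}. ennreal (x powr (a - 2) * (1 - y\<^sup>2 / x\<^sup>2) powr (v - 1 / 2) * exp (- x)) \<partial>lborel) =
    ennreal (2 powr (a - 2) * Gamma (v + 1 / 2)) *
     (\<integral>\<^sup>+z\<in>{0<..}. (\<integral>\<^sup>+w\<in>{0<..<1}. ennreal (z powr (a / 2 - 1) * exp (- z) *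
        (w powr (a / 2 - 3 / 2) * (1 - w) powr (v - a / 2) * exp (- (y\<^sup>2 / (4 * z) / w)))) \<partial>lborel) \<partial>lborel)"
proof -
  let ?A = "v + 1 / 2" and ?C = "v + 1 - a / 2"
  let ?h = "\<lambda>x. x powr (a - 2) * (1 - y\<^sup>2 / x\<^sup>2) powr (v - 1 / 2)"
  let ?I = "\<lambda>r. \<integral>\<^sup>+x\<in>{y<..}. ennreal (?h x * exp (- (x\<^sup>2 / (4 * r)))) \<partial>lborel"
  let ?K = "\<lambda>r. \<integral>\<^sup>+x\<in>{0<..}. ennreal (x powr (?A - 1) * (1 + x) powr (- ?C) * exp (- (y\<^sup>2 / (4 * r) * x))) \<partial>lborel"
  let ?W = "\<lambda>r. \<integral>\<^sup>+w\<in>{0<..<1}. ennreal (w powr (a / 2 - 3 / 2) * (1 - w) powr (v - a / 2) * exp (- (y\<^sup>2 / (4 * r) / w))) \<partial>lborel"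
  let ?f = "\<lambda>x r. ennreal (?h x * (r powr (- 1 / 2) * exp (- r) * exp (- (x\<^sup>2 / (4 * r))))) * indicator {0<..} r * indicator {y<..} x"
  have pos: "0 < ?A" "0 < ?C" "0 \<le> Gamma ?A" "0 \<le> Gamma ?C" using assms by (auto intro!: Gamma_real_nonneg)
  have W: "ennreal (Gamma ?C) * ?I r = ennreal (2 powr (a - 2) * Gamma ?A * r powr (a / 2 - 1 / 2)) * ?W r" if "0 < r" for r
  proof -
    let ?b = "y\<^sup>2 / (4 * r)"
    have b: "0 < ?b" using assms that by simp
    let ?L = "\<integral>\<^sup>+x\<in>{0<..}. ennreal (x powr (?C - 1) * (1 + x) powr (- ?A) * exp (- (?b * x))) \<partial>lborel"
    have "ennreal (Gamma ?C) * ?I r = ennreal (Gamma ?C) * (ennreal (1 / 2 * y powr (a - 1) * exp (- ?b)) * ?K r)"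
      using nn_integral_sqrt_substitution[OF assms(1) that, of a v] by simp
    also have "\<dots> = ennreal (1 / 2 * y powr (a - 1) * exp (- ?b)) * (ennreal (Gamma ?C) * ?K r)"
      by (simp add: mult_ac)
    also have "\<dots> = ennreal (1 / 2 * y powr (a - 1) * exp (- ?b)) * (ennreal (Gamma ?A * ?b powr (?C - ?A)) * ?L)"
      using nn_integral_kummer[OF pos(1) b pos(2)] by simp
    also have "\<dots> = ennreal (1 / 2 * y powr (a - 1) * Gamma ?A * ?b powr (?C - ?A)) * (ennreal (exp (- ?b)) * ?L)"
    proof -
      have G: "ennreal (p * e) * (ennreal (g * q) * L) = ennreal (p * g * q) * (ennreal e * L)"
        if "0 \<le> p" "0 \<le> e" "0 \<le> g" "0 \<le> q" for p e g q L
        using that by (simp add: ennreal_mult mult_ac)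
      show ?thesis by (rule G) (use pos in auto)
    qed
    also have "ennreal (exp (- ?b)) * ?L = ?W r"
      by (rule nn_integral_inverse_substitution[symmetric])
    \<comment> \<open>Since \<open>?C - ?A\<close> is (1 - a) / 2, all powers of y cancel. The
      surviving \<open>r powr (a / 2 - 1 / 2)\<close> later merges with
      \<open>r powr (- 1 / 2)\<close> into the power \<open>a / 2 - 1\<close> of the integral
      defining K with index - a / 2.\<close>
    also have "1 / 2 * y powr (a - 1) * Gamma ?A * ?b powr (?C - ?A) = 2 powr (a - 2) * Gamma ?A * r powr (a / 2 - 1 / 2)"
    proof -
      have "?b powr (?C - ?A) = (y / 2) powr (1 - a) * r powr (a / 2 - 1 / 2)"
      proof -
        have "?b = (y / 2) powr 2 * r powr (- 1)"
          using assms that by (simp add: powr_minus power_divide field_simps)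
        then have "?b powr (?C - ?A) = (y / 2) powr (2 * (?C - ?A)) * r powr (- (?C - ?A))"
          by (simp only: powr_mult powr_powr powr_ge_zero mult_minus1)
        moreover have "2 * (?C - ?A) = 1 - a" "- (?C - ?A) = a / 2 - 1 / 2" by (simp_all add: field_simps)
        ultimately show ?thesis by simp
      qed
      also have "(y / 2) powr (1 - a) = 2 powr (a - 2) * 2 * y powr (- (a - 1))"
        using assms by (simp add: powr_divide powr_diff powr_minus field_simps)
      finally have "?b powr (?C - ?A) = 2 powr (a - 2) * 2 * y powr (- (a - 1)) * r powr (a / 2 - 1 / 2)" .
      moreover have "y powr (a - 1) * y powr (- (a - 1)) = 1"
        using assms by (simp add: powr_add[symmetric] del: minus_diff_eq)
      ultimately show ?thesis by (simp only:) (simp add: mult_ac)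
    qed
    finally show ?thesis .
  qed
  have "ennreal (sqrt pi) * (\<integral>\<^sup>+x\<in>{y<..}. ennreal (?h x * exp (- x)) \<partial>lborel)
    = (\<integral>\<^sup>+x. ennreal (sqrt pi) * (ennreal (?h x * exp (- x)) * indicator {y<..} x) \<partial>lborel)"
    by (intro nn_integral_cmult[symmetric]) auto
  also have "\<dots> = (\<integral>\<^sup>+x. \<integral>\<^sup>+r. ?f x r \<partial>lborel \<partial>lborel)"
  proof (intro nn_integral_cong)
    fix x :: real
    show "ennreal (sqrt pi) * (ennreal (?h x * exp (- x)) * indicator {y<..} x) = (\<integral>\<^sup>+r. ?f x r \<partial>lborel)"
    proof (cases "y < x")
      case True
      have "(\<integral>\<^sup>+r. ?f x r \<partial>lborel) = (\<integral>\<^sup>+r. ennreal (?h x) * (ennreal (r powr (- 1 / 2) * exp (- r - x\<^sup>2 / (4 * r))) * indicator {0<..} r) \<partial>lborel)"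
        using True assms by (intro nn_integral_cong) (auto simp: ennreal_mult[symmetric] exp_add[symmetric] mult.assoc indicator_def)
      also have "\<dots> = ennreal (?h x) * ennreal (sqrt pi * exp (- x))"
        using True assms nn_integral_subordination[of x] by (subst nn_integral_cmult) auto
      finally show ?thesis using True by (simp add: ennreal_mult[symmetric] mult_ac)
    qed simp
  qed
  also have "\<dots> = (\<integral>\<^sup>+r. \<integral>\<^sup>+x. ?f x r \<partial>lborel \<partial>lborel)"
    by (rule lborel_pair.Fubini') measurable
  also have "\<dots> = (\<integral>\<^sup>+r. ennreal (r powr (- 1 / 2) * exp (- r)) * ?I r * indicator {0<..} r \<partial>lborel)"
  proof (intro nn_integral_cong)
    fix r :: real
    have "?f x r = (ennreal (r powr (- 1 / 2) * exp (- r)) * indicator {0<..} r) * (ennreal (?h x * exp (- (x\<^sup>2 / (4 * r)))) * indicator {y<..} x)" for x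
      by (auto simp: indicator_def ennreal_mult[symmetric] mult_ac)
    then have "(\<integral>\<^sup>+x. ?f x r \<partial>lborel) = (ennreal (r powr (- 1 / 2) * exp (- r)) * indicator {0<..} r) * ?I r"
      by (simp only:) (intro nn_integral_cmult, auto)
    then show "(\<integral>\<^sup>+x. ?f x r \<partial>lborel) = ennreal (r powr (- 1 / 2) * exp (- r)) * ?I r * indicator {0<..} r"
      by (simp add: mult_ac)
  qed
  finally have 1: "ennreal (sqrt pi) * (\<integral>\<^sup>+x\<in>{y<..}. ennreal (?h x * exp (- x)) \<partial>lborel) =
     (\<integral>\<^sup>+r. ennreal (r powr (- 1 / 2) * exp (- r)) * ?I r * indicator {0<..} r \<partial>lborel)" .
  have "ennreal (sqrt pi * Gamma ?C) * (\<integral>\<^sup>+x\<in>{y<..}. ennreal (?h x * exp (- x)) \<partial>lborel) =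
      ennreal (Gamma ?C) * (ennreal (sqrt pi) * (\<integral>\<^sup>+x\<in>{y<..}. ennreal (?h x * exp (- x)) \<partial>lborel))"
    using pos by (simp add: ennreal_mult mult_ac)
  also have "\<dots> = (\<integral>\<^sup>+r. ennreal (Gamma ?C) * (ennreal (r powr (- 1 / 2) * exp (- r)) * ?I r * indicator {0<..} r) \<partial>lborel)"
    unfolding 1 by (intro nn_integral_cmult[symmetric]) measurable
  also have "\<dots> = (\<integral>\<^sup>+r. ennreal (2 powr (a - 2) * Gamma ?A) * ((ennreal (r powr (a / 2 - 1) * exp (- r)) * ?W r) * indicator {0<..} r) \<partial>lborel)"
  proof (intro nn_integral_cong)
    fix r :: real
    show "ennreal (Gamma ?C) * (ennreal (r powr (- 1 / 2) * exp (- r)) * ?I r * indicator {0<..} r) =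
       ennreal (2 powr (a - 2) * Gamma ?A) * ((ennreal (r powr (a / 2 - 1) * exp (- r)) * ?W r) * indicator {0<..} r)"
    proof (cases "0 < r")
      case True
      have "ennreal (Gamma ?C) * (ennreal (r powr (- 1 / 2) * exp (- r)) * ?I r * indicator {0<..} r)
        = ennreal (r powr (- 1 / 2) * exp (- r)) * (ennreal (Gamma ?C) * ?I r)"
        using True by (simp add: mult_ac)
      also have "\<dots> = ennreal (r powr (- 1 / 2) * exp (- r)) * ennreal (2 powr (a - 2) * Gamma ?A * r powr (a / 2 - 1 / 2)) * ?W r"
        by (subst W[OF True]) (simp only: mult.assoc)
      also have "ennreal (r powr (- 1 / 2) * exp (- r)) * ennreal (2 powr (a - 2) * Gamma ?A * r powr (a / 2 - 1 / 2))
        = ennreal (2 powr (a - 2) * Gamma ?A * (r powr (- 1 / 2 + (a / 2 - 1 / 2)) * exp (- r)))"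
        using pos by (simp only: powr_add ennreal_mult[symmetric] mult_nonneg_nonneg powr_ge_zero exp_ge_zero) (simp add: mult_ac)
      also have "- 1 / 2 + (a / 2 - 1 / 2) = a / 2 - 1" by simp
      also have "ennreal (2 powr (a - 2) * Gamma ?A * (r powr (a / 2 - 1) * exp (- r))) =
          ennreal (2 powr (a - 2) * Gamma ?A) * ennreal (r powr (a / 2 - 1) * exp (- r))"
        using pos by (intro ennreal_mult) auto
      finally show ?thesis using True by (simp only: mult.assoc) simp
    qed simp
  qed
  also have "\<dots> = ennreal (2 powr (a - 2) * Gamma ?A) * (\<integral>\<^sup>+r\<in>{0<..}. (ennreal (r powr (a / 2 - 1) * exp (- r)) * ?W r) \<partial>lborel)"
    by (intro nn_integral_cmult) measurable
  also have "(\<integral>\<^sup>+r\<in>{0<..}. (ennreal (r powr (a / 2 - 1) * exp (- r)) * ?W r) \<partial>lborel) =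
    (\<integral>\<^sup>+z\<in>{0<..}. (\<integral>\<^sup>+w\<in>{0<..<1}. ennreal (z powr (a / 2 - 1) * exp (- z) *
        (w powr (a / 2 - 3 / 2) * (1 - w) powr (v - a / 2) * exp (- (y\<^sup>2 / (4 * z) / w)))) \<partial>lborel) \<partial>lborel)"
    by (intro nn_integral_cong, subst nn_integral_cmult[symmetric])
      (auto simp: ennreal_mult[symmetric] mult.assoc[symmetric] intro!: nn_integral_cong arg_cong2[where f="(*)"])
  finally show ?thesis .
qed

section \<open>Moments of randomly weighted sums\<close>

lemma nn_integral_Beta:
  fixes a b :: real
  assumes "0 < a" "0 < b"
  shows "(\<integral>\<^sup>+x\<in>{0<..<1}. ennreal (x powr (a - 1) * (1 - x) powr (b - 1)) \<partial>lborel) = ennreal (Beta a b)"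
proof -
  have "((\<lambda>t. t powr (a - 1) * (1 - t) powr (b - 1)) has_integral Beta a b) {0<..<1}"
    using has_integral_Beta_real[of a b] assms by (simp add: has_integral_Icc_iff_Ioo)
  then show ?thesis
    by (rule nn_integral_has_integral_lebesgue'[rotated]) auto
qed

lemma nn_integral_Beta_nat:
  assumes "0 < s"
  shows "(\<integral>\<^sup>+r\<in>{0<..<s}. ennreal (r ^ q * (s - r) ^ p) \<partial>lborel) =
    ennreal (fact p * fact q / fact (p + q + 1) * s ^ (p + q + 1))"
proof -
  have "(\<integral>\<^sup>+r\<in>{0<..<s}. ennreal (r ^ q * (s - r) ^ p) \<partial>lborel) =
      ennreal \<bar>s\<bar> * (\<integral>\<^sup>+x. ennreal ((0 + s * x) ^ q * (s - (0 + s * x)) ^ p) * indicator {0<..<s} (0 + s * x) \<partial>lborel)"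
    using assms by (intro nn_integral_real_affine) auto
  also have "(\<integral>\<^sup>+x. ennreal ((0 + s * x) ^ q * (s - (0 + s * x)) ^ p) * indicator {0<..<s} (0 + s * x) \<partial>lborel)
      = (\<integral>\<^sup>+x. ennreal (s ^ (p + q)) * (ennreal (x powr (real (Suc q) - 1) * (1 - x) powr (real (Suc p) - 1)) * indicator {0<..<1} x) \<partial>lborel)"
  proof (intro nn_integral_cong)
    fix x :: real
    have "(s * x) ^ q * (s - s * x) ^ p = s ^ (p + q) * (x ^ q * (1 - x) ^ p)"
    proof -
      have "s - s * x = s * (1 - x)" by (simp add: algebra_simps)
      then show ?thesis by (simp only: power_mult_distrib power_add mult_ac)
    qed
    moreover have "s * x < s \<longleftrightarrow> x < 1" using assms by simp
    ultimately show "ennreal ((0 + s * x) ^ q * (s - (0 + s * x)) ^ p) * indicator {0<..<s} (0 + s * x) =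
        ennreal (s ^ (p + q)) * (ennreal (x powr (real (Suc q) - 1) * (1 - x) powr (real (Suc p) - 1)) * indicator {0<..<1} x)"
      using assms by (auto simp: indicator_def powr_realpow ennreal_mult[symmetric] zero_less_mult_iff)
  qed
  also have "\<dots> = ennreal (s ^ (p + q)) * ennreal (Beta (real (Suc q)) (real (Suc p)))"
    by (subst nn_integral_cmult) (simp_all only: nn_integral_Beta of_nat_0_less_iff zero_less_Suc, measurable)
  also have "Beta (real (Suc q)) (real (Suc p)) = fact p * fact q / fact (p + q + 1)"
    using Gamma_fact[of p, where 'a=real] Gamma_fact[of q, where 'a=real] Gamma_fact[of "p + q + 1", where 'a=real]
    by (simp add: Beta_def add_ac)
  finally show ?thesis using assms by (simp add: ennreal_mult[symmetric] mult_ac)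
qed

text \<open>In the variable u = r + d the domain is 0 < r < u, and integrating out r leaves a Beta
  integral. Here r will be an event time and d the next gap, so this is the step that adds a
  gap.\<close>

lemma nn_integral_power_convolution:
  fixes h :: "real \<Rightarrow> ennreal"
  assumes [measurable]: "h \<in> borel_measurable borel"
  shows "(\<integral>\<^sup>+r\<in>{0<..}. (\<integral>\<^sup>+d\<in>{0<..}. ennreal (r ^ q * d ^ p) * h (r + d) \<partial>lborel) \<partial>lborel) =
    (\<integral>\<^sup>+u\<in>{0<..}. ennreal (fact p * fact q / fact (p + q + 1) * u ^ (p + q + 1)) * h u \<partial>lborel)"
proof -
  let ?f = "\<lambda>r u::real. (if 0 < r \<and> r < u then ennreal (r ^ q * (u - r) ^ p) else 0) * h u"
  have "(\<integral>\<^sup>+r\<in>{0<..}. (\<integral>\<^sup>+d\<in>{0<..}. ennreal (r ^ q * d ^ p) * h (r + d) \<partial>lborel) \<partial>lborel) =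
     (\<integral>\<^sup>+r. (\<integral>\<^sup>+u. ?f r u \<partial>lborel) \<partial>lborel)"
  proof (intro nn_integral_cong)
    fix r :: real
    have measurable_fr: "?f r \<in> borel_measurable borel" by measurable
    have "(\<integral>\<^sup>+u. ?f r u \<partial>lborel) = (\<integral>\<^sup>+d. ?f r (r + 1 * d) \<partial>lborel)"
      using nn_integral_real_affine[of "?f r" 1 r] by (simp add: measurable_fr)
    also have "\<dots> = (\<integral>\<^sup>+d. indicator {0<..} r * (ennreal (r ^ q * d ^ p) * h (r + d) * indicator {0<..} d) \<partial>lborel)"
      by (intro nn_integral_cong) (auto simp: indicator_def)
    also have "\<dots> = indicator {0<..} r * (\<integral>\<^sup>+d\<in>{0<..}. ennreal (r ^ q * d ^ p) * h (r + d) \<partial>lborel)"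
      by (intro nn_integral_cmult) measurable
    finally show "(\<integral>\<^sup>+d\<in>{0<..}. ennreal (r ^ q * d ^ p) * h (r + d) \<partial>lborel) * indicator {0<..} r = (\<integral>\<^sup>+u. ?f r u \<partial>lborel)"
      by (simp add: mult.commute)
  qed
  also have "\<dots> = (\<integral>\<^sup>+u. (\<integral>\<^sup>+r. ?f r u \<partial>lborel) \<partial>lborel)"
    by (rule lborel_pair.Fubini') measurable
  also have "\<dots> = (\<integral>\<^sup>+u\<in>{0<..}. ennreal (fact p * fact q / fact (p + q + 1) * u ^ (p + q + 1)) * h u \<partial>lborel)"
  proof (intro nn_integral_cong)
    fix u :: real
    show "(\<integral>\<^sup>+r. ?f r u \<partial>lborel) = ennreal (fact p * fact q / fact (p + q + 1) * u ^ (p + q + 1)) * h u * indicator {0<..} u"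
    proof (cases "0 < u")
      case True
      have "(\<integral>\<^sup>+r. ?f r u \<partial>lborel) = (\<integral>\<^sup>+r\<in>{0<..<u}. ennreal (r ^ q * (u - r) ^ p) \<partial>lborel) * h u"
        by (subst nn_integral_multc[symmetric]) (auto intro!: nn_integral_cong simp: indicator_def)
      then show ?thesis using True nn_integral_Beta_nat[OF True] by simp
    next
      case False
      then have "(\<lambda>r. ?f r u) = (\<lambda>_. 0)" by (auto simp: fun_eq_iff)
      then show ?thesis using False by (simp only:) simp
    qed
  qed
  finally show ?thesis .
qed

text \<open>Tonelli for the product of the two laws. Both integrals are kept over \<open>M\<close>,
  with separate sample points, so that the law of the second variable alone can be inserted
  afterwards.\<close>

lemma (in prob_space) nn_integral_indep_var:
  assumes ind: "indep_var N1 X N2 Y" and f: "f \<in> borel_measurable (N1 \<Otimes>\<^sub>M N2)"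
  shows "(\<integral>\<^sup>+\<omega>. f (X \<omega>, Y \<omega>) \<partial>M) = (\<integral>\<^sup>+\<omega>. (\<integral>\<^sup>+\<omega>'. f (X \<omega>, Y \<omega>') \<partial>M) \<partial>M)"
proof -
  have X[measurable]: "X \<in> M \<rightarrow>\<^sub>M N1" and Y[measurable]: "Y \<in> M \<rightarrow>\<^sub>M N2"
    and eq: "distr M N1 X \<Otimes>\<^sub>M distr M N2 Y = distr M (N1 \<Otimes>\<^sub>M N2) (\<lambda>x. (X x, Y x))"
    using ind unfolding indep_var_distribution_eq by auto
  interpret Y: prob_space "distr M N2 Y" by (rule prob_space_distr) (rule Y)
  have f'[measurable]: "f \<in> borel_measurable (distr M N1 X \<Otimes>\<^sub>M distr M N2 Y)"
    using f by (simp cong: measurable_cong_sets)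
  have "(\<integral>\<^sup>+\<omega>. f (X \<omega>, Y \<omega>) \<partial>M) = (\<integral>\<^sup>+z. f z \<partial>(distr M N1 X \<Otimes>\<^sub>M distr M N2 Y))"
    unfolding eq using f by (subst nn_integral_distr) auto
  also have "\<dots> = (\<integral>\<^sup>+x. \<integral>\<^sup>+y. f (x, y) \<partial>distr M N2 Y \<partial>distr M N1 X)"
    by (rule Y.nn_integral_fst[symmetric]) measurable
  also have "\<dots> = (\<integral>\<^sup>+\<omega>. \<integral>\<^sup>+y. f (X \<omega>, y) \<partial>distr M N2 Y \<partial>M)"
    using Y.borel_measurable_nn_integral_fst[OF f'] by (intro nn_integral_distr X) (simp cong: measurable_cong_sets)
  also have "\<dots> = (\<integral>\<^sup>+\<omega>. (\<integral>\<^sup>+\<omega>'. f (X \<omega>, Y \<omega>') \<partial>M) \<partial>M)"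
  proof (rule nn_integral_cong)
    fix \<omega> assume "\<omega> \<in> space M"
    then have "X \<omega> \<in> space N1" using X by (rule measurable_space[rotated])
    then have "(\<lambda>y. f (X \<omega>, y)) \<in> borel_measurable N2" using f by (rule measurable_Pair2[rotated])
    then show "(\<integral>\<^sup>+y. f (X \<omega>, y) \<partial>distr M N2 Y) = (\<integral>\<^sup>+\<omega>'. f (X \<omega>, Y \<omega>') \<partial>M)"
      by (intro nn_integral_distr Y) (simp cong: measurable_cong_sets)
  qed
  finally show ?thesis .
qed

text \<open>Functions of disjoint blocks of an independent family are independent;
  \<open>\<phi>\<close> and \<open>\<psi>\<close> exhibit \<open>U\<close> and \<open>V\<close> as
  such functions.\<close>

lemma (in prob_space) nn_integral_indep_restrict:
  assumes "indep_vars N X I" "A \<inter> B = {}" "A \<subseteq> I" "B \<subseteq> I"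
    and [measurable]: "\<phi> \<in> PiM A N \<rightarrow>\<^sub>M N1" "\<psi> \<in> PiM B N \<rightarrow>\<^sub>M N2" "f \<in> borel_measurable (N1 \<Otimes>\<^sub>M N2)"
    and U: "\<And>\<omega>. U \<omega> = \<phi> (\<lambda>i\<in>A. X i \<omega>)" and V: "\<And>\<omega>. V \<omega> = \<psi> (\<lambda>i\<in>B. X i \<omega>)"
  shows "(\<integral>\<^sup>+\<omega>. f (U \<omega>, V \<omega>) \<partial>M) = (\<integral>\<^sup>+\<omega>. (\<integral>\<^sup>+\<omega>'. f (U \<omega>, V \<omega>') \<partial>M) \<partial>M)"
  using nn_integral_indep_var[OF indep_var_restrict[OF assms(1-4)], of "\<lambda>z. f (\<phi> (fst z), \<psi> (snd z))"]
  by (simp add: U V)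

text \<open>Abstracts from the angles: a mark enters only through its nonnegativity, its
  independence and its moments. A step contributes its exponential gap times its mark.\<close>

locale random_steps = prob_space +
  fixes D V :: "nat \<Rightarrow> 'a \<Rightarrow> real" and l :: real and \<mu> :: "nat \<Rightarrow> real"
  assumes rate_pos: "0 < l"
    and step_distributed: "1 \<le> j \<Longrightarrow> distributed M lborel (D j) (exponential_density l)"
    and mark_nonneg: "0 \<le> V j \<omega>"
    and mark_moment: "1 \<le> j \<Longrightarrow> (\<integral>\<^sup>+\<omega>. ennreal (V j \<omega> ^ k) \<partial>M) = ennreal (\<mu> k)"
    and moment_nonneg: "0 \<le> \<mu> k"
    and indep: "indep_vars (\<lambda>_. borel) (case_sum D V) ({1..} <+> {1..})"
begin

definition S :: "nat \<Rightarrow> 'a \<Rightarrow> real" where "S n \<omega> = (\<Sum>j = 1..n. D j \<omega>)"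
definition W :: "nat \<Rightarrow> 'a \<Rightarrow> real" where "W n \<omega> = (\<Sum>j = 1..n. D j \<omega> * V j \<omega>)"
text \<open>The n-fold convolution power of \<open>\<mu>\<close>. No factorials occur in the series,
  because those of the binomial theorem are cancelled by the Beta integrals over the gaps.\<close>

definition coeff :: "nat \<Rightarrow> nat \<Rightarrow> real" where "coeff n i = fps_nth (Abs_fps \<mu> ^ n) i"

lemma measurable_D: "1 \<le> j \<Longrightarrow> D j \<in> borel_measurable M"
  using step_distributed[of j] by (simp add: distributed_def)

lemma measurable_V: "1 \<le> j \<Longrightarrow> V j \<in> borel_measurable M"
  using indep unfolding indep_vars_def by (auto dest!: bspec[of _ _ "Inr j"])

lemma measurable_S[measurable]: "S n \<in> borel_measurable M"
  unfolding S_def[abs_def] by (auto intro!: borel_measurable_sum measurable_D)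

lemma measurable_W[measurable]: "W n \<in> borel_measurable M"
  unfolding W_def[abs_def] by (auto intro!: borel_measurable_sum borel_measurable_times measurable_D measurable_V)

lemma measurable_D_Suc[measurable]: "D (Suc n) \<in> borel_measurable M"
  by (rule measurable_D) simp

lemma measurable_V_Suc[measurable]: "V (Suc n) \<in> borel_measurable M"
  by (rule measurable_V) simp

lemma AE_D_pos: "AE \<omega> in M. \<forall>j\<ge>1. 0 < D j \<omega>"
proof -
  have "AE \<omega> in M. 1 \<le> j \<longrightarrow> 0 < D j \<omega>" for j
  proof (cases "1 \<le> j")
    case True
    have "AE x in lborel. 0 < exponential_density l x \<longrightarrow> 0 < x"
      using AE_lborel_singleton[of "0::real"] by eventually_elim (auto simp: exponential_density_def)
    then have "AE x in density lborel (exponential_density l). 0 < x"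
      by (subst AE_density) auto
    then have "AE x in distr M lborel (D j). 0 < x"
      using distributed_distr_eq_density[OF step_distributed[OF True]] by (simp only:)
    then have "AE \<omega> in M. 0 < D j \<omega>"
      using measurable_D[OF True] by (subst (asm) AE_distr_iff) auto
    then show ?thesis by eventually_elim auto
  qed simp
  then show ?thesis by (subst AE_all_countable) auto
qed

lemma AE_nonneg: "AE \<omega> in M. 0 \<le> W n \<omega> \<and> 0 < D (Suc n) \<omega> \<and> 0 \<le> S n \<omega>"
  using AE_D_pos by eventually_elim
    (auto simp: W_def S_def less_imp_le intro!: sum_nonneg mult_nonneg_nonneg mark_nonneg)

text \<open>A new step is integrated out in two stages: its mark, given the past and the gap, and
  then its gap, given the past. Each part rests on two disjoint blocks of indices.\<close>

lemma nn_integral_indep_step: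
  "f \<in> borel_measurable (borel \<Otimes>\<^sub>M borel) \<Longrightarrow>
    (\<integral>\<^sup>+\<omega>. f ((W n \<omega>, S n \<omega>), D (Suc n) \<omega>) \<partial>M) = (\<integral>\<^sup>+\<omega>. (\<integral>\<^sup>+\<omega>'. f ((W n \<omega>, S n \<omega>), D (Suc n) \<omega>') \<partial>M) \<partial>M)"
  "g \<in> borel_measurable (borel \<Otimes>\<^sub>M borel) \<Longrightarrow>
    (\<integral>\<^sup>+\<omega>. g ((W n \<omega>, S n \<omega>, D (Suc n) \<omega>), V (Suc n) \<omega>) \<partial>M) = (\<integral>\<^sup>+\<omega>. (\<integral>\<^sup>+\<omega>'. g ((W n \<omega>, S n \<omega>, D (Suc n) \<omega>), V (Suc n) \<omega>') \<partial>M) \<partial>M)"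
proof -
  let ?A = "{1..n} <+> {1..n}" and ?A' = "{1..Suc n} <+> {1..n}"
  have 1: "(\<lambda>f. (\<Sum>j = 1..n. f (Inl j) * f (Inr j), \<Sum>j = 1..n. f (Inl j))) \<in> PiM ?A (\<lambda>_. borel) \<rightarrow>\<^sub>M (borel :: (real \<times> real) measure)"
    by (auto intro!: borel_measurable_Pair borel_measurable_sum borel_measurable_times measurable_component_singleton)
  have 2: "(\<lambda>f. (\<Sum>j = 1..n. f (Inl j) * f (Inr j), \<Sum>j = 1..n. f (Inl j), f (Inl (Suc n)))) \<in> PiM ?A' (\<lambda>_. borel) \<rightarrow>\<^sub>M (borel :: (real \<times> real \<times> real) measure)"
    by (auto intro!: borel_measurable_Pair borel_measurable_sum borel_measurable_times measurable_component_singleton)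
  have 3: "(\<lambda>f. f i) \<in> PiM {i} (\<lambda>_. borel) \<rightarrow>\<^sub>M (borel :: real measure)" for i :: "nat + nat"
    by (intro measurable_component_singleton) simp
  show "(\<integral>\<^sup>+\<omega>. f ((W n \<omega>, S n \<omega>), D (Suc n) \<omega>) \<partial>M) = (\<integral>\<^sup>+\<omega>. (\<integral>\<^sup>+\<omega>'. f ((W n \<omega>, S n \<omega>), D (Suc n) \<omega>') \<partial>M) \<partial>M)"
    if "f \<in> borel_measurable (borel \<Otimes>\<^sub>M borel)"
    by (rule nn_integral_indep_restrict[OF indep, of ?A "{Inl (Suc n)}", OF _ _ _ 1 3 that])
      (auto simp: W_def S_def intro!: sum.cong)
  show "(\<integral>\<^sup>+\<omega>. g ((W n \<omega>, S n \<omega>, D (Suc n) \<omega>), V (Suc n) \<omega>) \<partial>M) = (\<integral>\<^sup>+\<omega>. (\<integral>\<^sup>+\<omega>'. g ((W n \<omega>, S n \<omega>, D (Suc n) \<omega>), V (Suc n) \<omega>') \<partial>M) \<partial>M)"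
    if "g \<in> borel_measurable (borel \<Otimes>\<^sub>M borel)"
    by (rule nn_integral_indep_restrict[OF indep, of ?A' "{Inr (Suc n)}", OF _ _ _ 2 3 that])
      (auto simp: W_def S_def intro!: sum.cong)
qed

text \<open>Binomial theorem, followed by integration of the mark. The length \<open>\<phi>\<close>
  of the step and the weight \<open>g\<close> are left general because two kinds of step occur: a
  complete one of length d, and the last one, cut off at time s.\<close>

lemma nn_integral_step_expand:
  assumes [measurable]: "case_prod \<phi> \<in> borel_measurable (borel \<Otimes>\<^sub>M borel)" "case_prod g \<in> borel_measurable (borel \<Otimes>\<^sub>M borel)"
    and nonneg: "\<And>r d. 0 \<le> \<phi> r d"
  shows "(\<integral>\<^sup>+\<omega>. ennreal ((W n \<omega> + \<phi> (S n \<omega>) (D (Suc n) \<omega>) * V (Suc n) \<omega>) ^ k) * g (S n \<omega>) (D (Suc n) \<omega>) \<partial>M) =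
    (\<Sum>i\<le>k. ennreal (real (k choose i) * \<mu> (k - i)) *
      (\<integral>\<^sup>+\<omega>. ennreal (W n \<omega> ^ i) * (ennreal (\<phi> (S n \<omega>) (D (Suc n) \<omega>) ^ (k - i)) * g (S n \<omega>) (D (Suc n) \<omega>)) \<partial>M))"
proof -
  let ?h = "\<lambda>i \<omega>. ennreal (W n \<omega> ^ i) * (ennreal (\<phi> (S n \<omega>) (D (Suc n) \<omega>) ^ (k - i)) * g (S n \<omega>) (D (Suc n) \<omega>))"
  have h[measurable]: "?h i \<in> borel_measurable M" for i by measurable
  have "(\<integral>\<^sup>+\<omega>. ennreal ((W n \<omega> + \<phi> (S n \<omega>) (D (Suc n) \<omega>) * V (Suc n) \<omega>) ^ k) * g (S n \<omega>) (D (Suc n) \<omega>) \<partial>M)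
    = (\<integral>\<^sup>+\<omega>. (\<Sum>i\<le>k. ennreal (real (k choose i)) * (?h i \<omega> * ennreal (V (Suc n) \<omega> ^ (k - i)))) \<partial>M)"
  proof (rule nn_integral_cong_AE, use AE_nonneg[of n] in eventually_elim)
    fix \<omega> assume *: "0 \<le> W n \<omega> \<and> 0 < D (Suc n) \<omega> \<and> 0 \<le> S n \<omega>"
    let ?p = "\<phi> (S n \<omega>) (D (Suc n) \<omega>)" and ?v = "V (Suc n) \<omega>"
    have v: "0 \<le> ?v" by (rule mark_nonneg)
    have "ennreal ((W n \<omega> + ?p * ?v) ^ k) = ennreal (\<Sum>i\<le>k. real (k choose i) * W n \<omega> ^ i * (?p ^ (k - i) * ?v ^ (k - i)))"
      by (simp add: binomial_ring power_mult_distrib)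
    also have "\<dots> = (\<Sum>i\<le>k. ennreal (real (k choose i) * W n \<omega> ^ i * (?p ^ (k - i) * ?v ^ (k - i))))"
      using * v nonneg by (intro sum_ennreal[symmetric]) auto
    finally have e: "ennreal ((W n \<omega> + ?p * ?v) ^ k) = (\<Sum>i\<le>k. ennreal (real (k choose i) * W n \<omega> ^ i * (?p ^ (k - i) * ?v ^ (k - i))))" .
    show "ennreal ((W n \<omega> + ?p * ?v) ^ k) * g (S n \<omega>) (D (Suc n) \<omega>) = (\<Sum>i\<le>k. ennreal (real (k choose i)) * (?h i \<omega> * ennreal (?v ^ (k - i))))"
      unfolding e sum_distrib_right using * v nonneg by (intro sum.cong refl) (simp add: ennreal_mult mult_ac)
  qed
  also have "\<dots> = (\<Sum>i\<le>k. ennreal (real (k choose i)) * (\<integral>\<^sup>+\<omega>. ?h i \<omega> * ennreal (V (Suc n) \<omega> ^ (k - i)) \<partial>M))"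
    by (subst nn_integral_sum, measurable, subst nn_integral_cmult, measurable)
  also have "\<dots> = (\<Sum>i\<le>k. ennreal (real (k choose i) * \<mu> (k - i)) * (\<integral>\<^sup>+\<omega>. ?h i \<omega> \<partial>M))"
  proof (intro sum.cong refl)
    fix i
    let ?f = "\<lambda>z. ennreal (fst (fst z) ^ i) * (ennreal (\<phi> (fst (snd (fst z))) (snd (snd (fst z))) ^ (k - i)) *
      g (fst (snd (fst z))) (snd (snd (fst z)))) * ennreal (snd z ^ (k - i))"
    have "?f \<in> borel_measurable ((borel :: (real \<times> real \<times> real) measure) \<Otimes>\<^sub>M (borel :: real measure))"
      unfolding borel_prod[symmetric] by measurable
    from nn_integral_indep_step(2)[OF this, of n]
    have "(\<integral>\<^sup>+\<omega>. ?h i \<omega> * ennreal (V (Suc n) \<omega> ^ (k - i)) \<partial>M) = (\<integral>\<^sup>+\<omega>. (\<integral>\<^sup>+\<omega>'. ?h i \<omega> * ennreal (V (Suc n) \<omega>' ^ (k - i)) \<partial>M) \<partial>M)"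
      by simp
    also have "\<dots> = (\<integral>\<^sup>+\<omega>. ?h i \<omega> * ennreal (\<mu> (k - i)) \<partial>M)"
      by (subst nn_integral_cmult) (simp_all add: mark_moment)
    also have "\<dots> = (\<integral>\<^sup>+\<omega>. ?h i \<omega> \<partial>M) * ennreal (\<mu> (k - i))"
      by (rule nn_integral_multc) measurable
    finally show "ennreal (real (k choose i)) * (\<integral>\<^sup>+\<omega>. ?h i \<omega> * ennreal (V (Suc n) \<omega> ^ (k - i)) \<partial>M) =
      ennreal (real (k choose i) * \<mu> (k - i)) * (\<integral>\<^sup>+\<omega>. ?h i \<omega> \<partial>M)"
      using moment_nonneg by (simp add: ennreal_mult mult_ac)
  qed
  finally show ?thesis .
qed

lemma nn_integral_exponential:
  assumes [measurable]: "h \<in> borel_measurable borel"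
  shows "(\<integral>\<^sup>+\<omega>. h (D (Suc n) \<omega>) \<partial>M) = (\<integral>\<^sup>+d\<in>{0<..}. ennreal (l * exp (- l * d)) * h d \<partial>lborel)"
proof -
  have "(\<integral>\<^sup>+\<omega>. h (D (Suc n) \<omega>) \<partial>M) = (\<integral>\<^sup>+d. ennreal (exponential_density l d) * h d \<partial>lborel)"
    by (rule distributed_nn_integral[symmetric, OF step_distributed]) auto
  also have "\<dots> = (\<integral>\<^sup>+d\<in>{0<..}. ennreal (l * exp (- l * d)) * h d \<partial>lborel)"
    using AE_lborel_singleton[of "0::real"]
    by (intro nn_integral_cong_AE, eventually_elim) (auto simp: exponential_density_def indicator_def mult_ac)
  finally show ?thesis .
qed

lemma nn_integral_step:
  assumes [measurable]: "case_prod g \<in> borel_measurable (borel \<Otimes>\<^sub>M borel)"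
  shows "(\<integral>\<^sup>+\<omega>. ennreal (W n \<omega> ^ i) * g (S n \<omega>) (D (Suc n) \<omega>) \<partial>M) =
    (\<integral>\<^sup>+\<omega>. ennreal (W n \<omega> ^ i) * (\<integral>\<^sup>+d\<in>{0<..}. ennreal (l * exp (- l * d)) * g (S n \<omega>) d \<partial>lborel) \<partial>M)"
proof -
  let ?f = "\<lambda>z. ennreal (fst (fst z) ^ i) * g (snd (fst z)) (snd z)"
  have "?f \<in> borel_measurable ((borel :: (real \<times> real) measure) \<Otimes>\<^sub>M (borel :: real measure))"
    unfolding borel_prod[symmetric] by measurable
  from nn_integral_indep_step(1)[OF this, of n]
  have "(\<integral>\<^sup>+\<omega>. ennreal (W n \<omega> ^ i) * g (S n \<omega>) (D (Suc n) \<omega>) \<partial>M) =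
     (\<integral>\<^sup>+\<omega>. (\<integral>\<^sup>+\<omega>'. ennreal (W n \<omega> ^ i) * g (S n \<omega>) (D (Suc n) \<omega>') \<partial>M) \<partial>M)"
    by simp
  also have "\<dots> = (\<integral>\<^sup>+\<omega>. ennreal (W n \<omega> ^ i) * (\<integral>\<^sup>+\<omega>'. g (S n \<omega>) (D (Suc n) \<omega>') \<partial>M) \<partial>M)"
    by (subst nn_integral_cmult) measurable
  also have "\<dots> = (\<integral>\<^sup>+\<omega>. ennreal (W n \<omega> ^ i) * (\<integral>\<^sup>+d\<in>{0<..}. ennreal (l * exp (- l * d)) * g (S n \<omega>) d \<partial>lborel) \<partial>M)"
    by (subst nn_integral_exponential) measurable
  finally show ?thesis .
qed

end

lemma nn_integral_exponential_tail:
  fixes l a :: real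
  assumes "0 < l"
  shows "(\<integral>\<^sup>+d\<in>{a<..}. ennreal (l * exp (- l * d)) \<partial>lborel) = ennreal (exp (- l * a))"
proof -
  have "(\<integral>\<^sup>+d\<in>{a<..}. ennreal (l * exp (- l * d)) \<partial>lborel) = (\<integral>\<^sup>+d\<in>{a..}. ennreal (l * exp (- l * d)) \<partial>lborel)"
    using AE_lborel_singleton[of a] by (intro nn_integral_cong_AE, eventually_elim) (auto simp: indicator_def)
  also have "\<dots> = ennreal (0 - (- exp (- l * a)))"
  proof (rule nn_integral_FTC_atLeast)
    have "filterlim (\<lambda>x. - (l * x)) at_bot at_top"
      using assms by (intro filterlim_compose[OF filterlim_uminus_at_bot_at_top] filterlim_tendsto_pos_mult_at_top[OF tendsto_const] filterlim_ident)
    then have "((\<lambda>x. - exp (- (l * x))) \<longlongrightarrow> - 0) at_top"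
      by (intro tendsto_minus filterlim_compose[OF exp_at_bot])
    then show "((\<lambda>x. - exp (- l * x)) \<longlongrightarrow> 0) at_top" by simp
  qed (use assms in \<open>auto intro!: derivative_eq_intros\<close>)
  finally show ?thesis by simp
qed

context random_steps
begin

lemma coeff_Suc: "coeff (Suc n) k = (\<Sum>i\<le>k. coeff n i * \<mu> (k - i))"
  unfolding coeff_def power_Suc2 fps_mult_nth by (simp add: atLeast0AtMost)

lemma coeff_nonneg: "0 \<le> coeff n k"
proof (induction n arbitrary: k)
  case 0
  then show ?case by (simp add: coeff_def)
next
  case (Suc n)
  then show ?case unfolding coeff_Suc by (auto intro!: sum_nonneg mult_nonneg_nonneg moment_nonneg)
qed

lemma nn_integral_Suc:
  assumes [measurable]: "h \<in> borel_measurable borel"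
  shows "(\<integral>\<^sup>+\<omega>. ennreal (W (Suc n) \<omega> ^ k) * h (S (Suc n) \<omega>) \<partial>M) =
    (\<Sum>i\<le>k. ennreal (real (k choose i) * \<mu> (k - i)) * (\<integral>\<^sup>+\<omega>. ennreal (W n \<omega> ^ i) *
      (\<integral>\<^sup>+d\<in>{0<..}. ennreal (l * exp (- l * d)) * (ennreal (d ^ (k - i)) * h (S n \<omega> + d)) \<partial>lborel) \<partial>M))"
proof -
  \<comment> \<open>A gap is positive only almost surely, whereas the expansion demands a length
    that is nonnegative everywhere; hence the absolute value. It disappears again once the gap is
    integrated over d > 0.\<close>
  have "(\<integral>\<^sup>+\<omega>. ennreal (W (Suc n) \<omega> ^ k) * h (S (Suc n) \<omega>) \<partial>M) =
    (\<integral>\<^sup>+\<omega>. ennreal ((W n \<omega> + \<bar>D (Suc n) \<omega>\<bar> * V (Suc n) \<omega>) ^ k) * h (S n \<omega> + D (Suc n) \<omega>) \<partial>M)"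
    by (rule nn_integral_cong_AE, use AE_nonneg[of n] in eventually_elim) (simp add: W_def S_def)
  also have "\<dots> = (\<Sum>i\<le>k. ennreal (real (k choose i) * \<mu> (k - i)) * (\<integral>\<^sup>+\<omega>. ennreal (W n \<omega> ^ i) *
      (ennreal (\<bar>D (Suc n) \<omega>\<bar> ^ (k - i)) * h (S n \<omega> + D (Suc n) \<omega>)) \<partial>M))"
    by (rule nn_integral_step_expand[of "\<lambda>r d. \<bar>d\<bar>" "\<lambda>r d. h (r + d)"]) (auto simp: case_prod_beta)
  also have "\<dots> = (\<Sum>i\<le>k. ennreal (real (k choose i) * \<mu> (k - i)) * (\<integral>\<^sup>+\<omega>. ennreal (W n \<omega> ^ i) *
      (\<integral>\<^sup>+d\<in>{0<..}. ennreal (l * exp (- l * d)) * (ennreal (\<bar>d\<bar> ^ (k - i)) * h (S n \<omega> + d)) \<partial>lborel) \<partial>M))"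
    by (subst nn_integral_step[of "\<lambda>r d. ennreal (\<bar>d\<bar> ^ (k - _)) * h (r + d)"]) (auto simp: case_prod_beta)
  also have "\<dots> = (\<Sum>i\<le>k. ennreal (real (k choose i) * \<mu> (k - i)) * (\<integral>\<^sup>+\<omega>. ennreal (W n \<omega> ^ i) *
      (\<integral>\<^sup>+d\<in>{0<..}. ennreal (l * exp (- l * d)) * (ennreal (d ^ (k - i)) * h (S n \<omega> + d)) \<partial>lborel) \<partial>M))"
  proof (intro sum.cong refl, rule arg_cong2[where f="(*)"], rule refl, rule nn_integral_cong, rule arg_cong2[where f="(*)"], rule refl)
    fix i \<omega>
    show "(\<integral>\<^sup>+d\<in>{0<..}. ennreal (l * exp (- l * d)) * (ennreal (\<bar>d\<bar> ^ (k - i)) * h (S n \<omega> + d)) \<partial>lborel) =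
      (\<integral>\<^sup>+d\<in>{0<..}. ennreal (l * exp (- l * d)) * (ennreal (d ^ (k - i)) * h (S n \<omega> + d)) \<partial>lborel)"
      by (rule nn_integral_cong) (auto simp: indicator_def)
  qed
  finally show ?thesis .
qed

text \<open>The event time S (n + 1) has density l^(n+1) r^n exp (- l r) / n!, so this says that
  given S (n + 1) = r the k-th moment of W (n + 1) is r^k n! k! / (n + k)! times the coefficient.
  The arbitrary test function \<open>h\<close> lets the induction close: it is applied to
  \<open>h\<close> averaged over the next gap.\<close>

lemma nn_integral_moment:
  assumes "h \<in> borel_measurable borel"
  shows "(\<integral>\<^sup>+\<omega>. ennreal (W (Suc n) \<omega> ^ k) * h (S (Suc n) \<omega>) \<partial>M) =
    ennreal (l ^ Suc n * (fact k / fact (n + k)) * coeff (Suc n) k) *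
      (\<integral>\<^sup>+r\<in>{0<..}. ennreal (r ^ (n + k) * exp (- l * r)) * h r \<partial>lborel)"
  using assms
proof (induction n arbitrary: k h)
  case 0
  note [measurable] = 0
  let ?t = "\<lambda>i. ennreal (real (k choose i) * \<mu> (k - i)) * (\<integral>\<^sup>+\<omega>. ennreal (W 0 \<omega> ^ i) *
      (\<integral>\<^sup>+d\<in>{0<..}. ennreal (l * exp (- l * d)) * (ennreal (d ^ (k - i)) * h (S 0 \<omega> + d)) \<partial>lborel) \<partial>M)"
  \<comment> \<open>\<open>W 0\<close> is the empty sum, so all terms except i = 0 vanish.\<close>
  have "(\<Sum>i\<le>k. ?t i) = (\<Sum>i\<in>{0}. ?t i)"
    by (rule sum.mono_neutral_right) (auto simp: W_def power_0_left)
  then have "(\<integral>\<^sup>+\<omega>. ennreal (W (Suc 0) \<omega> ^ k) * h (S (Suc 0) \<omega>) \<partial>M) = ?t 0"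
    unfolding nn_integral_Suc[OF 0] by simp
  also have "\<dots> = ennreal (\<mu> k) * (\<integral>\<^sup>+d\<in>{0<..}. ennreal (l * exp (- l * d)) * (ennreal (d ^ k) * h d) \<partial>lborel)"
    by (simp add: W_def S_def emeasure_space_1)
  also have "(\<integral>\<^sup>+d\<in>{0<..}. ennreal (l * exp (- l * d)) * (ennreal (d ^ k) * h d) \<partial>lborel)
     = (\<integral>\<^sup>+d. ennreal l * (ennreal (d ^ (0 + k) * exp (- l * d)) * h d * indicator {0<..} d) \<partial>lborel)"
    using rate_pos by (intro nn_integral_cong) (auto simp: indicator_def ennreal_mult mult_ac)
  also have "\<dots> = ennreal l * (\<integral>\<^sup>+d\<in>{0<..}. ennreal (d ^ (0 + k) * exp (- l * d)) * h d \<partial>lborel)"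
    by (rule nn_integral_cmult) measurable
  finally show ?case
    using rate_pos moment_nonneg by (simp add: coeff_def ennreal_mult mult_ac)
next
  case (Suc n)
  note [measurable] = Suc.prems
  let ?J = "\<integral>\<^sup>+u\<in>{0<..}. ennreal (u ^ (Suc n + k) * exp (- l * u)) * h u \<partial>lborel"
  have inner: "(\<integral>\<^sup>+\<omega>. ennreal (W (Suc n) \<omega> ^ i) *
      (\<integral>\<^sup>+d\<in>{0<..}. ennreal (l * exp (- l * d)) * (ennreal (d ^ (k - i)) * h (S (Suc n) \<omega> + d)) \<partial>lborel) \<partial>M) =
    ennreal (l ^ Suc (Suc n) * (fact i * fact (k - i) / fact (Suc n + k)) * coeff (Suc n) i) * ?J"
    if "i \<le> k" for i
  proof -
    let ?h = "\<lambda>r. \<integral>\<^sup>+d\<in>{0<..}. ennreal (l * exp (- l * d)) * (ennreal (d ^ (k - i)) * h (r + d)) \<partial>lborel"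
    have "(\<integral>\<^sup>+\<omega>. ennreal (W (Suc n) \<omega> ^ i) * ?h (S (Suc n) \<omega>) \<partial>M) =
      ennreal (l ^ Suc n * (fact i / fact (n + i)) * coeff (Suc n) i) *
      (\<integral>\<^sup>+r\<in>{0<..}. ennreal (r ^ (n + i) * exp (- l * r)) * ?h r \<partial>lborel)"
      by (rule Suc.IH) measurable
    also have "(\<integral>\<^sup>+r\<in>{0<..}. ennreal (r ^ (n + i) * exp (- l * r)) * ?h r \<partial>lborel) =
      (\<integral>\<^sup>+r. ennreal l * ((\<integral>\<^sup>+d\<in>{0<..}. ennreal (r ^ (n + i) * d ^ (k - i)) * (ennreal (exp (- l * (r + d))) * h (r + d)) \<partial>lborel) * indicator {0<..} r) \<partial>lborel)"
    proof (intro nn_integral_cong)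
      fix r :: real
      show "ennreal (r ^ (n + i) * exp (- l * r)) * ?h r * indicator {0<..} r =
        ennreal l * ((\<integral>\<^sup>+d\<in>{0<..}. ennreal (r ^ (n + i) * d ^ (k - i)) * (ennreal (exp (- l * (r + d))) * h (r + d)) \<partial>lborel) * indicator {0<..} r)"
      proof (cases "0 < r")
        case True
        have "ennreal (r ^ (n + i) * exp (- l * r)) * ?h r = (\<integral>\<^sup>+d. ennreal (r ^ (n + i) * exp (- l * r)) * (ennreal (l * exp (- l * d)) * (ennreal (d ^ (k - i)) * h (r + d)) * indicator {0<..} d) \<partial>lborel)"
          by (rule nn_integral_cmult[symmetric]) measurable
        also have "\<dots> = (\<integral>\<^sup>+d. ennreal l * (ennreal (r ^ (n + i) * d ^ (k - i)) * (ennreal (exp (- l * (r + d))) * h (r + d)) * indicator {0<..} d) \<partial>lborel)"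
        proof (intro nn_integral_cong)
          fix d :: real
          have "exp (- l * (r + d)) = exp (- l * r) * exp (- l * d)" by (simp add: exp_add[symmetric] algebra_simps)
          then show "ennreal (r ^ (n + i) * exp (- l * r)) * (ennreal (l * exp (- l * d)) * (ennreal (d ^ (k - i)) * h (r + d)) * indicator {0<..} d) =
             ennreal l * (ennreal (r ^ (n + i) * d ^ (k - i)) * (ennreal (exp (- l * (r + d))) * h (r + d)) * indicator {0<..} d)"
            using True rate_pos by (auto simp: indicator_def ennreal_mult mult_ac)
        qed
        also have "\<dots> = ennreal l * (\<integral>\<^sup>+d\<in>{0<..}. ennreal (r ^ (n + i) * d ^ (k - i)) * (ennreal (exp (- l * (r + d))) * h (r + d)) \<partial>lborel)"
          by (rule nn_integral_cmult) measurable
        finally show ?thesis using True by simp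
      qed simp
    qed
    also have "\<dots> = ennreal l * (\<integral>\<^sup>+r\<in>{0<..}. (\<integral>\<^sup>+d\<in>{0<..}. ennreal (r ^ (n + i) * d ^ (k - i)) * (ennreal (exp (- l * (r + d))) * h (r + d)) \<partial>lborel) \<partial>lborel)"
      by (rule nn_integral_cmult) measurable
    also have "(\<integral>\<^sup>+r\<in>{0<..}. (\<integral>\<^sup>+d\<in>{0<..}. ennreal (r ^ (n + i) * d ^ (k - i)) * (ennreal (exp (- l * (r + d))) * h (r + d)) \<partial>lborel) \<partial>lborel) =
       (\<integral>\<^sup>+u\<in>{0<..}. ennreal (fact (k - i) * fact (n + i) / fact ((k - i) + (n + i) + 1) * u ^ ((k - i) + (n + i) + 1)) * (ennreal (exp (- l * u)) * h u) \<partial>lborel)"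
      by (rule nn_integral_power_convolution) measurable
    \<comment> \<open>The total exponent does not depend on i, so the same integral
      \<open>?J\<close> factors out of the whole binomial sum.\<close>
    also have "(k - i) + (n + i) + 1 = Suc n + k" using that by simp
    also have "(\<integral>\<^sup>+u\<in>{0<..}. ennreal (fact (k - i) * fact (n + i) / fact (Suc n + k) * u ^ (Suc n + k)) * (ennreal (exp (- l * u)) * h u) \<partial>lborel) =
       (\<integral>\<^sup>+u. ennreal (fact (k - i) * fact (n + i) / fact (Suc n + k)) * (ennreal (u ^ (Suc n + k) * exp (- l * u)) * h u * indicator {0<..} u) \<partial>lborel)"
    proof (intro nn_integral_cong)
      fix u :: real
      have "ennreal (a * p) * (ennreal e * h u) = ennreal a * (ennreal (p * e) * h u)" if "0 \<le> a" "0 \<le> p" "0 \<le> e" for a p e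
        using that by (simp add: ennreal_mult mult_ac)
      from this[of "fact (k - i) * fact (n + i) / fact (Suc n + k)" "u ^ (Suc n + k)" "exp (- l * u)"]
      show "ennreal (fact (k - i) * fact (n + i) / fact (Suc n + k) * u ^ (Suc n + k)) * (ennreal (exp (- l * u)) * h u) * indicator {0<..} u =
        ennreal (fact (k - i) * fact (n + i) / fact (Suc n + k)) * (ennreal (u ^ (Suc n + k) * exp (- l * u)) * h u * indicator {0<..} u)"
        by (auto simp: indicator_def)
    qed
    also have "\<dots> = ennreal (fact (k - i) * fact (n + i) / fact (Suc n + k)) * ?J"
      by (rule nn_integral_cmult) measurable
    also have "ennreal (l ^ Suc n * (fact i / fact (n + i)) * coeff (Suc n) i) * (ennreal l * (ennreal (fact (k - i) * fact (n + i) / fact (Suc n + k)) * ?J))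
      = ennreal (l ^ Suc n * (fact i / fact (n + i)) * coeff (Suc n) i * l * (fact (k - i) * fact (n + i) / fact (Suc n + k))) * ?J"
    proof -
      have "ennreal a * (ennreal b * (ennreal c * J)) = ennreal (a * b * c) * J" if "0 \<le> a" "0 \<le> b" "0 \<le> c" for a b c J
        using that by (simp add: ennreal_mult mult.assoc)
      then show ?thesis by this (use rate_pos coeff_nonneg in \<open>auto simp del: fact_Suc power_Suc\<close>)
    qed
    also have "l ^ Suc n * (fact i / fact (n + i)) * coeff (Suc n) i * l * (fact (k - i) * fact (n + i) / fact (Suc n + k)) =
       l ^ Suc (Suc n) * (fact i * fact (k - i) / fact (Suc n + k)) * coeff (Suc n) i"
      by (simp del: fact_Suc)
    finally show ?thesis .
  qed
  let ?c = "\<lambda>i. real (k choose i) * \<mu> (k - i) * (l ^ Suc (Suc n) * (fact i * fact (k - i) / fact (Suc n + k)) * coeff (Suc n) i)"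
  have "(\<integral>\<^sup>+\<omega>. ennreal (W (Suc (Suc n)) \<omega> ^ k) * h (S (Suc (Suc n)) \<omega>) \<partial>M) = (\<Sum>i\<le>k. ennreal (?c i) * ?J)"
    unfolding nn_integral_Suc[OF Suc.prems]
  proof (intro sum.cong refl)
    fix i assume "i \<in> {..k}"
    then have i: "i \<le> k" by simp
    have "ennreal a * (ennreal b * J) = ennreal (a * b) * J" if "0 \<le> a" "0 \<le> b" for a b J
      using that by (simp add: ennreal_mult mult.assoc)
    then show "ennreal (real (k choose i) * \<mu> (k - i)) * (\<integral>\<^sup>+\<omega>. ennreal (W (Suc n) \<omega> ^ i) *
      (\<integral>\<^sup>+d\<in>{0<..}. ennreal (l * exp (- l * d)) * (ennreal (d ^ (k - i)) * h (S (Suc n) \<omega> + d)) \<partial>lborel) \<partial>M) = ennreal (?c i) * ?J"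
      unfolding inner[OF i] by this (use rate_pos moment_nonneg coeff_nonneg in \<open>auto simp del: fact_Suc power_Suc\<close>)
  qed
  also have "\<dots> = ennreal (\<Sum>i\<le>k. ?c i) * ?J"
    unfolding sum_distrib_right[symmetric] using rate_pos moment_nonneg coeff_nonneg
    by (subst sum_ennreal) (auto simp del: fact_Suc power_Suc)
  \<comment> \<open>The binomial coefficient cancels i! (k - i)! and leaves k!; what remains is the
    convolution that defines the next \<open>coeff\<close>.\<close>
  also have "(\<Sum>i\<le>k. ?c i) = l ^ Suc (Suc n) * (fact k / fact (Suc n + k)) * coeff (Suc (Suc n)) k"
    unfolding coeff_Suc[of "Suc n"] sum_distrib_left
  proof (intro sum.cong refl)
    fix i assume "i \<in> {..k}"
    then have "real (k choose i) * (fact i * fact (k - i)) = fact k"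
      by (simp add: binomial_fact)
    then show "?c i = l ^ Suc (Suc n) * (fact k / fact (Suc n + k)) * (coeff (Suc n) i * \<mu> (k - i))"
      by (simp del: fact_Suc power_Suc add: field_simps)
  qed
  finally show ?case .
qed

text \<open>The event in the indicator is N(s) = n + 1. The last of the n + 2 steps has length s - S
  (n + 1), and its gap only has to outlast s, which contributes exp (- l (s - r)) at S (n + 1) = r.
  The rest is a Beta integral over r in (0, s).\<close>

lemma nn_integral_moment_at:
  assumes s: "0 < s"
  shows "(\<integral>\<^sup>+\<omega>. ennreal ((W (Suc n) \<omega> + (s - S (Suc n) \<omega>) * V (Suc (Suc n)) \<omega>) ^ k) *
      indicator {\<omega>. S (Suc n) \<omega> \<le> s \<and> s < S (Suc (Suc n)) \<omega>} \<omega> \<partial>M) =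
    ennreal (exp (- l * s) * l ^ Suc n * s ^ (Suc n + k) * (fact k / fact (Suc n + k)) * coeff (Suc (Suc n)) k)"
proof -
  \<comment> \<open>The maximum makes the length nonnegative everywhere; it agrees with s - r on the
    event that \<open>?g\<close> selects.\<close>
  let ?\<phi> = "\<lambda>r d::real. max 0 (s - r)"
  let ?g = "\<lambda>r d. if r \<le> s \<and> s < r + d then 1 else 0 :: ennreal"
  have inner: "(\<integral>\<^sup>+\<omega>. ennreal (W (Suc n) \<omega> ^ i) * (ennreal (max 0 (s - S (Suc n) \<omega>) ^ (k - i)) * ?g (S (Suc n) \<omega>) (D (Suc (Suc n)) \<omega>)) \<partial>M) =
     ennreal (exp (- l * s) * l ^ Suc n * s ^ (Suc n + k) * (fact i * fact (k - i) / fact (Suc n + k)) * coeff (Suc n) i)"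
    if "i \<le> k" for i
  proof -
    let ?h = "\<lambda>r. if r \<le> s then ennreal (max 0 (s - r) ^ (k - i) * exp (- l * (s - r))) else 0"
    have "(\<integral>\<^sup>+\<omega>. ennreal (W (Suc n) \<omega> ^ i) * (ennreal (max 0 (s - S (Suc n) \<omega>) ^ (k - i)) * ?g (S (Suc n) \<omega>) (D (Suc (Suc n)) \<omega>)) \<partial>M) =
       (\<integral>\<^sup>+\<omega>. ennreal (W (Suc n) \<omega> ^ i) * (\<integral>\<^sup>+d\<in>{0<..}. ennreal (l * exp (- l * d)) * (ennreal (max 0 (s - S (Suc n) \<omega>) ^ (k - i)) * ?g (S (Suc n) \<omega>) d) \<partial>lborel) \<partial>M)"
      by (rule nn_integral_step[of "\<lambda>r d. ennreal (max 0 (s - r) ^ (k - i)) * ?g r d"]) (simp add: case_prod_beta)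
    also have "\<dots> = (\<integral>\<^sup>+\<omega>. ennreal (W (Suc n) \<omega> ^ i) * ?h (S (Suc n) \<omega>) \<partial>M)"
    proof (intro nn_integral_cong arg_cong2[where f="(*)"] refl)
      fix \<omega>
      let ?r = "S (Suc n) \<omega>"
      show "(\<integral>\<^sup>+d\<in>{0<..}. ennreal (l * exp (- l * d)) * (ennreal (max 0 (s - ?r) ^ (k - i)) * ?g ?r d) \<partial>lborel) = ?h ?r"
      proof (cases "?r \<le> s")
        case True
        have "(\<integral>\<^sup>+d\<in>{0<..}. ennreal (l * exp (- l * d)) * (ennreal (max 0 (s - ?r) ^ (k - i)) * ?g ?r d) \<partial>lborel) =
          (\<integral>\<^sup>+d. ennreal (max 0 (s - ?r) ^ (k - i)) * (ennreal (l * exp (- l * d)) * indicator {s - ?r<..} d) \<partial>lborel)"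
          using True by (intro nn_integral_cong) (auto simp: indicator_def mult_ac)
        also have "\<dots> = ennreal (max 0 (s - ?r) ^ (k - i)) * ennreal (exp (- l * (s - ?r)))"
          by (subst nn_integral_cmult) (simp_all only: nn_integral_exponential_tail[OF rate_pos], measurable)
        finally show ?thesis using True by (simp add: ennreal_mult)
      qed simp
    qed
    also have "\<dots> = ennreal (l ^ Suc n * (fact i / fact (n + i)) * coeff (Suc n) i) *
      (\<integral>\<^sup>+r\<in>{0<..}. ennreal (r ^ (n + i) * exp (- l * r)) * ?h r \<partial>lborel)"
      by (rule nn_integral_moment) measurable
    also have "(\<integral>\<^sup>+r\<in>{0<..}. ennreal (r ^ (n + i) * exp (- l * r)) * ?h r \<partial>lborel) =
      (\<integral>\<^sup>+r. ennreal (exp (- l * s)) * (ennreal (r ^ (n + i) * (s - r) ^ (k - i)) * indicator {0<..<s} r) \<partial>lborel)"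
    \<comment> \<open>The closed condition r \<le> s and the open interval can disagree only at r =
      s.\<close>
    proof (rule nn_integral_cong_AE, use AE_lborel_singleton[of s] in eventually_elim)
      fix r assume "r \<noteq> s"
      moreover have "r ^ (n + i) * exp (- l * r) * ((s - r) ^ (k - i) * exp (- l * (s - r))) = exp (- l * s) * (r ^ (n + i) * (s - r) ^ (k - i))"
      proof -
        \<comment> \<open>The survival factor of the last gap completes the exponential to a
          constant, so that only powers of the lengths remain: the uniform law on the
          simplex.\<close>
        have "exp (- l * r) * exp (- l * (s - r)) = exp (- l * s)" by (simp add: exp_add[symmetric] algebra_simps)
        then show ?thesis by (metis mult.assoc mult.commute)
      qed
      ultimately show "ennreal (r ^ (n + i) * exp (- l * r)) * ?h r * indicator {0<..} r =
         ennreal (exp (- l * s)) * (ennreal (r ^ (n + i) * (s - r) ^ (k - i)) * indicator {0<..<s} r)"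
        by (auto simp: indicator_def ennreal_mult[symmetric] max_def)
    qed
    also have "\<dots> = ennreal (exp (- l * s)) * ennreal (fact (k - i) * fact (n + i) / fact ((k - i) + (n + i) + 1) * s ^ ((k - i) + (n + i) + 1))"
      by (subst nn_integral_cmult) (simp_all only: nn_integral_Beta_nat[OF s], measurable)
    also have "(k - i) + (n + i) + 1 = Suc n + k" using that by simp
    also have "ennreal (l ^ Suc n * (fact i / fact (n + i)) * coeff (Suc n) i) * (ennreal (exp (- l * s)) * ennreal (fact (k - i) * fact (n + i) / fact (Suc n + k) * s ^ (Suc n + k)))
       = ennreal (l ^ Suc n * (fact i / fact (n + i)) * coeff (Suc n) i * (exp (- l * s) * (fact (k - i) * fact (n + i) / fact (Suc n + k) * s ^ (Suc n + k))))"
      using rate_pos coeff_nonneg s by (simp add: ennreal_mult[symmetric] del: fact_Suc power_Suc)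
    also have "l ^ Suc n * (fact i / fact (n + i)) * coeff (Suc n) i * (exp (- l * s) * (fact (k - i) * fact (n + i) / fact (Suc n + k) * s ^ (Suc n + k)))
       = exp (- l * s) * l ^ Suc n * s ^ (Suc n + k) * (fact i * fact (k - i) / fact (Suc n + k)) * coeff (Suc n) i"
      by (simp del: fact_Suc power_Suc)
    finally show ?thesis .
  qed
  let ?c = "\<lambda>i. real (k choose i) * \<mu> (k - i) * (exp (- l * s) * l ^ Suc n * s ^ (Suc n + k) * (fact i * fact (k - i) / fact (Suc n + k)) * coeff (Suc n) i)"
  have "(\<integral>\<^sup>+\<omega>. ennreal ((W (Suc n) \<omega> + (s - S (Suc n) \<omega>) * V (Suc (Suc n)) \<omega>) ^ k) *
      indicator {\<omega>. S (Suc n) \<omega> \<le> s \<and> s < S (Suc (Suc n)) \<omega>} \<omega> \<partial>M) =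
    (\<integral>\<^sup>+\<omega>. ennreal ((W (Suc n) \<omega> + ?\<phi> (S (Suc n) \<omega>) (D (Suc (Suc n)) \<omega>) * V (Suc (Suc n)) \<omega>) ^ k) * ?g (S (Suc n) \<omega>) (D (Suc (Suc n)) \<omega>) \<partial>M)"
  proof (intro nn_integral_cong)
    fix \<omega>
    have "S (Suc (Suc n)) \<omega> = S (Suc n) \<omega> + D (Suc (Suc n)) \<omega>" by (simp add: S_def)
    then show "ennreal ((W (Suc n) \<omega> + (s - S (Suc n) \<omega>) * V (Suc (Suc n)) \<omega>) ^ k) *
      indicator {\<omega>. S (Suc n) \<omega> \<le> s \<and> s < S (Suc (Suc n)) \<omega>} \<omega> = ennreal ((W (Suc n) \<omega> + ?\<phi> (S (Suc n) \<omega>) (D (Suc (Suc n)) \<omega>) * V (Suc (Suc n)) \<omega>) ^ k) * ?g (S (Suc n) \<omega>) (D (Suc (Suc n)) \<omega>)"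
      by (auto simp: indicator_def)
  qed
  also have "\<dots> = (\<Sum>i\<le>k. ennreal (real (k choose i) * \<mu> (k - i)) * (\<integral>\<^sup>+\<omega>. ennreal (W (Suc n) \<omega> ^ i) *
      (ennreal (?\<phi> (S (Suc n) \<omega>) (D (Suc (Suc n)) \<omega>) ^ (k - i)) * ?g (S (Suc n) \<omega>) (D (Suc (Suc n)) \<omega>)) \<partial>M))"
    by (rule nn_integral_step_expand[of ?\<phi> ?g]) (auto simp: case_prod_beta)
  also have "\<dots> = (\<Sum>i\<le>k. ennreal (?c i))"
    using rate_pos moment_nonneg coeff_nonneg s
    by (intro sum.cong refl) (subst inner, auto simp: ennreal_mult[symmetric] simp del: fact_Suc power_Suc)
  also have "\<dots> = ennreal (\<Sum>i\<le>k. ?c i)"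
    using rate_pos moment_nonneg coeff_nonneg s by (intro sum_ennreal) (auto simp del: fact_Suc power_Suc)
  also have "(\<Sum>i\<le>k. ?c i) = exp (- l * s) * l ^ Suc n * s ^ (Suc n + k) * (fact k / fact (Suc n + k)) * coeff (Suc (Suc n)) k"
    unfolding coeff_Suc[of "Suc n"] sum_distrib_left
  proof (intro sum.cong refl)
    fix i assume "i \<in> {..k}"
    then have "real (k choose i) * (fact i * fact (k - i)) = fact k"
      by (simp add: binomial_fact)
    then show "?c i = exp (- l * s) * l ^ Suc n * s ^ (Suc n + k) * (fact k / fact (Suc n + k)) * (coeff (Suc n) i * \<mu> (k - i))"
      by (simp del: fact_Suc power_Suc add: field_simps)
  qed
  finally show ?thesis .
qed

end

section \<open>Ballot numbers and Beta moments\<close>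

lemma pochhammer_of_nat_Suc: "pochhammer (real (Suc m)) k = fact (m + k) / fact m"
proof (induction k)
  case (Suc k)
  show ?case by (simp only: pochhammer_Suc Suc) (simp add: field_simps)
qed simp

text \<open>This ratio is the k-th moment of the Beta(a, b) law, brought to the form in which the
  generating functions deliver it.\<close>

lemma Beta_ratio:
  fixes a b :: real
  assumes "0 < a" "0 < b"
  shows "Beta (a + real k) b / Beta a b = pochhammer a k / pochhammer (a + b) k"
proof -
  have "z \<notin> \<int>\<^sub>\<le>\<^sub>0" if "0 < z" for z :: real
    using that nonpos_Ints_nonpos[of z] by force
  then have p: "pochhammer z k = Gamma (z + real k) / Gamma z" if "0 < z" for z
    using that pochhammer_Gamma[of z k] by simp
  have "Gamma z \<noteq> 0" if "0 < z" for z :: real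
    using Gamma_real_pos[OF that] by (metis less_irrefl)
  then have "Gamma a \<noteq> 0" "Gamma b \<noteq> 0" "Gamma (a + b) \<noteq> 0" using assms by auto
  then show ?thesis
    unfolding Beta_def using assms by (simp add: p add_ac)
qed

text \<open>\<open>ballot r k\<close> is the coefficient of \<open>z ^ k\<close> in \<open>C(z) ^ r\<close>, where \<open>C = 1 + z C\<^sup>2\<close> is the Catalan
  generating function.\<close>

fun ballot :: "nat \<Rightarrow> nat \<Rightarrow> nat" where
  "ballot 0 k = (if k = 0 then 1 else 0)"
| "ballot (Suc r) 0 = 1"
| "ballot (Suc r) (Suc k) = ballot r (Suc k) + ballot (Suc (Suc r)) k"

lemma ballot_0_right: "ballot r 0 = 1"
  by (cases r) auto

text \<open>As series: C^r C^q = C^(r + q). The recursion of \<open>ballot\<close> is C^(r + 1) =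
  C^r + z C^(r + 2) read coefficientwise, and the induction applies it to the first factor with q
  fixed.\<close>

lemma ballot_convolution: "(\<Sum>i\<le>k. ballot r i * ballot q (k - i)) = ballot (r + q) k"
proof (induction r k rule: ballot.induct)
  case (1 k)
  have "(\<Sum>i\<le>k. ballot 0 i * ballot q (k - i)) = (\<Sum>i\<in>{0}. ballot 0 i * ballot q (k - i))"
    by (rule sum.mono_neutral_right) auto
  then show ?case by simp
next
  case (2 r)
  then show ?case by (simp add: ballot_0_right)
next
  case (3 r k)
  \<comment> \<open>The term i = 0 does not fall under the recursion; as
    \<open>ballot (Suc r) 0\<close> and \<open>ballot r 0\<close> are both 1, it is assigned to the
    sum for r.\<close>
  have "(\<Sum>i\<le>Suc k. ballot (Suc r) i * ballot q (Suc k - i))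
    = (ballot r 0 * ballot q (Suc k) + (\<Sum>i\<le>k. ballot r (Suc i) * ballot q (k - i))) + (\<Sum>i\<le>k. ballot (Suc (Suc r)) i * ballot q (k - i))"
    by (simp add: sum.atMost_Suc_shift ballot_0_right algebra_simps sum.distrib del: sum.atMost_Suc)
  also have "ballot r 0 * ballot q (Suc k) + (\<Sum>i\<le>k. ballot r (Suc i) * ballot q (k - i)) = (\<Sum>i\<le>Suc k. ballot r i * ballot q (Suc k - i))"
    by (simp add: sum.atMost_Suc_shift del: sum.atMost_Suc)
  finally show ?case using 3 by simp
qed

text \<open>The value r / (2 k + r) times the binomial coefficient of 2 k + r over k, with
  denominators cleared. At r = k = 0 the left side would be 1 and the right side 0, which explains
  the premise.\<close>

lemma ballot_closed_form:
  "0 < r \<or> 0 < k \<Longrightarrow> real (ballot r k) * fact k * fact (k + r) = real r * fact (2 * k + r - 1)"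
proof (induction r k rule: ballot.induct)
  case (2 r)
  then show ?case by (simp add: fact_reduce)
next
  case (3 r k)
  let ?F = "fact (2 * k + r + 1) :: real"
  have 1: "real (ballot r (Suc k)) * fact (Suc k) * fact (Suc k + r) = real r * ?F"
    using 3 by (simp del: fact_Suc add: numeral_2_eq_2)
  have 2: "real (ballot (Suc (Suc r)) k) * fact k * fact (Suc (Suc k + r)) = real (Suc (Suc r)) * ?F"
    using 3 by (simp del: fact_Suc)
  have "real (ballot (Suc r) (Suc k)) * fact (Suc k) * fact (Suc k + Suc r) =
     real (Suc (Suc k + r)) * (real (ballot r (Suc k)) * fact (Suc k) * fact (Suc k + r)) +
     real (Suc k) * (real (ballot (Suc (Suc r)) k) * fact k * fact (Suc (Suc k + r)))"
    by (simp add: algebra_simps)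
  \<comment> \<open>Rests on (k + r + 2) r + (k + 1) (r + 2) = (r + 1) (2 k + r + 2).\<close>
  also have "\<dots> = real (Suc r) * (real (2 * k + r + 2) * ?F)"
    unfolding 1 2 by (simp del: fact_Suc add: algebra_simps)
  also have "real (2 * k + r + 2) * ?F = fact (2 * Suc k + Suc r - 1)"
    by (simp add: algebra_simps)
  finally show ?case .
qed simp

text \<open>The closed form contains the rising factorial of 2 n + 2 of length 2 k. Duplication
  splits it into two of length k with bases half a unit apart and releases the factor 4^k; this is
  where the argument z/4 comes from.\<close>

lemma ballot_pochhammer:
  "real (ballot (2 * Suc n) k) / 4 ^ k =
    pochhammer (real (Suc n)) k * pochhammer (real (Suc n) + 1 / 2) k / (fact k * pochhammer (real (2 * n + 3)) k)"
proof -
  have d: "fact (2 * n + 1 + 2 * k) / fact (2 * n + 1) = 4 ^ k * pochhammer (real (Suc n)) k * pochhammer (real (Suc n) + 1 / 2) k"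
    using pochhammer_double[of "real (Suc n)" k] pochhammer_of_nat_Suc[of "2 * n + 1" "2 * k"]
    by (simp add: power_mult del: fact_Suc)
  have e: "pochhammer (real (2 * n + 3)) k = fact (2 * n + 2 + k) / fact (2 * n + 2)"
    using pochhammer_of_nat_Suc[of "2 * n + 2" k] by (simp add: numeral_3_eq_3 del: fact_Suc)
  have "real (ballot (2 * Suc n) k) * fact k * fact (2 * n + 2 + k) = real (2 * n + 2) * fact (2 * n + 1 + 2 * k)"
  proof -
    have "k + 2 * Suc n = 2 * n + 2 + k" "2 * k + 2 * Suc n - 1 = 2 * n + 1 + 2 * k" "real (2 * Suc n) = real (2 * n + 2)" by simp_all
    then show ?thesis using ballot_closed_form[of "2 * Suc n" k] by (simp only:) simp
  qed
  moreover have "(fact (2 * n + 2) :: real) = real (2 * n + 2) * fact (2 * n + 1)"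
  proof -
    have "2 * n + 2 = Suc (2 * n + 1)" by simp
    then show ?thesis by (simp only: fact_Suc)
  qed
  ultimately have "real (ballot (2 * Suc n) k) * fact k * (fact (2 * n + 2 + k) / fact (2 * n + 2)) = fact (2 * n + 1 + 2 * k) / fact (2 * n + 1)"
    by (simp del: fact_Suc)
  then have "real (ballot (2 * Suc n) k) * fact k * pochhammer (real (2 * n + 3)) k = 4 ^ k * (pochhammer (real (Suc n)) k * pochhammer (real (Suc n) + 1 / 2) k)"
    unfolding d e by simp
  moreover have "0 < pochhammer (real (2 * n + 3)) k" by (intro pochhammer_pos) simp
  ultimately show ?thesis by (simp add: field_simps)
qed

text \<open>The moments of the Beta(m + 1/2, m + 1/2) law, which is the law of (1 - cos theta) /
  2.\<close>

definition cosine_moment :: "nat \<Rightarrow> nat \<Rightarrow> real" where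
  "cosine_moment m k = pochhammer (real m + 1 / 2) k / pochhammer (2 * real m + 1) k"

text \<open>Vandermonde's convolution for rising factorials, in series terms (1 - z)^(- n/2) (1 -
  z)^(- 1/2) = (1 - z)^(- (n + 1)/2).\<close>

lemma cosine_moment_0_power:
  "fps_nth (Abs_fps (cosine_moment 0) ^ n) k = pochhammer (real n / 2) k / fact k"
proof (induction n arbitrary: k)
  case (Suc n)
  have "fps_nth (Abs_fps (cosine_moment 0) ^ Suc n) k = (\<Sum>i\<le>k. pochhammer (real n / 2) i / fact i * (pochhammer (1 / 2) (k - i) / fact (k - i)))"
    unfolding power_Suc2 fps_mult_nth
    by (simp add: atLeast0AtMost Suc cosine_moment_def pochhammer_fact)
  also have "\<dots> = (\<Sum>i\<le>k. real (k choose i) * pochhammer (real n / 2) i * pochhammer (1 / 2) (k - i)) / fact k"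
    unfolding sum_divide_distrib by (intro sum.cong refl) (simp add: binomial_fact)
  also have "\<dots> = pochhammer (real (Suc n) / 2) k / fact k"
    by (simp add: pochhammer_binomial_sum[symmetric] add_divide_distrib add_ac)
  finally show ?case .
qed (auto simp: pochhammer_0_left)

lemma cosine_moment_1_power:
  "fps_nth (Abs_fps (cosine_moment 1) ^ n) k = real (ballot (2 * n) k) / 4 ^ k"
proof (induction n arbitrary: k)
  case (Suc n)
  \<comment> \<open>In the case n = 0 of \<open>ballot_pochhammer\<close> the rising factorial of 1
    cancels against j!.\<close>
  have "cosine_moment 1 j = real (ballot 2 j) / 4 ^ j" for j
    using ballot_pochhammer[of 0 j]
    by (simp add: cosine_moment_def numeral_2_eq_2[symmetric] pochhammer_fact[symmetric])
  then have "fps_nth (Abs_fps (cosine_moment 1) ^ Suc n) k = (\<Sum>i\<le>k. real (ballot (2 * n) i) / 4 ^ i * (real (ballot 2 (k - i)) / 4 ^ (k - i)))"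
    unfolding power_Suc2 fps_mult_nth by (simp add: atLeast0AtMost Suc del: One_nat_def)
  also have "\<dots> = (\<Sum>i\<le>k. real (ballot (2 * n) i * ballot 2 (k - i))) / 4 ^ k"
    unfolding sum_divide_distrib by (intro sum.cong refl) (simp add: power_add[symmetric])
  also have "\<dots> = real (ballot (2 * n + 2) k) / 4 ^ k"
    by (simp only: ballot_convolution[symmetric] of_nat_sum)
  finally show ?case by simp
qed auto

text \<open>The prefactor is k! divided by the rising factorial of n + 1. For m = 0 it supplies the
  denominator of the Beta moment, as 2 v + 1 = n + 1; for m = 1 it removes the surplus factor left
  by \<open>ballot_pochhammer\<close>.\<close>

lemma cosine_moment_power:
  assumes "m \<in> {0, 1}" and v: "v = (if m = 0 then real n / 2 else real n + 1)"
  shows "fact n * fact k / fact (n + k) * fps_nth (Abs_fps (cosine_moment m) ^ Suc n) k =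
    Beta (v + 1 / 2 + real k) (v + 1 / 2) / Beta (v + 1 / 2) (v + 1 / 2)"
proof -
  have "0 \<le> v" using v by auto
  then have B: "Beta (v + 1 / 2 + real k) (v + 1 / 2) / Beta (v + 1 / 2) (v + 1 / 2) = pochhammer (v + 1 / 2) k / pochhammer (2 * v + 1) k"
    by (subst Beta_ratio) auto
  consider "m = 0" | "m = 1" using assms by auto
  then show ?thesis
  proof cases
    case 1
    then show ?thesis
      using pochhammer_of_nat_Suc[of n k] unfolding B by (simp add: cosine_moment_0_power v add_divide_distrib add_ac del: power_Suc)
  next
    case 2
    then have v: "v + 1 / 2 = real (Suc n) + 1 / 2" "2 * v + 1 = real (2 * n + 3)" using v by auto
    have "fps_nth (Abs_fps (cosine_moment m) ^ Suc n) k = pochhammer (real (Suc n)) k * pochhammer (real (Suc n) + 1 / 2) k / (fact k * pochhammer (real (2 * n + 3)) k)"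
      unfolding 2 cosine_moment_1_power ballot_pochhammer ..
    then show ?thesis
      unfolding B unfolding v by (simp add: pochhammer_of_nat_Suc del: power_Suc of_nat_Suc)
  qed
qed

section \<open>Determinacy by moments, and the moments of one mark\<close>

text \<open>Equal moments give both characteristic functions the same Taylor polynomials at 0. On
  the unit interval absolute moments are at most 1, so each remainder is at most 2 |t|^n / n! and
  vanishes in the limit for every t.\<close>

lemma real_distribution_eq_moments:
  assumes "real_distribution M1" "real_distribution M2"
    and b1: "AE x in M1. 0 \<le> x \<and> x \<le> 1" and b2: "AE x in M2. 0 \<le> x \<and> x \<le> 1"
    and eq: "\<And>k. (\<integral>\<^sup>+x. ennreal (x ^ k) \<partial>M1) = (\<integral>\<^sup>+x. ennreal (x ^ k) \<partial>M2)"
  shows "M1 = M2"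
proof (rule Levy_uniqueness[OF assms(1,2)], rule ext)
  fix t :: real
  have approx: "cmod (char M t - (\<Sum>k\<le>n. ((\<i> * t) ^ k / fact k) * enn2real (\<integral>\<^sup>+x. ennreal (x ^ k) \<partial>M))) \<le> 2 * \<bar>t\<bar> ^ n / fact n"
    if "real_distribution M" and b: "AE x in M. 0 \<le> x \<and> x \<le> 1" for M :: "real measure" and n :: nat
  proof -
    interpret real_distribution M by fact
    have int: "integrable M (\<lambda>x. x ^ k)" for k
      by (rule integrable_const_bound[of _ 1], use b in eventually_elim) (auto simp: power_le_one)
    have m: "expectation (\<lambda>x. x ^ k) = enn2real (\<integral>\<^sup>+x. ennreal (x ^ k) \<partial>M)" for k
      by (rule integral_eq_nn_integral) (use b in auto)
    have "expectation (\<lambda>x. \<bar>x\<bar> ^ n) \<le> expectation (\<lambda>x. 1)"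
    proof (rule integral_mono_AE)
      show "integrable M (\<lambda>x. \<bar>x\<bar> ^ n)" using integrable_abs[OF int[of n]] by (simp add: power_abs)
      show "AE x in M. \<bar>x\<bar> ^ n \<le> 1" using b by eventually_elim (auto simp: power_le_one)
    qed simp
    then have "expectation (\<lambda>x. \<bar>x\<bar> ^ n) \<le> 1" using prob_space by simp
    then have "(2 * \<bar>t\<bar> ^ n / fact n) * expectation (\<lambda>x. \<bar>x\<bar> ^ n) \<le> 2 * \<bar>t\<bar> ^ n / fact n * 1"
      by (intro mult_left_mono) auto
    then show ?thesis using char_approx1[OF int, where n=n and t=t] unfolding m by simp
  qed
  have lim: "(\<lambda>n. 4 * (\<bar>t\<bar> ^ n / fact n)) \<longlonglongrightarrow> 4 * 0"
    using summable_LIMSEQ_zero[OF summable_exp_generic[of "\<bar>t\<bar>"]]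
    by (intro tendsto_mult tendsto_const) (simp add: field_simps)
  have "cmod (char M1 t - char M2 t) \<le> 4 * (\<bar>t\<bar> ^ n / fact n)" for n
  proof -
    let ?p = "\<Sum>k\<le>n. ((\<i> * t) ^ k / fact k) * enn2real (\<integral>\<^sup>+x. ennreal (x ^ k) \<partial>M2)"
    have "cmod (char M1 t - char M2 t) \<le> cmod (char M1 t - ?p) + cmod (char M2 t - ?p)"
      using norm_triangle_ineq4[of "char M1 t - ?p" "char M2 t - ?p"] by simp
    also have "\<dots> \<le> 2 * \<bar>t\<bar> ^ n / fact n + 2 * \<bar>t\<bar> ^ n / fact n"
      by (rule add_mono[OF approx[OF assms(1) b1, where n=n, unfolded eq] approx[OF assms(2) b2, where n=n]])
    finally show ?thesis by simp
  qed
  then have "cmod (char M1 t - char M2 t) \<le> 4 * 0"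
    by (intro LIMSEQ_le_const[OF lim]) auto
  then show "char M1 t = char M2 t" by simp
qed

text \<open>With y = (1 - cos x) / 2 one has y (1 - y) = (sin x / 2)^2, so the angle density becomes
  a multiple of the Beta(m + 1/2, m + 1/2) density. The multiple is fixed by total mass 1, for which
  the premise is there.\<close>

lemma nn_integral_angle_moment:
  assumes "prob_space (density lborel (\<lambda>x. ennreal (angle_density m x)))"
  shows "(\<integral>\<^sup>+x. ennreal (angle_density m x) * ennreal (((1 - cos x) / 2) ^ k) \<partial>lborel) = ennreal (cosine_moment m k)"
proof -
  let ?K = "Gamma (real m + 1) / (sqrt pi * Gamma (real m + 1 / 2))"
  let ?a = "real m + 1 / 2"
  have K: "0 \<le> ?K" by (intro divide_nonneg_nonneg mult_nonneg_nonneg Gamma_real_nonneg) auto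
  have *: "(\<integral>\<^sup>+x. ennreal (angle_density m x) * ennreal (((1 - cos x) / 2) ^ k) \<partial>lborel) = ennreal (?K * 4 ^ m * Beta (?a + real k) ?a)" for k
  proof -
    let ?f = "\<lambda>x. ?K * 4 ^ m * (x powr ((?a + real k) - 1) * (1 - x) powr (?a - 1))"
    have "ennreal (?K * 4 ^ m * Beta (?a + real k) ?a) = ennreal (?K * 4 ^ m) * (\<integral>\<^sup>+x\<in>{0<..<1}. ennreal (x powr ((?a + real k) - 1) * (1 - x) powr (?a - 1)) \<partial>lborel)"
      using K by (subst nn_integral_Beta) (auto simp: ennreal_mult' simp del: times_divide_eq_left)
    also have "\<dots> = (\<integral>\<^sup>+x\<in>{0<..<1}. ennreal (?f x) \<partial>lborel)"
      using K by (subst nn_integral_cmult[symmetric]) (auto intro!: nn_integral_cong simp: indicator_def ennreal_mult' simp del: times_divide_eq_left)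
    also have "\<dots> = (\<integral>\<^sup>+x\<in>{0<..<pi}. ennreal (\<bar>sin x / 2\<bar> * ?f ((1 - cos x) / 2)) \<partial>lborel)"
    proof (rule nn_integral_change_of_variables)
      show "((\<lambda>x. (1 - cos x) / 2) has_real_derivative sin x / 2) (at x within {0<..<pi})" for x
        by (auto intro!: derivative_eq_intros)
      show "bij_betw (\<lambda>x. (1 - cos x) / 2) {0<..<pi} {0<..<1}"
      proof (rule bij_betwI[where g="\<lambda>x. arccos (1 - 2 * x)"])
        show "(\<lambda>x. (1 - cos x) / 2) \<in> {0<..<pi} \<rightarrow> {0<..<1}"
        proof
          fix x assume "x \<in> {0<..<pi}"
          then show "(1 - cos x) / 2 \<in> {0<..<1}"
            using cos_monotone_0_pi[of 0 x] cos_monotone_0_pi[of x pi] by auto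
        qed
        show "(\<lambda>x. arccos (1 - 2 * x)) \<in> {0<..<1} \<rightarrow> {0<..<pi}"
          using arccos_lt_bounded by (auto simp: field_simps)
      qed (auto simp: arccos_cos diff_divide_distrib)
    qed (use K in auto)
    also have "\<dots> = (\<integral>\<^sup>+x. ennreal (angle_density m x) * ennreal (((1 - cos x) / 2) ^ k) \<partial>lborel)"
    proof (intro nn_integral_cong)
      fix x :: real
      show "ennreal (\<bar>sin x / 2\<bar> * ?f ((1 - cos x) / 2)) * indicator {0<..<pi} x = ennreal (angle_density m x) * ennreal (((1 - cos x) / 2) ^ k)"
      proof (cases "0 < x \<and> x < pi")
        case True
        let ?y = "(1 - cos x) / 2"
        have s: "0 < sin x" using True by (simp add: sin_gt_zero)
        have sq: "?y * (1 - ?y) = (sin x / 2) ^ 2"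
        proof -
          have "?y * (1 - ?y) = (1 - (cos x)\<^sup>2) / 4" by (simp add: power2_eq_square field_simps)
          then show ?thesis by (simp add: power_divide sin_squared_eq)
        qed
        have "\<bar>cos x\<bar> < 1" using s sin_cos_squared_add[of x] by (metis abs_square_less_1 less_add_same_cancel2 zero_less_power)
        then have y: "0 < ?y" "0 < 1 - ?y" by auto
        have "?y powr ((?a + real k) - 1) * (1 - ?y) powr (?a - 1) = ?y ^ k * ((?y * (1 - ?y)) powr (?a - 1))"
        proof -
          have "?y powr ((?a + real k) - 1) = ?y powr (?a - 1) * ?y ^ k"
            using y by (simp add: powr_realpow[symmetric] powr_add[symmetric] algebra_simps)
          then show ?thesis by (simp only: powr_mult mult_ac)
        qed
        \<comment> \<open>The square doubles the exponent m - 1/2 to 2 m - 1; the Jacobian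
          \<open>sin x / 2\<close> supplies the missing power, also for m = 0, where the exponent is
          negative.\<close>
        also have "(?y * (1 - ?y)) powr (?a - 1) = (sin x / 2) powr (real (2 * m) - 1)"
        proof -
          have "(?y * (1 - ?y)) powr (?a - 1) = ((sin x / 2) powr 2) powr (?a - 1)"
            unfolding sq using s by simp
          also have "\<dots> = (sin x / 2) powr (real (2 * m) - 1)"
            unfolding powr_powr by (simp add: algebra_simps)
          finally show ?thesis .
        qed
        also have "\<dots> = (sin x / 2) ^ (2 * m) / (sin x / 2)"
          using s by (simp add: powr_diff powr_realpow[symmetric])
        finally have "\<bar>sin x / 2\<bar> * ?f ?y = ?K * 4 ^ m * (?y ^ k * (sin x / 2) ^ (2 * m))"
          using s by simp
        also have "\<dots> = ?K * sin x ^ (2 * m) * ?y ^ k"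
        proof -
          have e: "sin x ^ (2 * m) = 4 ^ m * (sin x / 2) ^ (2 * m)" by (simp add: power_divide power_mult)
          show ?thesis unfolding e by (simp only: mult_ac)
        qed
        finally have "\<bar>sin x / 2\<bar> * ?f ?y = ?K * sin x ^ (2 * m) * ?y ^ k" .
        then show ?thesis
          using True K y by (simp add: angle_density_def ennreal_mult'[symmetric] ennreal_mult''[symmetric])
      qed (auto simp: angle_density_def)
    qed
    finally show ?thesis by simp
  qed
  \<comment> \<open>The case k = 0 of the formula just proved, compared with the total mass.\<close>
  have "ennreal (?K * 4 ^ m * Beta ?a ?a) = 1"
  proof -
    have [measurable]: "angle_density m \<in> borel_measurable borel" unfolding angle_density_def[abs_def] by measurable
    have "ennreal (?K * 4 ^ m * Beta ?a ?a) = (\<integral>\<^sup>+x. ennreal (angle_density m x) * ennreal (((1 - cos x) / 2) ^ 0) \<partial>lborel)"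
      using *[of 0] by (simp only: of_nat_0 add_0_right)
    also have "\<dots> = 1" using prob_space.emeasure_space_1[OF assms] by (simp add: emeasure_density)
    finally show ?thesis .
  qed
  then have n: "?K * 4 ^ m * Beta ?a ?a = 1" by (simp only: ennreal_eq_1)
  then have "?K * 4 ^ m * Beta (?a + real k) ?a = Beta (?a + real k) ?a / Beta ?a ?a"
  proof -
    have "p * x = x / b" if "p * b = 1" for p b x :: real
    proof -
      have "b \<noteq> 0" using that by auto
      then have "p = 1 / b" using that by (simp add: eq_divide_eq)
      then show ?thesis by simp
    qed
    then show ?thesis using n by blast
  qed
  also have "\<dots> = cosine_moment m k"
    unfolding cosine_moment_def by (subst Beta_ratio) (auto simp: algebra_simps)
  finally show ?thesis using *[of k] by simp
qed

section \<open>The conditional law of the motion\<close>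

text \<open>By monotonicity the counted indices form an initial segment of the positive integers, so
  their number is their maximum.\<close>

lemma strict_mono_count:
  fixes f :: "nat \<Rightarrow> real"
  assumes "\<And>j. 1 \<le> j \<Longrightarrow> f (j - 1) < f j"
  shows "card {j. 1 \<le> j \<and> f j \<le> s} = Suc n \<longleftrightarrow> f (Suc n) \<le> s \<and> s < f (Suc (Suc n))"
proof -
  have "strict_mono f"
    unfolding strict_mono_Suc_iff using assms by (metis diff_Suc_1 le_add1 plus_1_eq_Suc)
  then have le: "i \<le> j \<Longrightarrow> f i \<le> f j" for i j
    by (simp add: strict_mono_less_eq)
  show ?thesis
  proof
    let ?A = "{j. 1 \<le> j \<and> f j \<le> s}"
    assume card: "card ?A = Suc n"
    \<comment> \<open>An infinite set has \<open>card\<close> 0, so a positive count already forces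
      finiteness.\<close>
    then have "0 < card ?A" by (simp only: zero_less_Suc)
    then have fin: "finite ?A" "?A \<noteq> {}" unfolding card_gt_0_iff by auto
    have "?A = {1..Max ?A}"
    proof (intro set_eqI iffI)
      fix j assume "j \<in> {1..Max ?A}"
      moreover have "Max ?A \<in> ?A" using fin by (rule Max_in)
      ultimately show "j \<in> ?A" using le[of j "Max ?A"] by auto
    qed (use fin in auto)
    then have "card ?A = Max ?A" by (metis card_atLeastAtMost diff_Suc_1)
    then have A: "?A = {1..Suc n}" using card \<open>?A = {1..Max ?A}\<close> by simp
    then have "Suc n \<in> ?A" "Suc (Suc n) \<notin> ?A" by auto
    then show "f (Suc n) \<le> s \<and> s < f (Suc (Suc n))" by auto
  next
    assume *: "f (Suc n) \<le> s \<and> s < f (Suc (Suc n))"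
    have "{j. 1 \<le> j \<and> f j \<le> s} = {1..Suc n}"
    proof (intro set_eqI iffI)
      fix j assume "j \<in> {j. 1 \<le> j \<and> f j \<le> s}"
      then show "j \<in> {1..Suc n}" using * le[of "Suc (Suc n)" j] by (cases "Suc (Suc n) \<le> j") auto
    next
      fix j assume "j \<in> {1..Suc n}"
      then show "j \<in> {j. 1 \<le> j \<and> f j \<le> s}" using * le[of j "Suc n"] by auto
    qed
    then show "card {j. 1 \<le> j \<and> f j \<le> s} = Suc n" by simp
  qed
qed

definition symmetric_beta_density :: "real \<Rightarrow> real \<Rightarrow> real" where
  "symmetric_beta_density a x = (if 0 < x \<and> x < 1 then (x * (1 - x)) powr (a - 1) / Beta a a else 0)"

lemma symmetric_beta_density_measurable[measurable]: "symmetric_beta_density a \<in> borel_measurable borel"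
  unfolding symmetric_beta_density_def[abs_def] by measurable

lemma Beta_real_pos: "0 < a \<Longrightarrow> 0 < b \<Longrightarrow> 0 < Beta a (b :: real)"
  unfolding Beta_def by (auto intro!: divide_pos_pos mult_pos_pos Gamma_real_pos)

lemma symmetric_beta_density_nonneg: "0 < a \<Longrightarrow> 0 \<le> symmetric_beta_density a x"
  using Beta_real_pos[of a a] by (auto simp: symmetric_beta_density_def)

lemma nn_integral_symmetric_beta_moment:
  assumes "0 < a"
  shows "(\<integral>\<^sup>+x. ennreal (symmetric_beta_density a x) * ennreal (x ^ k) \<partial>lborel) = ennreal (Beta (a + real k) a / Beta a a)"
proof -
  have "(\<integral>\<^sup>+x. ennreal (symmetric_beta_density a x) * ennreal (x ^ k) \<partial>lborel) =
    (\<integral>\<^sup>+x. ennreal (1 / Beta a a) * (ennreal (x powr (a + real k - 1) * (1 - x) powr (a - 1)) * indicator {0<..<1} x) \<partial>lborel)"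
  proof (intro nn_integral_cong)
    fix x :: real
    have "x powr (a + real k - 1) = x powr (a - 1) * x ^ k" if "0 < x"
      using that by (simp add: powr_realpow[symmetric] powr_add[symmetric] algebra_simps)
    then show "ennreal (symmetric_beta_density a x) * ennreal (x ^ k) =
       ennreal (1 / Beta a a) * (ennreal (x powr (a + real k - 1) * (1 - x) powr (a - 1)) * indicator {0<..<1} x)"
      using Beta_real_pos[OF assms assms]
      by (auto simp: symmetric_beta_density_def indicator_def ennreal_mult[symmetric] powr_mult mult_ac)
  qed
  also have "\<dots> = ennreal (1 / Beta a a) * ennreal (Beta (a + real k) a)"
    using assms by (subst nn_integral_cmult) (auto simp: nn_integral_Beta)
  finally show ?thesis
    using Beta_real_pos[OF assms assms] Beta_real_pos[of "a + real k" a] assms by (simp add: ennreal_mult[symmetric])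
qed

lemma prob_space_symmetric_beta:
  assumes "0 < a"
  shows "prob_space (density lborel (\<lambda>x. ennreal (symmetric_beta_density a x)))"
proof
  show "emeasure (density lborel (\<lambda>x. ennreal (symmetric_beta_density a x))) (space (density lborel (\<lambda>x. ennreal (symmetric_beta_density a x)))) = 1"
    using nn_integral_symmetric_beta_moment[OF assms, of 0] Beta_real_pos[OF assms assms] by (simp add: emeasure_density)
qed

text \<open>The angles are replaced by nonnegative marks in [0, 1]; cos theta is recovered as 1
  minus twice the mark.\<close>

lemma poisson_motion_random_steps:
  assumes "prob_space M" "0 < l" "poisson_motion M l m S \<theta>"
  shows "random_steps M (\<lambda>j \<omega>. S j \<omega> - S (j - 1) \<omega>) (\<lambda>j \<omega>. (1 - cos (\<theta> j \<omega>)) / 2) l (cosine_moment m)"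
proof -
  interpret prob_space M by fact
  let ?D = "\<lambda>j \<omega>. S j \<omega> - S (j - 1) \<omega>"
  have th: "distributed M lborel (\<theta> j) (angle_density m)" if "1 \<le> j" for j
    using assms(3) that unfolding poisson_motion_def by auto
  have ind: "indep_vars (\<lambda>_. borel) (case_sum ?D \<theta>) ({1..} <+> {1..})"
    using assms(3) unfolding poisson_motion_def by auto
  \<comment> \<open>Coordinatewise maps preserve independence: the gaps are kept and each angle is
    sent to its mark.\<close>
  let ?Y = "case_sum (\<lambda>_ x. x) (\<lambda>_ x::real. (1 - cos x) / 2) :: nat + nat \<Rightarrow> real \<Rightarrow> real"
  have "indep_vars (\<lambda>_. borel) (\<lambda>i x. ?Y i (case_sum ?D \<theta> i x)) ({1..} <+> {1..})"
    by (rule indep_vars_compose2[OF ind]) (auto split: sum.split)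
  moreover have "(\<lambda>i x. ?Y i (case_sum ?D \<theta> i x)) = case_sum ?D (\<lambda>j \<omega>. (1 - cos (\<theta> j \<omega>)) / 2)"
    by (auto simp: fun_eq_iff split: sum.split)
  ultimately have ind': "indep_vars (\<lambda>_. borel) (case_sum ?D (\<lambda>j \<omega>. (1 - cos (\<theta> j \<omega>)) / 2)) ({1..} <+> {1..})"
    by simp
  show ?thesis
  proof
    fix j k :: nat assume j: "1 \<le> j"
    show "distributed M lborel (?D j) (exponential_density l)"
      using assms(3) j unfolding poisson_motion_def by auto
    have "prob_space (distr M lborel (\<theta> j))"
      using th[OF j] by (intro prob_space_distr) (auto simp: distributed_def)
    then have "prob_space (density lborel (\<lambda>x. ennreal (angle_density m x)))"
      using distributed_distr_eq_density[OF th[OF j]] by simp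
    note nn_integral_angle_moment[OF this, of k]
    moreover have "(\<integral>\<^sup>+x. ennreal (angle_density m x) * ennreal (((1 - cos x) / 2) ^ k) \<partial>lborel) = (\<integral>\<^sup>+\<omega>. ennreal (((1 - cos (\<theta> j \<omega>)) / 2) ^ k) \<partial>M)"
      by (rule distributed_nn_integral[OF th[OF j]]) measurable
    ultimately show "(\<integral>\<^sup>+\<omega>. ennreal (((1 - cos (\<theta> j \<omega>)) / 2) ^ k) \<partial>M) = ennreal (cosine_moment m k)" by simp
  qed (use assms(2) ind' in \<open>auto simp: cosine_moment_def intro!: divide_nonneg_nonneg pochhammer_nonneg\<close>)
qed

section \<open>The law of the motion at a fixed time, given the number of turns\<close>

locale turning_motion =
  fixes M :: "'a measure" and S \<theta> :: "nat \<Rightarrow> 'a \<Rightarrow> real" and c l :: real and m :: nat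
  assumes prob_M: "prob_space M" and c: "0 < c" and l: "0 < l" and m: "m \<in> {0, 1}" and motion: "poisson_motion M l m S \<theta>"
begin

definition gap :: "nat \<Rightarrow> 'a \<Rightarrow> real" where "gap j \<omega> = S j \<omega> - S (j - 1) \<omega>"
definition mark :: "nat \<Rightarrow> 'a \<Rightarrow> real" where "mark j \<omega> = (1 - cos (\<theta> j \<omega>)) / 2"

sublocale steps: random_steps M gap mark l "cosine_moment m"
  unfolding gap_def[abs_def] mark_def[abs_def] by (rule poisson_motion_random_steps[OF prob_M l motion])

lemma steps_S: "\<omega> \<in> space M \<Longrightarrow> steps.S n \<omega> = S n \<omega>"
  using sum_telescope''[of 0 n "\<lambda>j. S j \<omega>"] motion by (simp add: steps.S_def gap_def poisson_motion_def)

lemma measurable_event_time[measurable]: "S n \<in> borel_measurable M"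
  using steps.measurable_S[of n] by (rule measurable_cong[THEN iffD1, rotated]) (rule steps_S)

lemma measurable_turn_angle: "1 \<le> j \<Longrightarrow> \<theta> j \<in> borel_measurable M"
  using motion unfolding poisson_motion_def by (auto simp: distributed_def)

lemma measurable_event_count[measurable]: "event_count S s \<in> M \<rightarrow>\<^sub>M count_space UNIV"
  unfolding event_count_def[abs_def] by measurable

lemma measurable_random_motion[measurable]: "random_motion c S \<theta> s \<in> borel_measurable M"
proof -
  let ?f = "\<lambda>k \<omega>. c * (\<Sum>j = 1..k + 1. ((if j = k + 1 then s else S j \<omega>) - S (j - 1) \<omega>) * cos (\<theta> j \<omega>))"
  have "?f k \<in> borel_measurable M" for k
  proof (intro borel_measurable_times borel_measurable_const borel_measurable_sum)
    fix j assume "j \<in> {1..k + 1}"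
    then have [measurable]: "\<theta> j \<in> borel_measurable M" by (intro measurable_turn_angle) simp
    show "(\<lambda>\<omega>. (if j = k + 1 then s else S j \<omega>) - S (j - 1) \<omega>) \<in> borel_measurable M"
      "(\<lambda>\<omega>. cos (\<theta> j \<omega>)) \<in> borel_measurable M" by measurable
  qed
  \<comment> \<open>The number of summands is itself random; it takes countably many values, and the
    sum is measurable for each of them.\<close>
  then have "(\<lambda>\<omega>. ?f (event_count S s \<omega>) \<omega>) \<in> borel_measurable M"
    by (rule measurable_compose_countable[where f="?f" and g="event_count S s"]) (rule measurable_event_count)
  then show ?thesis unfolding random_motion_def[abs_def] Let_def .
qed

lemma event_count_iff:
  "AE \<omega> in M. event_count S s \<omega> = Suc n \<longleftrightarrow> steps.S (Suc n) \<omega> \<le> s \<and> s < steps.S (Suc (Suc n)) \<omega>"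
  using steps.AE_D_pos AE_space
proof eventually_elim
  case (elim \<omega>)
  then show ?case
    using strict_mono_count[of "\<lambda>j. S j \<omega>" s n] by (simp add: event_count_def steps_S gap_def)
qed

text \<open>Event times are almost surely positive. The kernel in \<open>fixed_count_law\<close> is
  formed for every real s, so times s \<le> 0 need an answer too.\<close>

lemma event_count_nonpos:
  assumes "s \<le> 0"
  shows "AE \<omega> in M. event_count S s \<omega> \<noteq> Suc n"
  using event_count_iff[of s n] steps.AE_D_pos AE_space
proof eventually_elim
  case (elim \<omega>)
  have "0 < steps.S (Suc n) \<omega>"
    unfolding steps.S_def using elim by (intro sum_pos) auto
  then show ?case using elim(1) assms by auto
qed

text \<open>Division by s turns the lengths into convex weights and removes s^k. The integral is
  restricted to the event but not yet normalised, so the Poisson weight is still present.\<close>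

lemma nn_integral_event_count_moment:
  assumes "0 < s"
  shows "(\<integral>\<^sup>+\<omega>. ennreal (((steps.W (Suc n) \<omega> + (s - steps.S (Suc n) \<omega>) * mark (Suc (Suc n)) \<omega>) / s) ^ k) *
      indicator {\<omega>\<in>space M. event_count S s \<omega> = Suc n} \<omega> \<partial>M) =
    ennreal (exp (- l * s) * (l * s) ^ Suc n * (fact k / fact (Suc n + k)) * steps.coeff (Suc (Suc n)) k)"
proof -
  let ?Z = "\<lambda>\<omega>. steps.W (Suc n) \<omega> + (s - steps.S (Suc n) \<omega>) * mark (Suc (Suc n)) \<omega>"
  let ?I = "\<lambda>\<omega>. indicator {\<omega>. steps.S (Suc n) \<omega> \<le> s \<and> s < steps.S (Suc (Suc n)) \<omega>} \<omega> :: ennreal"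
  have [measurable]: "\<theta> (Suc j) \<in> borel_measurable M" for j by (rule measurable_turn_angle) simp
  have "(\<integral>\<^sup>+\<omega>. ennreal ((?Z \<omega> / s) ^ k) * indicator {\<omega>\<in>space M. event_count S s \<omega> = Suc n} \<omega> \<partial>M) =
    (\<integral>\<^sup>+\<omega>. ennreal (1 / s ^ k) * (ennreal (?Z \<omega> ^ k) * ?I \<omega>) \<partial>M)"
  proof (rule nn_integral_cong_AE, use event_count_iff[of s n] AE_space in eventually_elim)
    fix \<omega> assume *: "event_count S s \<omega> = Suc n \<longleftrightarrow> steps.S (Suc n) \<omega> \<le> s \<and> s < steps.S (Suc (Suc n)) \<omega>" "\<omega> \<in> space M"
    have "ennreal ((?Z \<omega> / s) ^ k) = ennreal (1 / s ^ k) * ennreal (?Z \<omega> ^ k)"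
      using assms by (simp add: power_divide ennreal_mult'[symmetric])
    then show "ennreal ((?Z \<omega> / s) ^ k) * indicator {\<omega>\<in>space M. event_count S s \<omega> = Suc n} \<omega> = ennreal (1 / s ^ k) * (ennreal (?Z \<omega> ^ k) * ?I \<omega>)"
      using * by (auto simp: indicator_def)
  qed
  also have "\<dots> = ennreal (1 / s ^ k) * (\<integral>\<^sup>+\<omega>. ennreal (?Z \<omega> ^ k) * ?I \<omega> \<partial>M)"
    by (rule nn_integral_cmult) measurable
  also have "\<dots> = ennreal (1 / s ^ k) * ennreal (exp (- l * s) * l ^ Suc n * s ^ (Suc n + k) * (fact k / fact (Suc n + k)) * steps.coeff (Suc (Suc n)) k)"
    by (simp only: steps.nn_integral_moment_at[OF assms])
  also have "\<dots> = ennreal (exp (- l * s) * (l * s) ^ Suc n * (fact k / fact (Suc n + k)) * steps.coeff (Suc (Suc n)) k)"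
    using assms by (simp add: ennreal_mult'[symmetric] power_add power_mult_distrib mult_ac del: fact_Suc)
  finally show ?thesis .
qed

text \<open>On the event, X(s) = c s (1 - 2 Q) with Q a convex combination of n + 1 marks, whose
  moments are those of Beta(v + 1/2, v + 1/2). The density obtained for s > 0 is the one called
  p_n^m, written through q = (c s - x) / (2 c s), where 4 q (1 - q) = 1 - x^2 / (c s)^2.\<close>

lemma distr_random_motion:
  assumes n: "1 \<le> n" and v: "v = (if m = 0 then real n / 2 else real n + 1)"
  shows "distr (uniform_measure M {\<omega>\<in>space M. event_count S s \<omega> = n}) borel (random_motion c S \<theta> s) =
    density lborel (\<lambda>x. if 0 < s then ennreal (symmetric_beta_density (v + 1 / 2) ((c * s - x) / (2 * c * s)) / (2 * c * s)) else 0)"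
proof -
  obtain k where k: "n = Suc k" using n by (cases n) auto
  let ?A = "{\<omega>\<in>space M. event_count S s \<omega> = n}"
  let ?U = "uniform_measure M ?A"
  have A[measurable]: "?A \<in> sets M" by measurable
  have X[measurable]: "random_motion c S \<theta> s \<in> borel_measurable ?U" by measurable
  show ?thesis
  proof (cases "0 < s")
    case False
    \<comment> \<open>Conditioning on a null event yields the zero measure, since 0 / 0 = 0 in
      \<open>ennreal\<close>; the density has the matching default 0.\<close>
    have null: "emeasure M ?A = 0"
      using event_count_nonpos[of s k] False by (intro emeasure_eq_0_AE) (auto simp: k)
    have "emeasure (distr ?U borel (random_motion c S \<theta> s)) B = 0" if [measurable]: "B \<in> sets borel" for B
    proof -
      have "emeasure M (?A \<inter> (random_motion c S \<theta> s -` B \<inter> space M)) = 0"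
        by (rule emeasure_eq_0[OF A null]) auto
      then show ?thesis by (simp add: emeasure_distr emeasure_uniform_measure[OF A])
    qed
    then show ?thesis using False by (intro measure_eqI) (auto simp: emeasure_density)
  next
    case s: True
    let ?a = "v + 1 / 2"
    have a: "0 < ?a" using v by auto
    have [measurable]: "\<theta> (Suc j) \<in> borel_measurable M" for j by (rule measurable_turn_angle) simp
    let ?Q = "\<lambda>\<omega>. (steps.W n \<omega> + (s - steps.S n \<omega>) * mark (Suc n) \<omega>) / s"
    have Q[measurable]: "?Q \<in> borel_measurable ?U" by measurable
    have mom: "(\<integral>\<^sup>+\<omega>. ennreal (?Q \<omega> ^ j) * indicator ?A \<omega> \<partial>M) =
       ennreal (exp (- l * s) * (l * s) ^ n * (fact j / fact (n + j)) * steps.coeff (Suc n) j)" for j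
      using nn_integral_event_count_moment[OF s, of k j] unfolding k by simp
    have "cosine_moment m 0 = 1" by (simp add: cosine_moment_def)
    then have coeff0: "steps.coeff j 0 = 1" for j
      by (induction j) (simp add: steps.coeff_def, simp add: steps.coeff_Suc)
    let ?p = "exp (- l * s) * (l * s) ^ n / fact n"
    have p: "0 < ?p" using s l by simp
    \<comment> \<open>The moment of order 0 is the probability of the event, here the Poisson
      weight; it will be divided out.\<close>
    have pA: "emeasure M ?A = ennreal ?p" using mom[of 0] by (simp add: coeff0)
    have "emeasure M ?A \<noteq> 0" using p by (simp only: pA ennreal_eq_0_iff not_le)
    then have U: "prob_space ?U" by (rule prob_space_uniform_measure) (simp only: pA, simp)
    interpret U: prob_space ?U by (rule U)
    have Qmom: "(\<integral>\<^sup>+\<omega>. ennreal (?Q \<omega> ^ j) \<partial>?U) = ennreal (Beta (?a + real j) ?a / Beta ?a ?a)" for j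
    proof -
      have "(\<integral>\<^sup>+\<omega>. ennreal (?Q \<omega> ^ j) \<partial>?U) = (\<integral>\<^sup>+\<omega>. ennreal (?Q \<omega> ^ j) * indicator ?A \<omega> \<partial>M) / emeasure M ?A"
        by (rule nn_integral_uniform_measure) measurable
      also have "\<dots> = ennreal (exp (- l * s) * (l * s) ^ n * (fact j / fact (n + j)) * steps.coeff (Suc n) j / ?p)"
        unfolding mom pA using p s l by (intro divide_ennreal) (auto intro!: mult_nonneg_nonneg divide_nonneg_nonneg steps.coeff_nonneg)
      also have "exp (- l * s) * (l * s) ^ n * (fact j / fact (n + j)) * steps.coeff (Suc n) j / ?p = fact n * fact j / fact (n + j) * steps.coeff (Suc n) j"
        using s l by simp
      also have "\<dots> = Beta (?a + real j) ?a / Beta ?a ?a"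
        unfolding steps.coeff_def by (rule cosine_moment_power[OF m v])
      finally show ?thesis .
    qed
    have "distr ?U borel ?Q = density lborel (\<lambda>x. ennreal (symmetric_beta_density ?a x))"
    proof (rule real_distribution_eq_moments)
      show "real_distribution (distr ?U borel ?Q)" by (rule U.real_distribution_distr) (rule Q)
      interpret B: prob_space "density lborel (\<lambda>x. ennreal (symmetric_beta_density ?a x))"
        by (rule prob_space_symmetric_beta[OF a])
      show "real_distribution (density lborel (\<lambda>x. ennreal (symmetric_beta_density ?a x)))"
        by standard auto
      have "AE \<omega> in ?U. 0 \<le> ?Q \<omega> \<and> ?Q \<omega> \<le> 1"
      proof (rule AE_uniform_measureI[OF A], use event_count_iff[of s k] steps.AE_D_pos in eventually_elim, intro impI)
        fix \<omega>
        assume 1: "event_count S s \<omega> = Suc k \<longleftrightarrow> steps.S (Suc k) \<omega> \<le> s \<and> s < steps.S (Suc (Suc k)) \<omega>"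
          and 2: "\<forall>j\<ge>1. 0 < gap j \<omega>" and 3: "\<omega> \<in> ?A"
        have u: "0 \<le> mark j \<omega>" "mark j \<omega> \<le> 1" for j
          using cos_ge_minus_one[of "\<theta> j \<omega>"] by (auto simp: mark_def)
        have r: "0 \<le> s - steps.S n \<omega>" using 1 3 by (auto simp: k)
        have W: "0 \<le> steps.W n \<omega>" "steps.W n \<omega> \<le> steps.S n \<omega>"
        proof -
          show "0 \<le> steps.W n \<omega>"
            unfolding steps.W_def using 2 by (intro sum_nonneg mult_nonneg_nonneg) (auto simp: less_imp_le u)
          have "gap j \<omega> * mark j \<omega> \<le> gap j \<omega> * 1" if "1 \<le> j" for j
            using 2 that u by (intro mult_left_mono) (auto simp: less_imp_le)
          then show "steps.W n \<omega> \<le> steps.S n \<omega>"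
            unfolding steps.W_def steps.S_def by (intro sum_mono) auto
        qed
        have "0 \<le> (s - steps.S n \<omega>) * mark (Suc n) \<omega>" "(s - steps.S n \<omega>) * mark (Suc n) \<omega> \<le> (s - steps.S n \<omega>) * 1"
          using u r by (auto intro!: mult_nonneg_nonneg mult_left_mono simp del: mult_1_right)
        then show "0 \<le> ?Q \<omega> \<and> ?Q \<omega> \<le> 1" using W s by (simp add: divide_le_eq)
      qed
      then show "AE x in distr ?U borel ?Q. 0 \<le> x \<and> x \<le> 1" by (subst AE_distr_iff) auto
      show "AE x in density lborel (\<lambda>x. ennreal (symmetric_beta_density ?a x)). 0 \<le> x \<and> x \<le> 1"
        by (subst AE_density) (auto simp: symmetric_beta_density_def)
      show "(\<integral>\<^sup>+x. ennreal (x ^ j) \<partial>distr ?U borel ?Q) = (\<integral>\<^sup>+x. ennreal (x ^ j) \<partial>density lborel (\<lambda>x. ennreal (symmetric_beta_density ?a x)))" for j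
        using nn_integral_symmetric_beta_moment[OF a, of j] Qmom[of j]
        by (simp add: nn_integral_distr[OF Q] nn_integral_density)
    qed
    then have "distributed ?U lborel ?Q (\<lambda>x. ennreal (symmetric_beta_density ?a x))"
      using Q by (auto simp: distributed_def cong: distr_cong)
    \<comment> \<open>The affine map q to c s - 2 c s q carries the unit interval onto [- c s, c s]
      with reversed orientation.\<close>
    from U.distributed_affine[OF this, of "- (2 * c * s)" "c * s"]
    have D: "distributed ?U lborel (\<lambda>\<omega>. c * s + - (2 * c * s) * ?Q \<omega>)
       (\<lambda>x. ennreal (symmetric_beta_density ?a ((x - c * s) / - (2 * c * s))) / \<bar>- (2 * c * s)\<bar>)"
      using c s by simp
    have "distr ?U borel (random_motion c S \<theta> s) = distr ?U borel (\<lambda>\<omega>. c * s + - (2 * c * s) * ?Q \<omega>)"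
    proof (rule distr_cong_AE)
      have "random_motion c S \<theta> s \<omega> = c * s + - (2 * c * s) * ?Q \<omega>" if \<omega>: "\<omega> \<in> ?A" for \<omega>
      proof -
        let ?d = "\<lambda>j. S j \<omega> - S (j - 1) \<omega>"
        have "random_motion c S \<theta> s \<omega> = c * ((\<Sum>j = 1..n. ?d j * cos (\<theta> j \<omega>)) + (s - S n \<omega>) * cos (\<theta> (Suc n) \<omega>))"
          using \<omega> by (simp add: random_motion_def Let_def)
        also have "(\<Sum>j = 1..n. ?d j * cos (\<theta> j \<omega>)) = steps.S n \<omega> - 2 * steps.W n \<omega>"
          unfolding steps.S_def steps.W_def sum_distrib_left sum_subtractf[symmetric]
          by (intro sum.cong refl) (simp add: gap_def mark_def field_simps)
        also have "c * (steps.S n \<omega> - 2 * steps.W n \<omega> + (s - S n \<omega>) * cos (\<theta> (Suc n) \<omega>)) = c * s + - (2 * c * s) * ?Q \<omega>"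
          using \<omega> s by (simp add: steps_S mark_def field_simps)
        finally show ?thesis .
      qed
      then show "AE \<omega> in ?U. random_motion c S \<theta> s \<omega> = c * s + - (2 * c * s) * ?Q \<omega>"
        by (intro AE_uniform_measureI[OF A]) auto
    qed auto
    also have "\<dots> = distr ?U lborel (\<lambda>\<omega>. c * s + - (2 * c * s) * ?Q \<omega>)"
      by (rule distr_cong) auto
    also have "\<dots> = density lborel (\<lambda>x. ennreal (symmetric_beta_density ?a ((x - c * s) / - (2 * c * s))) / \<bar>- (2 * c * s)\<bar>)"
      by (rule distributed_distr_eq_density[OF D])
    also have "\<dots> = density lborel (\<lambda>x. if 0 < s then ennreal (symmetric_beta_density ?a ((c * s - x) / (2 * c * s)) / (2 * c * s)) else 0)"
    proof (rule arg_cong[where f="density lborel"], rule ext)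
      fix x
      have "(x - c * s) / - (2 * c * s) = (c * s - x) / (2 * c * s)"
        by (metis minus_diff_eq minus_divide_divide)
      then show "ennreal (symmetric_beta_density ?a ((x - c * s) / - (2 * c * s))) / ennreal \<bar>- (2 * c * s)\<bar> =
         (if 0 < s then ennreal (symmetric_beta_density ?a ((c * s - x) / (2 * c * s)) / (2 * c * s)) else 0)"
        using s c symmetric_beta_density_nonneg[OF a] by (simp only:) (simp add: divide_ennreal)
    qed
    finally show ?thesis .
  qed
qed

end

section \<open>The Gamma time change\<close>

lemma Gamma_duplication_real:
  fixes z :: real
  assumes "0 < z"
  shows "Gamma z * Gamma (z + 1 / 2) = 2 powr (1 - 2 * z) * sqrt pi * Gamma (2 * z)"
proof -
  have nn: "complex_of_real x \<notin> \<int>\<^sub>\<le>\<^sub>0" if "0 < x" for x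
    using that nonpos_Ints_nonpos[of x] by (force simp: of_real_in_nonpos_Ints_iff)
  have "complex_of_real (Gamma z * Gamma (z + 1 / 2)) = Gamma (complex_of_real z) * Gamma (complex_of_real z + 1 / 2)"
    using Gamma_complex_of_real[of z] Gamma_complex_of_real[of "z + 1 / 2"] by simp
  also have "\<dots> = exp ((1 - 2 * complex_of_real z) * of_real (ln 2)) * of_real (sqrt pi) * Gamma (2 * complex_of_real z)"
    using nn[of z] nn[of "z + 1 / 2"] assms by (intro Gamma_legendre_duplication) auto
  also have "\<dots> = complex_of_real (exp ((1 - 2 * z) * ln 2) * sqrt pi * Gamma (2 * z))"
    using Gamma_complex_of_real[of "2 * z"] by (simp add: exp_of_real[symmetric])
  finally have "Gamma z * Gamma (z + 1 / 2) = exp ((1 - 2 * z) * ln 2) * sqrt pi * Gamma (2 * z)"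
    by (simp only: of_real_eq_iff)
  then show ?thesis by (simp add: powr_def)
qed

lemma set_integral_eq_nn_integral:
  fixes f :: "'a \<Rightarrow> real"
  assumes meas: "set_borel_measurable M A f" and nonneg: "\<And>x. x \<in> A \<Longrightarrow> 0 \<le> f x"
    and fin: "(\<integral>\<^sup>+x\<in>A. ennreal (f x) \<partial>M) < \<infinity>"
  shows "ennreal (LINT x:A|M. f x) = (\<integral>\<^sup>+x\<in>A. ennreal (f x) \<partial>M)"
proof -
  have eq: "(\<integral>\<^sup>+x. ennreal (indicator A x *\<^sub>R f x) \<partial>M) = (\<integral>\<^sup>+x\<in>A. ennreal (f x) \<partial>M)"
    by (intro nn_integral_cong) (auto simp: indicator_def)
  have "integrable M (\<lambda>x. indicator A x *\<^sub>R f x)"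
    using meas nonneg fin unfolding eq[symmetric] set_borel_measurable_def
    by (intro integrableI_nonneg) (auto simp: indicator_def)
  then have "(\<integral>\<^sup>+x. ennreal (indicator A x *\<^sub>R f x) \<partial>M) = ennreal (\<integral>x. indicator A x *\<^sub>R f x \<partial>M)"
    using nonneg by (intro nn_integral_eq_integral) (auto simp: indicator_def)
  then show ?thesis unfolding eq set_lebesgue_integral_def by (rule sym)
qed

lemma set_integral_nonneg_real:
  fixes f :: "'a \<Rightarrow> real"
  shows "(\<And>x. x \<in> A \<Longrightarrow> 0 \<le> f x) \<Longrightarrow> 0 \<le> (LINT x:A|M. f x)"
  unfolding set_lebesgue_integral_def by (intro integral_nonneg_AE AE_I2) (auto simp: indicator_def)

lemma bessel_K_measurable[measurable]: "bessel_K \<mu> \<in> borel_measurable borel"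
  unfolding bessel_K_def[abs_def] set_lebesgue_integral_def by measurable

lemma gamma_density_measurable[measurable]: "gamma_density \<alpha> t \<in> borel_measurable borel"
  unfolding gamma_density_def[abs_def] by measurable

text \<open>The factor \<open>(u / 2) powr a\<close> cancels the prefactor of
  \<open>bessel_K\<close> at index - a. The Bochner integral has its intended value because
  \<open>a > 0\<close>: bounding the Gaussian factor by 1 leaves a convergent Gamma
  integral.\<close>

lemma bessel_K_conv_nn_integral:
  assumes "0 < a" "0 < u"
  shows "ennreal ((u / 2) powr a * bessel_K (- a) u) =
    ennreal (1 / 2) * (\<integral>\<^sup>+z\<in>{0<..}. ennreal (z powr (a - 1) * exp (- z) * exp (- (u\<^sup>2 / (4 * z)))) \<partial>lborel)"
proof -
  let ?f = "\<lambda>z. exp (- z - u\<^sup>2 / (4 * z)) * z powr (- (- a) - 1)"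
  have f: "?f z = z powr (a - 1) * exp (- z) * exp (- (u\<^sup>2 / (4 * z)))" for z
    by (simp add: exp_add[symmetric])
  have "(\<integral>\<^sup>+z\<in>{0<..}. ennreal (?f z) \<partial>lborel) \<le> (\<integral>\<^sup>+z\<in>{0<..}. ennreal (z powr (a - 1) * exp (- (1 * z))) \<partial>lborel)"
  proof (intro nn_integral_mono)
    fix z :: real
    have "?f z \<le> z powr (a - 1) * exp (- (1 * z))" if "0 < z"
    proof -
      have "exp (- (u\<^sup>2 / (4 * z))) \<le> 1" using that by simp
      then have "z powr (a - 1) * exp (- z) * exp (- (u\<^sup>2 / (4 * z))) \<le> z powr (a - 1) * exp (- z) * 1"
        by (intro mult_left_mono) auto
      then show ?thesis unfolding f by simp
    qed
    then show "ennreal (?f z) * indicator {0<..} z \<le> ennreal (z powr (a - 1) * exp (- (1 * z))) * indicator {0<..} z"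
      by (auto simp: indicator_def intro!: ennreal_leI)
  qed
  also have "\<dots> < \<infinity>" by (subst nn_integral_gamma_kernel) (use assms in auto)
  finally have i1: "ennreal (LINT z:{0<..}|lborel. ?f z) = (\<integral>\<^sup>+z\<in>{0<..}. ennreal (?f z) \<partial>lborel)"
    by (intro set_integral_eq_nn_integral) (auto simp: set_borel_measurable_def)
  have "(u / 2) powr a * (u / 2) powr (- a) = 1"
    using assms by (simp add: powr_add[symmetric])
  then have i2: "(u / 2) powr a * bessel_K (- a) u = 1 / 2 * (LINT z:{0<..}|lborel. ?f z)"
    unfolding bessel_K_def by (simp add: mult.assoc[symmetric])
  have "ennreal ((u / 2) powr a * bessel_K (- a) u) = ennreal (1 / 2) * ennreal (LINT z:{0<..}|lborel. ?f z)"
    unfolding i2 by (rule ennreal_mult') simp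
  also note i1
  finally show ?thesis by (simp only: f)
qed

text \<open>Provides the integrability behind the w-integral of the theorem. For v \<ge> 1/2 the
  middle factor is at most 1, and x > y trades the possibly nonintegrable power a - 2 for a - 1 at
  the cost of 1 / y.\<close>

lemma nn_integral_power_tail_finite:
  fixes y v a :: real
  assumes "0 < y" "1 / 2 \<le> v" "0 < a"
  shows "(\<integral>\<^sup>+x\<in>{y<..}. ennreal (x powr (a - 2) * (1 - y\<^sup>2 / x\<^sup>2) powr (v - 1 / 2) * exp (- x)) \<partial>lborel) < \<infinity>"
proof -
  have "(\<integral>\<^sup>+x\<in>{y<..}. ennreal (x powr (a - 2) * (1 - y\<^sup>2 / x\<^sup>2) powr (v - 1 / 2) * exp (- x)) \<partial>lborel)
    \<le> (\<integral>\<^sup>+x. ennreal (1 / y) * (ennreal (x powr (a - 1) * exp (- (1 * x))) * indicator {0<..} x) \<partial>lborel)"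
  proof (intro nn_integral_mono)
    fix x :: real
    have "x powr (a - 2) * (1 - y\<^sup>2 / x\<^sup>2) powr (v - 1 / 2) * exp (- x) \<le> 1 / y * (x powr (a - 1) * exp (- (1 * x)))" if "y < x"
    proof -
      have "y\<^sup>2 / x\<^sup>2 \<le> 1" using that assms by (simp add: divide_le_eq power_mono)
      then have "(1 - y\<^sup>2 / x\<^sup>2) powr (v - 1 / 2) \<le> 1" using assms by (intro powr_le1) auto
      moreover have "x powr (a - 2) \<le> 1 / y * x powr (a - 1)"
      proof -
        have "x powr (a - 2) = x powr (a - 1) / x" using powr_diff[of x "a - 1" 1] that assms by simp
        also have "\<dots> \<le> x powr (a - 1) / y" using that assms by (intro divide_left_mono) auto
        finally show ?thesis by simp
      qed
      ultimately have "x powr (a - 2) * (1 - y\<^sup>2 / x\<^sup>2) powr (v - 1 / 2) \<le> (1 / y * x powr (a - 1)) * 1"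
        using assms by (intro mult_mono) auto
      then have "x powr (a - 2) * (1 - y\<^sup>2 / x\<^sup>2) powr (v - 1 / 2) * exp (- x) \<le> (1 / y * x powr (a - 1)) * 1 * exp (- x)"
        by (rule mult_right_mono) simp
      then show ?thesis by simp
    qed
    then show "ennreal (x powr (a - 2) * (1 - y\<^sup>2 / x\<^sup>2) powr (v - 1 / 2) * exp (- x)) * indicator {y<..} x \<le>
       ennreal (1 / y) * (ennreal (x powr (a - 1) * exp (- (1 * x))) * indicator {0<..} x)"
      using assms by (auto simp: indicator_def ennreal_mult'[symmetric] intro!: ennreal_leI)
  qed
  also have "\<dots> = ennreal (1 / y) * (\<integral>\<^sup>+x\<in>{0<..}. ennreal (x powr (a - 1) * exp (- (1 * x))) \<partial>lborel)"
    by (rule nn_integral_cmult) measurable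
  also have "\<dots> < \<infinity>"
    by (subst nn_integral_gamma_kernel) (use assms in \<open>auto simp: ennreal_mult_less_top\<close>)
  finally show ?thesis .
qed

text \<open>Only times with c s > |x| contribute; after rescaling by t the threshold is
  \<open>y\<close>. The 1 / s in the conditional density lowers the Gamma power from \<alpha> - 1 to
  \<alpha> - 2.\<close>

lemma nn_integral_gamma_beta_mixture:
  fixes c t \<alpha> v x :: real
  assumes "0 < c" "0 < t" "0 < \<alpha>" "0 < v" "x \<noteq> 0"
  defines "y \<equiv> t * \<bar>x\<bar> / c"
  shows "(\<integral>\<^sup>+s. ennreal (gamma_density \<alpha> t s) * (if 0 < s then ennreal (symmetric_beta_density (v + 1 / 2) ((c * s - x) / (2 * c * s)) / (2 * c * s)) else 0) \<partial>lborel) =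
    ennreal (t * Gamma (v + 1) / (sqrt pi * Gamma (v + 1 / 2) * c * Gamma \<alpha>)) *
      (\<integral>\<^sup>+x\<in>{y<..}. ennreal (x powr (\<alpha> - 2) * (1 - y\<^sup>2 / x\<^sup>2) powr (v - 1 / 2) * exp (- x)) \<partial>lborel)"
proof -
  let ?B = "Beta (v + 1 / 2) (v + 1 / 2)"
  let ?K = "4 powr (1 / 2 - v) * t / (2 * c * Gamma \<alpha> * ?B)"
  let ?h = "\<lambda>x. x powr (\<alpha> - 2) * (1 - y\<^sup>2 / x\<^sup>2) powr (v - 1 / 2) * exp (- x)"
  let ?g = "\<lambda>s. ennreal (gamma_density \<alpha> t s) * (if 0 < s then ennreal (symmetric_beta_density (v + 1 / 2) ((c * s - x) / (2 * c * s)) / (2 * c * s)) else 0)"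
  have y: "0 < y" using assms by simp
  have B: "0 < ?B" using assms by (intro Beta_real_pos) auto
  have G: "0 < Gamma \<alpha>" "0 < Gamma (v + 1 / 2)" using assms by (auto intro!: Gamma_real_pos)
  have K: "0 \<le> ?K" using B G assms by (intro divide_nonneg_nonneg mult_nonneg_nonneg) auto
  have "(\<integral>\<^sup>+s. ?g s \<partial>lborel) = ennreal \<bar>1 / t\<bar> * (\<integral>\<^sup>+s. ?g (0 + 1 / t * s) \<partial>lborel)"
    using assms by (intro nn_integral_real_affine) auto
  also have "\<dots> = (\<integral>\<^sup>+s. ennreal \<bar>1 / t\<bar> * ?g (0 + 1 / t * s) \<partial>lborel)"
    by (rule nn_integral_cmult[symmetric]) measurable
  also have "\<dots> = (\<integral>\<^sup>+s. ennreal ?K * (ennreal (?h s) * indicator {y<..} s) \<partial>lborel)"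
  proof (intro nn_integral_cong)
    fix s :: real
    show "ennreal \<bar>1 / t\<bar> * ?g (0 + 1 / t * s) = ennreal ?K * (ennreal (?h s) * indicator {y<..} s)"
    proof (cases "0 < s")
      case False
      then have "\<not> 0 < 0 + 1 / t * s" using assms by (simp add: zero_less_divide_iff)
      then show ?thesis using False y by (auto simp: indicator_def)
    next
      case s: True
      let ?s = "s / t" and ?q = "(c * (s / t) - x) / (2 * c * (s / t))"
      define r where "r = c * (s / t)"
      have r: "0 < r" using assms s by (simp add: r_def)
      have q: "?q = (r - x) / (2 * r)" by (simp add: r_def)
      have "0 < ?q \<longleftrightarrow> x < c * (s / t)" "?q < 1 \<longleftrightarrow> - x < c * (s / t)"
        unfolding q unfolding r_def[symmetric] using r by (auto simp: zero_less_divide_iff divide_less_eq)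
      moreover have "y < s \<longleftrightarrow> \<bar>x\<bar> < c * (s / t)"
        unfolding y_def using assms by (simp add: field_simps)
      ultimately have iff: "0 < ?q \<and> ?q < 1 \<longleftrightarrow> y < s" by auto
      \<comment> \<open>Here r = c s / t is the largest possible displacement: q (1 - q) = (r^2 -
        x^2) / (4 r^2) and y / s = |x| / r.\<close>
      have qq: "?q * (1 - ?q) = (1 - y\<^sup>2 / s\<^sup>2) / 4"
      proof -
        have "y / s = \<bar>x\<bar> / r" unfolding y_def r_def using assms s by (simp add: field_simps)
        then have e: "y\<^sup>2 / s\<^sup>2 = x\<^sup>2 / r\<^sup>2" by (metis power2_abs power_divide)
        show ?thesis unfolding q e using r by (simp add: power2_eq_square field_simps)
      qed
      have "\<bar>1 / t\<bar> * (gamma_density \<alpha> t ?s * (symmetric_beta_density (v + 1 / 2) ?q / (2 * c * ?s))) = ?K * ?h s" if ys: "y < s"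
      proof -
        have "0 \<le> 1 - y\<^sup>2 / s\<^sup>2" using ys y by (simp add: divide_le_eq power_mono)
        then have sb: "symmetric_beta_density (v + 1 / 2) ?q = (1 - y\<^sup>2 / s\<^sup>2) powr (v - 1 / 2) * 4 powr (1 / 2 - v) / ?B"
          using iff ys powr_minus_divide[of 4 "v - 1 / 2"] unfolding symmetric_beta_density_def qq
          by (simp add: powr_divide)
        have gd: "gamma_density \<alpha> t ?s = t / Gamma \<alpha> * (s * s powr (\<alpha> - 2)) * exp (- s)"
        proof -
          have "t powr \<alpha> * ?s powr (\<alpha> - 1) = t * s powr (\<alpha> - 1)"
            using s assms by (simp add: powr_divide powr_diff)
          moreover have "s powr (\<alpha> - 1) = s * s powr (\<alpha> - 2)"
            using powr_add[of s 1 "\<alpha> - 2"] s by simp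
          ultimately show ?thesis using s assms by (simp add: gamma_density_def)
        qed
        show ?thesis unfolding sb gd using assms(1,2) s B G by (simp add: field_simps)
      qed
      moreover have "0 \<le> gamma_density \<alpha> t ?s" using G by (simp add: gamma_density_def)
      moreover have "0 \<le> symmetric_beta_density (v + 1 / 2) ?q" using assms by (intro symmetric_beta_density_nonneg) auto
      ultimately have prod: "ennreal \<bar>1 / t\<bar> * (ennreal (gamma_density \<alpha> t ?s) * ennreal (symmetric_beta_density (v + 1 / 2) ?q / (2 * c * ?s))) = ennreal (?K * ?h s)" if "y < s"
        using that assms s by (simp only: ennreal_mult'[symmetric] mult_nonneg_nonneg abs_ge_zero)
      have zero: "symmetric_beta_density (v + 1 / 2) ?q = 0" if "\<not> y < s"
        using that iff by (auto simp: symmetric_beta_density_def)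
      have g: "?g (0 + 1 / t * s) = ennreal (gamma_density \<alpha> t ?s) * ennreal (symmetric_beta_density (v + 1 / 2) ?q / (2 * c * ?s))"
        using s assms(2) by simp
      show ?thesis
      proof (cases "y < s")
        case True
        have "ennreal (?K * ?h s) = ennreal ?K * ennreal (?h s)" by (rule ennreal_mult'[OF K])
        then show ?thesis unfolding g prod[OF True] using True by simp
      next
        case False
        then show ?thesis unfolding g zero[OF False] by simp
      qed
    qed
  qed
  also have "\<dots> = ennreal ?K * (\<integral>\<^sup>+x\<in>{y<..}. ennreal (?h x) \<partial>lborel)"
    by (rule nn_integral_cmult) measurable
  \<comment> \<open>The power of 4 stems from the factor 1/4 in q (1 - q). Legendre duplication at v
    + 1/2 absorbs it together with the Gamma (2 v + 1) inside \<open>?B\<close>.\<close>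
  also have "?K = t * Gamma (v + 1) / (sqrt pi * Gamma (v + 1 / 2) * c * Gamma \<alpha>)"
  proof -
    have p: "2 powr (1 - 2 * (v + 1 / 2)) = 4 powr (1 / 2 - v) / 2"
    proof -
      have "4 powr (1 / 2 - v) = (2 powr 2) powr (1 / 2 - v)" by simp
      also have "\<dots> = 2 powr (1 - 2 * v)" unfolding powr_powr by (simp add: algebra_simps)
      also have "1 - 2 * v = 1 + (1 - 2 * (v + 1 / 2))" by simp
      also have "2 powr (1 + (1 - 2 * (v + 1 / 2))) = 2 * 2 powr (1 - 2 * (v + 1 / 2))"
        by (subst powr_add) simp
      finally show ?thesis by simp
    qed
    have alg: "p * t / (2 * c * ga * (g * g / g2)) = t * g1 / (q * g * c * ga)"
      if h: "g * g1 = p / 2 * q * g2" and pos: "0 < g" "0 < g2" "0 < q" "0 < ga" for p q g g1 g2 ga :: real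
    proof -
      have "p = 2 * g * g1 / (q * g2)" using h pos by (simp add: field_simps)
      then show ?thesis using pos assms(1) by (simp only:) (simp add: field_simps)
    qed
    have dup: "Gamma (v + 1 / 2) * Gamma (v + 1) = 4 powr (1 / 2 - v) / 2 * sqrt pi * Gamma (2 * v + 1)"
      using Gamma_duplication_real[of "v + 1 / 2"] assms unfolding p by (simp add: add_ac distrib_left)
    have Bv: "?B = Gamma (v + 1 / 2) * Gamma (v + 1 / 2) / Gamma (2 * v + 1)"
      unfolding Beta_def by (simp add: add_ac)
    have "0 < Gamma (2 * v + 1)" using assms by (intro Gamma_real_pos) auto
    then show ?thesis unfolding Bv using G by (intro alg[OF dup]) auto
  qed
  finally show ?thesis .
qed

text \<open>The theorem's side, brought to the same multiple of the same tail integral as the Gamma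
  mixture: with u = y / sqrt w the Bessel factor is half an integral over z, and after exchanging w
  and z the double integral is that of \<open>nn_integral_bessel_mixture\<close>.\<close>

lemma bessel_mixture_conv_nn_integral:
  fixes c t \<alpha> v x :: real
  assumes "0 < c" "0 < t" "0 < \<alpha>" "1 / 2 \<le> v" "\<alpha> / 2 - 1 < v" "x \<noteq> 0"
  defines "y \<equiv> t * \<bar>x\<bar> / c"
  shows "ennreal (1 / (Gamma ((\<alpha> + 1) / 2) * Beta (\<alpha> / 2) (v - \<alpha> / 2 + 1)) *
       (LINT w:{0<..<1}|lborel.
          w powr (\<alpha> / 2 - 1) * (1 - w) powr (v - \<alpha> / 2) *
          (t / (sqrt (pi * w) * c)) *
          (t * \<bar>x\<bar> / (2 * c * sqrt w)) powr (\<alpha> / 2) *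
          bessel_K (- (\<alpha> / 2)) (t * \<bar>x\<bar> / (c * sqrt w)))) =
    ennreal (t * Gamma (v + 1) / (sqrt pi * Gamma (v + 1 / 2) * c * Gamma \<alpha>)) *
      (\<integral>\<^sup>+x\<in>{y<..}. ennreal (x powr (\<alpha> - 2) * (1 - y\<^sup>2 / x\<^sup>2) powr (v - 1 / 2) * exp (- x)) \<partial>lborel)"
proof -
  let ?f = "\<lambda>z w. z powr (\<alpha> / 2 - 1) * exp (- z) * (w powr (\<alpha> / 2 - 3 / 2) * (1 - w) powr (v - \<alpha> / 2) * exp (- (y\<^sup>2 / (4 * z) / w)))"
  let ?L = "\<integral>\<^sup>+x\<in>{y<..}. ennreal (x powr (\<alpha> - 2) * (1 - y\<^sup>2 / x\<^sup>2) powr (v - 1 / 2) * exp (- x)) \<partial>lborel"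
  let ?R = "\<integral>\<^sup>+z\<in>{0<..}. (\<integral>\<^sup>+w\<in>{0<..<1}. ennreal (?f z w) \<partial>lborel) \<partial>lborel"
  let ?C = "v + 1 - \<alpha> / 2"
  let ?h = "\<lambda>w. w powr (\<alpha> / 2 - 1) * (1 - w) powr (v - \<alpha> / 2) * (t / (sqrt (pi * w) * c)) *
          (t * \<bar>x\<bar> / (2 * c * sqrt w)) powr (\<alpha> / 2) * bessel_K (- (\<alpha> / 2)) (t * \<bar>x\<bar> / (c * sqrt w))"
  have y: "0 < y" using assms by simp
  have G: "0 < Gamma ?C" "0 < Gamma (v + 1 / 2)" "0 < Gamma \<alpha>" "0 < Gamma (v + 1)" "0 < Gamma (\<alpha> / 2)" "0 < Gamma ((\<alpha> + 1) / 2)"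
    using assms by (auto intro!: Gamma_real_pos)
  have Beta: "Beta (\<alpha> / 2) (v - \<alpha> / 2 + 1) = Gamma (\<alpha> / 2) * Gamma ?C / Gamma (v + 1)"
  proof -
    have "v - \<alpha> / 2 + 1 = ?C" "\<alpha> / 2 + ?C = v + 1" by simp_all
    then show ?thesis unfolding Beta_def by (simp only:)
  qed
  let ?k = "2 powr (\<alpha> - 2) * Gamma (v + 1 / 2)" and ?k' = "sqrt pi * Gamma ?C"
  have LR: "ennreal ?k' * ?L = ennreal ?k * ?R"
    using assms y by (intro nn_integral_bessel_mixture) auto
  have k: "0 < ?k" "0 < ?k'" using G by auto
  have cancel: "ennreal (1 / p) * (ennreal p * X) = X" if "0 < p" for p X
    using that by (simp add: mult.assoc[symmetric] ennreal_mult'[symmetric])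
  have R: "?R = ennreal (?k' / ?k) * ?L"
  proof -
    have "?R = ennreal (1 / ?k) * (ennreal ?k * ?R)" by (rule cancel[OF k(1), symmetric])
    also have "\<dots> = ennreal (1 / ?k) * ennreal ?k' * ?L" unfolding LR[symmetric] by (simp only: mult.assoc)
    also have "ennreal (1 / ?k) * ennreal ?k' = ennreal (?k' / ?k)"
      using k by (subst ennreal_mult[symmetric]) auto
    finally show ?thesis .
  qed
  \<comment> \<open>Finiteness is easy to see for the tail integral; the proportionality just shown
    carries it to the double integral, as needed to pass to the Bochner integral over w.\<close>
  have "?L < \<infinity>" using assms y by (intro nn_integral_power_tail_finite) auto
  then have Rfin: "?R < \<infinity>" unfolding R by (simp add: ennreal_mult_less_top)
  have h: "ennreal (?h w) = ennreal (t / (2 * sqrt pi * c)) * (\<integral>\<^sup>+z\<in>{0<..}. ennreal (?f z w) \<partial>lborel)" and h_nonneg: "0 \<le> ?h w"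
    if w: "0 < w" "w < 1" for w
  proof -
    let ?u = "y / sqrt w"
    let ?I = "\<integral>\<^sup>+z\<in>{0<..}. ennreal (z powr (\<alpha> / 2 - 1) * exp (- z) * exp (- (?u\<^sup>2 / (4 * z)))) \<partial>lborel"
    let ?p = "w powr (\<alpha> / 2 - 3 / 2) * (1 - w) powr (v - \<alpha> / 2)"
    have u: "0 < ?u" using y w by simp
    have e1: "t * \<bar>x\<bar> / (2 * c * sqrt w) = ?u / 2" "t * \<bar>x\<bar> / (c * sqrt w) = ?u" by (simp_all add: y_def)
    \<comment> \<open>The factor 1 / sqrt w of the Gaussian-type normalisation lowers the exponent
      of w from \<alpha>/2 - 1 to \<alpha>/2 - 3/2.\<close>
    have e2: "w powr (\<alpha> / 2 - 1) * (1 - w) powr (v - \<alpha> / 2) * (t / (sqrt (pi * w) * c)) = t / (sqrt pi * c) * ?p"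
    proof -
      have "w powr (\<alpha> / 2 - 3 / 2) = w powr (\<alpha> / 2 - 1) / sqrt w"
        using w powr_diff[of w "\<alpha> / 2 - 1" "1 / 2"] by (simp add: powr_half_sqrt)
      then show ?thesis by (simp only:) (simp add: real_sqrt_mult mult_ac)
    qed
    have hw: "?h w = t / (sqrt pi * c) * ?p * ((?u / 2) powr (\<alpha> / 2) * bessel_K (- (\<alpha> / 2)) ?u)"
      unfolding e1 e2 by simp
    have "0 \<le> bessel_K (- (\<alpha> / 2)) ?u"
      unfolding bessel_K_def by (intro mult_nonneg_nonneg set_integral_nonneg_real) auto
    then show "0 \<le> ?h w" unfolding hw using assms by (intro mult_nonneg_nonneg divide_nonneg_nonneg) auto
    have "ennreal (?h w) = ennreal (t / (sqrt pi * c) * ?p) * ennreal ((?u / 2) powr (\<alpha> / 2) * bessel_K (- (\<alpha> / 2)) ?u)"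
      unfolding hw by (rule ennreal_mult') (use assms in auto)
    also have "ennreal ((?u / 2) powr (\<alpha> / 2) * bessel_K (- (\<alpha> / 2)) ?u) = ennreal (1 / 2) * ?I"
      using assms u by (intro bessel_K_conv_nn_integral) auto
    also have "ennreal (t / (sqrt pi * c) * ?p) * (ennreal (1 / 2) * ?I) = ennreal (t / (2 * sqrt pi * c)) * (ennreal ?p * ?I)"
    proof -
      have "t / (sqrt pi * c) * ?p * (1 / 2) = t / (2 * sqrt pi * c) * ?p" by simp
      then have "ennreal (t / (sqrt pi * c) * ?p) * ennreal (1 / 2) = ennreal (t / (2 * sqrt pi * c)) * ennreal ?p"
        using assms by (simp only: ennreal_mult'[symmetric] ennreal_mult''[symmetric]) (subst ennreal_mult''[symmetric], auto)
      then show ?thesis by (simp only: mult.assoc[symmetric])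
    qed
    also have "ennreal ?p * ?I = (\<integral>\<^sup>+z. ennreal ?p * (ennreal (z powr (\<alpha> / 2 - 1) * exp (- z) * exp (- (?u\<^sup>2 / (4 * z)))) * indicator {0<..} z) \<partial>lborel)"
      by (rule nn_integral_cmult[symmetric]) measurable
    also have "\<dots> = (\<integral>\<^sup>+z\<in>{0<..}. ennreal (?f z w) \<partial>lborel)"
    proof (intro nn_integral_cong)
      fix z :: real
      have "?u\<^sup>2 / (4 * z) = y\<^sup>2 / (4 * z) / w" using w by (simp add: power_divide)
      then have "?p * (z powr (\<alpha> / 2 - 1) * exp (- z) * exp (- (?u\<^sup>2 / (4 * z)))) = ?f z w" by (simp only: mult_ac)
      moreover have "ennreal (?p * (z powr (\<alpha> / 2 - 1) * exp (- z) * exp (- (?u\<^sup>2 / (4 * z))))) =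
          ennreal ?p * ennreal (z powr (\<alpha> / 2 - 1) * exp (- z) * exp (- (?u\<^sup>2 / (4 * z))))"
        by (rule ennreal_mult') simp
      ultimately show "ennreal ?p * (ennreal (z powr (\<alpha> / 2 - 1) * exp (- z) * exp (- (?u\<^sup>2 / (4 * z)))) * indicator {0<..} z) = ennreal (?f z w) * indicator {0<..} z"
        by (simp only: mult.assoc[symmetric])
    qed
    finally show "ennreal (?h w) = ennreal (t / (2 * sqrt pi * c)) * (\<integral>\<^sup>+z\<in>{0<..}. ennreal (?f z w) \<partial>lborel)" .
  qed
  let ?F = "\<lambda>z w. ennreal (?f z w) * indicator {0<..} z * indicator {0<..<1} w"
  have "(\<integral>\<^sup>+w\<in>{0<..<1}. ennreal (?h w) \<partial>lborel) = (\<integral>\<^sup>+w. ennreal (t / (2 * sqrt pi * c)) * (\<integral>\<^sup>+z. ?F z w \<partial>lborel) \<partial>lborel)"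
  proof (intro nn_integral_cong)
    fix w :: real
    show "ennreal (?h w) * indicator {0<..<1} w = ennreal (t / (2 * sqrt pi * c)) * (\<integral>\<^sup>+z. ?F z w \<partial>lborel)"
      using h[of w] by (cases "0 < w \<and> w < 1") auto
  qed
  also have "\<dots> = ennreal (t / (2 * sqrt pi * c)) * (\<integral>\<^sup>+w. \<integral>\<^sup>+z. ?F z w \<partial>lborel \<partial>lborel)"
    by (rule nn_integral_cmult) measurable
  also have "(\<integral>\<^sup>+w. \<integral>\<^sup>+z. ?F z w \<partial>lborel \<partial>lborel) = (\<integral>\<^sup>+z. \<integral>\<^sup>+w. ?F z w \<partial>lborel \<partial>lborel)"
    by (rule lborel_pair.Fubini') measurable
  also have "\<dots> = ?R"
  proof (intro nn_integral_cong)
    fix z :: real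
    show "(\<integral>\<^sup>+w. ?F z w \<partial>lborel) = (\<integral>\<^sup>+w\<in>{0<..<1}. ennreal (?f z w) \<partial>lborel) * indicator {0<..} z"
      by (cases "0 < z") auto
  qed
  finally have H: "(\<integral>\<^sup>+w\<in>{0<..<1}. ennreal (?h w) \<partial>lborel) = ennreal (t / (2 * sqrt pi * c)) * ?R" .
  have "ennreal (LINT w:{0<..<1}|lborel. ?h w) = ennreal (t / (2 * sqrt pi * c)) * ?R"
    unfolding H[symmetric]
  proof (rule set_integral_eq_nn_integral)
    show "set_borel_measurable lborel {0<..<1} ?h" unfolding set_borel_measurable_def by measurable
    show "(\<integral>\<^sup>+w\<in>{0<..<1}. ennreal (?h w) \<partial>lborel) < \<infinity>"
      unfolding H using Rfin by (simp add: ennreal_mult_less_top)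
  qed (use h_nonneg in auto)
  also have "\<dots> = ennreal (t / (2 * sqrt pi * c)) * ennreal (?k' / ?k) * ?L"
    unfolding R by (simp only: mult.assoc)
  also have "ennreal (t / (2 * sqrt pi * c)) * ennreal (?k' / ?k) = ennreal (t / (2 * sqrt pi * c) * (?k' / ?k))"
    using assms k by (intro ennreal_mult[symmetric]) auto
  finally have I: "ennreal (LINT w:{0<..<1}|lborel. ?h w) = ennreal (t / (2 * sqrt pi * c) * (?k' / ?k)) * ?L" .
  let ?b = "1 / (Gamma ((\<alpha> + 1) / 2) * Beta (\<alpha> / 2) (v - \<alpha> / 2 + 1))"
  have b: "0 \<le> ?b" unfolding Beta using G by auto
  have "ennreal (?b * (LINT w:{0<..<1}|lborel. ?h w)) = ennreal ?b * ennreal (LINT w:{0<..<1}|lborel. ?h w)"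
    by (rule ennreal_mult'[OF b])
  also have "\<dots> = ennreal ?b * ennreal (t / (2 * sqrt pi * c) * (?k' / ?k)) * ?L"
    unfolding I by (rule mult.assoc[symmetric])
  also have "ennreal ?b * ennreal (t / (2 * sqrt pi * c) * (?k' / ?k)) = ennreal (?b * (t / (2 * sqrt pi * c) * (?k' / ?k)))"
    using b assms k by (intro ennreal_mult[symmetric] mult_nonneg_nonneg) auto
  also have "?b * (t / (2 * sqrt pi * c) * (?k' / ?k)) = t * Gamma (v + 1) / (sqrt pi * Gamma (v + 1 / 2) * c * Gamma \<alpha>)"
  proof -
    \<comment> \<open>Duplication at \<alpha>/2 accounts for Gamma ((\<alpha> + 1) / 2) in the
      theorem: with the Gamma (\<alpha>/2) from the Beta function it forms Gamma \<alpha>, the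
      normaliser of the Gamma density.\<close>
    have "Gamma (\<alpha> / 2) * Gamma ((\<alpha> + 1) / 2) = 2 powr (1 - \<alpha>) * sqrt pi * Gamma \<alpha>"
      using Gamma_duplication_real[of "\<alpha> / 2"] assms by (simp add: add_divide_distrib)
    moreover have "2 powr (1 - \<alpha>) * 2 powr (\<alpha> - 2) = 1 / 2"
      by (simp add: powr_add[symmetric] powr_minus)
    ultimately have d: "Gamma (\<alpha> / 2) * Gamma ((\<alpha> + 1) / 2) * 2 powr (\<alpha> - 2) = sqrt pi * Gamma \<alpha> / 2"
      by (simp add: mult_ac)
    have "?b * (t / (2 * sqrt pi * c) * (?k' / ?k)) = t * Gamma (v + 1) / (2 * c * Gamma (v + 1 / 2) * (Gamma (\<alpha> / 2) * Gamma ((\<alpha> + 1) / 2) * 2 powr (\<alpha> - 2)))"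
    proof -
      have "1 / (g2 * (g1 * gc / gv)) * (t / (2 * q * c) * (q * gc / (p * gh))) = t * gv / (2 * c * gh * (g1 * g2 * p))"
        if "0 < gc" "0 < q" for g1 g2 gc gv p q gh :: real
        using that by (simp add: field_simps)
      then show ?thesis unfolding Beta by this (use G in auto)
    qed
    also have "\<dots> = t * Gamma (v + 1) / (sqrt pi * Gamma (v + 1 / 2) * c * Gamma \<alpha>)"
      unfolding d by (simp add: mult_ac)
    finally show ?thesis .
  qed
  finally show ?thesis .
qed

theorem theorem4p5:
  fixes M :: "'a measure"
    and S \<theta> :: "nat \<Rightarrow> 'a \<Rightarrow> real"
    and G :: "'a \<Rightarrow> real"
    and c l t \<alpha> v :: real
    and m n :: nat
  assumes "prob_space M"
    and "c > 0" and "l > 0" and "t > 0" and "\<alpha> > 0"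
    and "m \<in> {0, 1}" and "n \<ge> 1"
    and "v = (if m = 0 then real n / 2 else real n + 1)"
    and "v > \<alpha> / 2 - 1"
    and "poisson_motion M l m S \<theta>"
    and "distributed M lborel G (gamma_density \<alpha> t)"
    and "prob_space.indep_vars M (\<lambda>_. borel)
           (case_option G (case_sum (\<lambda>j \<omega>. S j \<omega> - S (j - 1) \<omega>) \<theta>))
           (insert None (Some ` ({1..} <+> {1..})))"
  shows "fixed_count_law M (random_motion c S \<theta>) (event_count S) n G =
    density lborel (\<lambda>x. ennreal
      (1 / (Gamma ((\<alpha> + 1) / 2) * Beta (\<alpha> / 2) (v - \<alpha> / 2 + 1)) *
       (LINT w:{0<..<1}|lborel.
          w powr (\<alpha> / 2 - 1) * (1 - w) powr (v - \<alpha> / 2) *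
          (t / (sqrt (pi * w) * c)) *
          (t * \<bar>x\<bar> / (2 * c * sqrt w)) powr (\<alpha> / 2) *
          bessel_K (- (\<alpha> / 2)) (t * \<bar>x\<bar> / (c * sqrt w)))))"
    (is "_ = density lborel (\<lambda>x. ennreal (?r x))")
proof -
  interpret turning_motion M S \<theta> c l m by (rule turning_motion.intro) (rule assms)+
  let ?P = "\<lambda>s x. if 0 < s then ennreal (symmetric_beta_density (v + 1 / 2) ((c * s - x) / (2 * c * s)) / (2 * c * s)) else 0"
  let ?A = "\<lambda>s. {\<omega>\<in>space M. event_count S s \<omega> = n}"
  let ?X = "\<lambda>s. distr (uniform_measure M (?A s)) borel (random_motion c S \<theta> s)"
  have v: "1 / 2 \<le> v" using assms by auto
  have X: "?X s = density lborel (?P s)" for s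
    by (rule distr_random_motion[OF assms(7,8)])
  have G_law: "distr M borel G = density lborel (\<lambda>s. ennreal (gamma_density \<alpha> t s))"
    using distributed_distr_eq_density[OF assms(11)] by (simp cong: distr_cong)
  \<comment> \<open>At s \<le> 0 the conditional law is the zero measure, so the kernel of the
    mixture consists of subprobability measures only.\<close>
  have sub: "subprob_space (?X s)" for s
  proof -
    have A[measurable]: "?A s \<in> sets M" by measurable
    have "emeasure M (?A s \<inter> space M) / emeasure M (?A s) \<le> 1"
    proof (cases "emeasure M (?A s) = 0")
      case False
      then show ?thesis by (simp add: steps.emeasure_eq_measure divide_ennreal Int_absorb2)
    qed (simp add: emeasure_eq_0[OF A])
    then have "subprob_space (uniform_measure M (?A s))"
      using steps.not_empty by (intro subprob_spaceI) (simp_all add: emeasure_uniform_measure[OF A])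
    then show ?thesis
      by (rule subprob_space.subprob_space_distr) (auto simp: steps.not_empty)
  qed
  have P[measurable]: "(\<lambda>(s, x). ?P s x) \<in> borel_measurable (borel \<Otimes>\<^sub>M borel)" by measurable
  have kernel: "?X \<in> borel \<rightarrow>\<^sub>M subprob_algebra borel"
  proof (rule measurable_subprob_algebra)
    fix B :: "real set" assume B[measurable]: "B \<in> sets borel"
    \<comment> \<open>Measurability in s is read off the explicit density, which is jointly
      measurable in s and x.\<close>
    show "(\<lambda>s. emeasure (?X s) B) \<in> borel_measurable borel"
      unfolding X by (subst emeasure_density) measurable
  qed (use sub in auto)
  have r[measurable]: "?r \<in> borel_measurable borel"
    unfolding set_lebesgue_integral_def by measurable
  \<comment> \<open>Both formulas for the density reduce to the same multiple of one tail integral.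
    The point x = 0, where the threshold y would be 0, is a null set.\<close>
  have mix: "AE x in lborel. (\<integral>\<^sup>+s. ennreal (gamma_density \<alpha> t s) * ?P s x \<partial>lborel) = ennreal (?r x)"
    using AE_lborel_singleton[of "0::real"]
  proof eventually_elim
    case (elim x)
    have "0 < v" using v by simp
    show ?case
      unfolding bessel_mixture_conv_nn_integral[OF assms(2,4,5) v assms(9) elim]
      by (rule nn_integral_gamma_beta_mixture[OF assms(2,4,5) \<open>0 < v\<close> elim])
  qed
  show ?thesis
  proof (rule measure_eqI)
    show "sets (fixed_count_law M (random_motion c S \<theta>) (event_count S) n G) = sets (density lborel (\<lambda>x. ennreal (?r x)))"
      unfolding fixed_count_law_def by (subst sets_bind[where N=borel]) auto
    fix B assume "B \<in> sets (fixed_count_law M (random_motion c S \<theta>) (event_count S) n G)"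
    then have B[measurable]: "B \<in> sets borel"
      unfolding fixed_count_law_def by (subst (asm) sets_bind[where N=borel]) auto
    have "emeasure (fixed_count_law M (random_motion c S \<theta>) (event_count S) n G) B = (\<integral>\<^sup>+s. emeasure (?X s) B \<partial>distr M borel G)"
      unfolding fixed_count_law_def using kernel by (intro emeasure_bind[where N=borel]) auto
    also have "\<dots> = (\<integral>\<^sup>+s. ennreal (gamma_density \<alpha> t s) * (\<integral>\<^sup>+x. ?P s x * indicator B x \<partial>lborel) \<partial>lborel)"
      unfolding G_law X by (subst nn_integral_density) (auto simp: emeasure_density)
    also have "\<dots> = (\<integral>\<^sup>+s. \<integral>\<^sup>+x. ennreal (gamma_density \<alpha> t s) * ?P s x * indicator B x \<partial>lborel \<partial>lborel)"
      by (subst nn_integral_cmult[symmetric]) (auto simp: mult.assoc)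
    also have "\<dots> = (\<integral>\<^sup>+x. \<integral>\<^sup>+s. ennreal (gamma_density \<alpha> t s) * ?P s x * indicator B x \<partial>lborel \<partial>lborel)"
      by (rule lborel_pair.Fubini') measurable
    also have "\<dots> = (\<integral>\<^sup>+x. (\<integral>\<^sup>+s. ennreal (gamma_density \<alpha> t s) * ?P s x \<partial>lborel) * indicator B x \<partial>lborel)"
      by (subst nn_integral_multc) auto
    also have "\<dots> = (\<integral>\<^sup>+x. ennreal (?r x) * indicator B x \<partial>lborel)"
      by (rule nn_integral_cong_AE, use mix in eventually_elim) simp
    also have "\<dots> = emeasure (density lborel (\<lambda>x. ennreal (?r x))) B"
      by (intro emeasure_density[symmetric]) measurable
    finally show "emeasure (fixed_count_law M (random_motion c S \<theta>) (event_count S) n G) B = emeasure (density lborel (\<lambda>x. ennreal (?r x))) B" .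
  qed
qed

end
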